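(* Suppose that $\mathbf{E}[\ln\rho_0]<0$; that there exists a unique $\kappa>0$ such that $\mathbf{E}[\rho_0^{\kappa}]=1$ and $\mathbf{E}[\rho_0^{\kappa}\ln^+\rho_0]<\infty$; and that there exists $\epsilon_0>0$ such that $\mathbf{E}[\rho_0^{-\epsilon_0}]<\infty$. Let $\nu\in(0,1\wedge\kappa)$. Then, for the random walk in random environment reflected at the origin, $$\lim_{n\to\infty}\frac{\ln(-\ln P_{\tilde\omega}[T_{n^{\nu}}>n])}{\ln n}=1-\frac{\nu}{\kappa},\qquad \mathbf{P}\text{-a.s.},$$ $$\lim_{n\to\infty}\frac{\ln(-\ln P_{\tilde\omega}[X_n<n^{\nu}])}{\ln n}=\Bigl(1-\frac{\nu}{\kappa}\Bigr)\wedge\frac{\kappa}{\kappa+1},\qquad \mathbf{P}\text{-a.s.},$$ and, for the random walk in random environment without reflection, $$\lim_{n\to\infty}\frac{\ln(-\ln P_{\omega}[T_{n^{\nu}}>n])}{\ln n}=\Bigl(1-\frac{\nu}{\kappa}\Bigr)\wedge\frac{\kappa}{\kappa+1},\qquad \mathbf{P}\text{-a.s.},$$ $$\lim_{n\to\infty}\frac{\ln(-\ln P_{\omega}[X_n<n^{\nu}])}{\ln n}=\Bigl(1-\frac{\nu}{\kappa}\Bigr)\wedge\frac{\kappa}{\kappa+1},\qquad \mathbf{P}\text{-a.s.}$$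
   Context: Let $\omega=(\omega_i,\ i\in\mathbb{Z})$ be a family of i.i.d. random variables with values in $(0,1)$ (the environment); $\mathbf{P}$ is its law and $\mathbf{E}$ the corresponding expectation. Put $\rho_i=(1-\omega_i)/\omega_i$. Given $\omega$, the quenched law $P_\omega$ is the law of the nearest-neighbour Markov chain $(X_n)_{n\ge0}$ on $\mathbb{Z}$ with $X_0=0$ and $P_\omega[X_{n+1}=x+1\mid X_n=x]=\omega_x$, $P_\omega[X_{n+1}=x-1\mid X_n=x]=1-\omega_x$. The walk reflected at the origin is the walk on $\mathbb{Z}_+$ started at $0$ and defined in the same way in the environment $\tilde\omega$ with $\tilde\omega_i=\omega_i$ for $i\ne0$ and $\tilde\omega_0=1$; its quenched law is $P_{\tilde\omega}$. For $a\in\mathbb{Z}$, $T_a=\min\{n\ge0:X_n=a\}$, and for non-integer $a$, $T_a:=T_{\lfloor a\rfloor}$. Also $x\wedge y=\min(x,y)$ and $\ln^+x=\max(\ln x,0)$. *)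

theory Defs
  imports "HOL-Probability.Probability"
begin

definition rho :: "(int \<Rightarrow> real) \<Rightarrow> int \<Rightarrow> real" where
  "rho e i = (1 - e i) / e i"

definition ln_plus :: "real \<Rightarrow> real" where
  "ln_plus x = max (ln x) 0"

definition rwre_step :: "(int \<Rightarrow> real) \<Rightarrow> int \<Rightarrow> int pmf" where
  "rwre_step e x = map_pmf (\<lambda>up. if up then x + 1 else x - 1) (bernoulli_pmf (e x))"

(* Law of X_n given X_0, ..., X_{n-1}. *)
definition rwre_kernel :: "(int \<Rightarrow> real) \<Rightarrow> nat \<Rightarrow> (nat \<Rightarrow> int) \<Rightarrow> int measure" where
  "rwre_kernel e n X =
     (case n of 0 \<Rightarrow> measure_pmf (return_pmf 0) | Suc m \<Rightarrow> measure_pmf (rwre_step e (X m)))"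

lemma Ionescu_Tulcea_rwre: "Ionescu_Tulcea (rwre_kernel e) (\<lambda>_. count_space UNIV)"
proof (rule Ionescu_Tulcea.intro)
  fix i
  show "rwre_kernel e i \<in> measurable (PiM {0..<i} (\<lambda>_. count_space UNIV)) (subprob_algebra (count_space UNIV))"
  proof (cases i)
    case 0
    then show ?thesis
      by (auto simp: rwre_kernel_def[abs_def] intro!: measurable_const measure_pmf_in_subprob_algebra)
  next
    case (Suc m)
    have "(\<lambda>X. X m) \<in> measurable (PiM {0..<i} (\<lambda>_. count_space UNIV)) (count_space (UNIV::int set))"
      using Suc by (intro measurable_component_singleton) auto
    moreover have "(\<lambda>x. measure_pmf (rwre_step e x)) \<in> measurable (count_space UNIV) (subprob_algebra (count_space UNIV))"
      using measure_pmf_in_subprob_algebra by auto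
    ultimately show ?thesis
      unfolding rwre_kernel_def[abs_def] Suc by simp
  qed
next
  fix i :: nat and x :: "nat \<Rightarrow> int"
  show "prob_space (rwre_kernel e i x)"
    by (cases i) (simp_all add: rwre_kernel_def measure_pmf.prob_space_axioms)
qed

(* The law of the whole trajectory (X_n), started at 0, in the environment e: the measure on the
   path space that the Ionescu-Tulcea theorem builds from the kernels above. *)
definition quenched :: "(int \<Rightarrow> real) \<Rightarrow> (nat \<Rightarrow> int) measure" where
  "quenched e =
     projective_family.lim UNIV (Ionescu_Tulcea.CI (rwre_kernel e) (\<lambda>_. count_space UNIV))
       (\<lambda>_. count_space UNIV)"

(* The walk in this environment, started at 0, stays in the nonnegative integers. *)
definition reflect_env :: "(int \<Rightarrow> real) \<Rightarrow> int \<Rightarrow> real" where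
  "reflect_env e = e(0 := 1)"

(* The infimum of the empty set is infinity in enat, so a level that is never hit gets infinity. *)
definition hitting_time :: "int \<Rightarrow> (nat \<Rightarrow> int) \<Rightarrow> enat" where
  "hitting_time a X = Inf (enat ` {n. X n = a})"

lemma pmf_rwre_step:
  assumes "0 \<le> e x" "e x \<le> 1"
  shows "pmf (rwre_step e x) (x + 1) = e x" "pmf (rwre_step e x) (x - 1) = 1 - e x"
proof -
  have "(\<lambda>up. if up then x + 1 else x - 1) -` {x + 1} = {True}"
    and "(\<lambda>up. if up then x + 1 else x - 1) -` {x - 1} = {False}"
    by (auto split: if_splits)
  then show "pmf (rwre_step e x) (x + 1) = e x" "pmf (rwre_step e x) (x - 1) = 1 - e x"
    using assms by (simp_all add: rwre_step_def pmf_map measure_pmf_single)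
qed

lemma space_quenched: "space (quenched e) = UNIV"
  and sets_quenched: "sets (quenched e) = sets (PiM UNIV (\<lambda>_. count_space UNIV))"
  and prob_space_quenched: "prob_space (quenched e)"
proof -
  interpret Ionescu_Tulcea "rwre_kernel e" "\<lambda>_. count_space UNIV" by (rule Ionescu_Tulcea_rwre)
  show sp: "space (quenched e) = UNIV" by (simp add: quenched_def space_PiM)
  show "sets (quenched e) = sets (PiM UNIV (\<lambda>_. count_space UNIV))" by (simp add: quenched_def)
  show "prob_space (quenched e)"
  proof
    interpret CI: prob_space "CI {}" by (rule PF.prob_space_P) auto
    have "emeasure PF.lim (PF.emb UNIV {} (space (PiM {} (\<lambda>_. count_space UNIV))))
        = emeasure (CI {}) (space (PiM {} (\<lambda>_. count_space UNIV)))"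
      by (rule lim) auto
    moreover have "space (CI {}) = space (PiM {} (\<lambda>_. count_space UNIV))"
      by (simp add: CI_def)
    moreover have "PF.emb UNIV {} (space (PiM {} (\<lambda>_. count_space UNIV))) = UNIV"
      by (auto simp: prod_emb_def space_PiM)
    ultimately show "emeasure (quenched e) (space (quenched e)) = 1"
      unfolding sp using CI.emeasure_space_1 by (simp add: quenched_def)
  qed
qed

lemma prob_quenched_path:
  "measure (quenched e) {X. \<forall>k\<le>n. X k = p k} =
     (if p 0 = 0 then \<Prod>k<n. pmf (rwre_step e (p k)) (p (Suc k)) else 0)"
proof -
  interpret Ionescu_Tulcea "rwre_kernel e" "\<lambda>_. count_space UNIV" by (rule Ionescu_Tulcea_rwre)
  let ?M = "\<lambda>_::nat. count_space (UNIV::int set)"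
  let ?r = "\<lambda>n. restrict p {0..<n}"
  have sing: "{?r n} \<in> sets (PiM {0..<n} ?M)" for n
  proof -
    have "{?r n} = (\<Pi>\<^sub>E k\<in>{0..<n}. {p k})"
      by (auto simp: PiE_iff extensional_def fun_eq_iff)
    then show ?thesis by (auto intro!: sets_PiM_I_finite)
  qed
  have eP: "emeasure (eP n x) {?r (Suc n)} =
      emeasure (rwre_kernel e n (?r n)) {p n} * indicator {?r n} x"
    if x: "x \<in> space (PiM {0..<n} ?M)" for n x
  proof -
    have "(\<lambda>y. x(n := y)) -` {?r (Suc n)} \<inter> space (count_space UNIV) = (if x = ?r n then {p n} else {})"
    proof -
      have "x(n := y) = ?r (Suc n) \<longleftrightarrow> x = ?r n \<and> y = p n" for y
      proof
        assume eq: "x(n := y) = ?r (Suc n)"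
        have "x k = ?r n k" for k
          using fun_cong[OF eq, of k] x
          by (cases "k < n") (auto simp: space_PiM PiE_iff extensional_def)
        moreover have "y = p n" using fun_cong[OF eq, of n] by simp
        ultimately show "x = ?r n \<and> y = p n" by auto
      qed (auto simp: fun_eq_iff less_Suc_eq)
      then show ?thesis by auto
    qed
    then show ?thesis
      by (subst emeasure_eP[OF x sing]) (auto split: split_indicator)
  qed
  have "emeasure (C 0 (Suc n) (\<lambda>_. undefined)) {?r (Suc n)} =
      emeasure (C 0 n (\<lambda>_. undefined)) {?r n} * emeasure (rwre_kernel e n (?r n)) {p n}" for n
  proof -
    have und: "(\<lambda>_. undefined) \<in> space (PiM {0..<0} ?M)" by (simp add: space_PiM)
    have meas: "eP n \<in> measurable (C 0 n (\<lambda>_. undefined)) (subprob_algebra (PiM {0..<Suc n} ?M))"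
      using measurable_eP[of n] by (simp add: measurable_cong_sets[OF sets_C[OF und] refl])
    have "emeasure (C 0 (Suc n) (\<lambda>_. undefined)) {?r (Suc n)} =
        (\<integral>\<^sup>+x. emeasure (eP n x) {?r (Suc n)} \<partial>C 0 n (\<lambda>_. undefined))"
      using meas prob_space.not_empty[OF prob_space_C[OF und]] sing
      by (simp add: emeasure_bind)
    also have "\<dots> = (\<integral>\<^sup>+x. emeasure (rwre_kernel e n (?r n)) {p n} * indicator {?r n} x \<partial>C 0 n (\<lambda>_. undefined))"
      using space_C[OF und] by (intro nn_integral_cong eP) auto
    also have "\<dots> = emeasure (rwre_kernel e n (?r n)) {p n} * emeasure (C 0 n (\<lambda>_. undefined)) {?r n}"
      using sing[of n] sets_C[OF und, of n] by (intro nn_integral_cmult_indicator) simp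
    finally show ?thesis by (simp add: mult.commute)
  qed
  note step = this
  have C: "emeasure (C 0 (Suc n) (\<lambda>_. undefined)) {?r (Suc n)} =
      ennreal (if p 0 = 0 then \<Prod>k<n. pmf (rwre_step e (p k)) (p (Suc k)) else 0)" for n
  proof (induction n)
    case 0
    show ?case
      by (subst step) (auto simp: rwre_kernel_def emeasure_return space_PiM restrict_def
          emeasure_pmf_single sing[of 0, simplified restrict_def, simplified] split: split_indicator)
  next
    case (Suc n)
    show ?case
      by (subst step, subst Suc)
        (auto simp: rwre_kernel_def emeasure_pmf_single ennreal_mult prod_nonneg)
  qed
  have set: "{X. \<forall>k\<le>n. X k = p k} = PF.emb UNIV {0..<Suc n} {?r (Suc n)}"
  proof -
    have "(\<forall>k\<le>n. X k = p k) \<longleftrightarrow> restrict X {0..<Suc n} = ?r (Suc n)" for X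
      by (auto simp: restrict_def fun_eq_iff less_Suc_eq_le split: if_splits)
    then show ?thesis by (auto simp: prod_emb_def space_PiM)
  qed
  have "emeasure (quenched e) {X. \<forall>k\<le>n. X k = p k} = emeasure (CI {0..<Suc n}) {?r (Suc n)}"
    unfolding set quenched_def using sing[of "Suc n"] by (intro lim) auto
  also have "\<dots> = emeasure (C 0 (Suc n) (\<lambda>_. undefined)) {?r (Suc n)}"
  proof (subst emeasure_CI[of _ "Suc n"])
    have "PF.emb {0..<Suc n} {0..<Suc n} {?r (Suc n)} = {?r (Suc n)}"
      using sets.sets_into_space[OF sing[of "Suc n"]] by (intro prod_emb_id) (auto simp: space_PiM)
    then show "emeasure (C 0 (Suc n) (\<lambda>_. undefined)) (PF.emb {0..<Suc n} {0..<Suc n} {?r (Suc n)})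
        = emeasure (C 0 (Suc n) (\<lambda>_. undefined)) {?r (Suc n)}" by simp
  qed (use sing[of "Suc n"] in auto)
  finally show ?thesis
    using C[of n] by (simp add: measure_def prod_nonneg)
qed

end

theory Submission
  imports Defs "HOL-Real_Asymp.Real_Asymp"
begin

text \<open>
  Every quenched probability is estimated by comparing the recursion for a killed walk with explicit
  sub- and supersolutions. Write \<open>V\<close> for the potential, \<open>V k - V (k - 1) = ln \<rho>\<^sub>k\<close>.

  Lower bounds. Among \<open>m\<close> consecutive sites there are \<open>i < j\<close> with
  \<open>V (j - 1) - V i \<ge> p ln m\<close>, for every \<open>p < 1 / \<kappa>\<close>. From \<open>i\<close> the walk crosses to \<open>j\<close> before
  returning with probability at most \<open>m powr (- p)\<close>, so it stays to the left of \<open>j\<close> for time \<open>n\<close>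
  with probability at least about \<open>exp (- 2 n m powr (- p))\<close>. With \<open>m = n\<^sup>\<nu>\<close> this gives the
  exponent \<open>1 - \<nu> / \<kappa>\<close>. Walking \<open>m = n\<^sup>a\<close> steps to the left costs \<open>exp (- n\<^sup>a)\<close> up to
  subpolynomial factors in the exponent, and \<open>a = 1 - a / \<kappa>\<close> balances it against such a trap on
  the negative half line (or, for the reflected walk, against the way back from a trap beyond
  \<open>n\<^sup>\<nu>\<close>): this is \<open>a = \<kappa> / (\<kappa> + 1)\<close>.

  Upper bounds. The perpetuity \<open>W i = 1 + \<rho>\<^sub>i + (1 + \<delta>) \<rho>\<^sub>i W (i - 1)\<close> bounds the expected crossing
  time of \<open>(i, i + 1)\<close>, and the slack \<open>\<delta>\<close> absorbs the quadratic terms, so that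
  \<open>\<Prod> (1 + 2 \<mu> W i)\<close> is a supersolution for the exponential moment of order \<open>\<mu>\<close> of the hitting time
  as long as \<open>2 \<mu> W i \<le> \<delta>\<close>. Its moments of order less than \<open>\<kappa>\<close> are finite for small \<open>\<delta>\<close>, so \<open>\<mu>\<close>
  may be a power of \<open>n\<close> with exponent just below \<open>- b / \<kappa>\<close> on a window of size \<open>n\<^sup>b\<close>. Excursions
  far to the left are controlled by the harmonic function \<open>\<phi> x = (\<Sum>k\<ge>x. exp (V k))\<close>.
\<close>

section \<open>Killed walks and quenched probabilities\<close>

text \<open>
  The probability that the walk started at \<open>x\<close> is in \<open>A\<close> at the times \<open>0, \<dots>, n - 1\<close> and in \<open>B\<close>
  at time \<open>n\<close>.
\<close>

primrec survive :: "(int \<Rightarrow> real) \<Rightarrow> int set \<Rightarrow> int set \<Rightarrow> nat \<Rightarrow> int \<Rightarrow> real" where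
  "survive e A B 0 x = indicator B x"
| "survive e A B (Suc n) x =
     indicator A x * (e x * survive e A B n (x + 1) + (1 - e x) * survive e A B n (x - 1))"

lemma measurable_coordinate [measurable]:
  "(\<lambda>X. X k) \<in> measurable (quenched e) (count_space UNIV)"
  by (subst measurable_cong_sets[OF sets_quenched refl]) (rule measurable_component_singleton, simp)

lemma sets_quenched_Collect:
  assumes "Measurable.pred (quenched e) P"
  shows "{X. P X} \<in> sets (quenched e)"
  using assms by (simp add: pred_def space_quenched)

lemma prob_quenched_prefix_step:
  assumes "0 \<le> e (p j)" "e (p j) \<le> 1"
  shows "measure (quenched e) {X. \<forall>k\<le>Suc j. X k = (p(Suc j := p j + 1)) k} =
           measure (quenched e) {X. \<forall>k\<le>j. X k = p k} * e (p j)"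
    and "measure (quenched e) {X. \<forall>k\<le>Suc j. X k = (p(Suc j := p j - 1)) k} =
           measure (quenched e) {X. \<forall>k\<le>j. X k = p k} * (1 - e (p j))"
proof -
  have "(\<Prod>k<j. pmf (rwre_step e ((p(Suc j := y)) k)) ((p(Suc j := y)) (Suc k))) =
      (\<Prod>k<j. pmf (rwre_step e (p k)) (p (Suc k)))" for y
    by (rule prod.cong) auto
  then show "measure (quenched e) {X. \<forall>k\<le>Suc j. X k = (p(Suc j := p j + 1)) k} =
           measure (quenched e) {X. \<forall>k\<le>j. X k = p k} * e (p j)"
    and "measure (quenched e) {X. \<forall>k\<le>Suc j. X k = (p(Suc j := p j - 1)) k} =
           measure (quenched e) {X. \<forall>k\<le>j. X k = p k} * (1 - e (p j))"
    unfolding prob_quenched_path by (auto simp: pmf_rwre_step[of e "p j", OF assms])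
qed

lemma prob_quenched_prefix_survive:
  assumes e: "\<And>x. 0 \<le> e x" "\<And>x. e x \<le> 1"
  shows "measure (quenched e) {X. (\<forall>k\<le>j. X k = p k) \<and> (\<forall>k<n. X (j + k) \<in> A) \<and> X (j + n) \<in> B} =
           measure (quenched e) {X. \<forall>k\<le>j. X k = p k} * survive e A B n (p j)"
proof (induction n arbitrary: j p)
  case 0
  have "{X. (\<forall>k\<le>j. X k = p k) \<and> X j \<in> B} = (if p j \<in> B then {X. \<forall>k\<le>j. X k = p k} else {})"
    by auto
  then show ?case by auto
next
  case (Suc n)
  interpret prob_space "quenched e" by (rule prob_space_quenched)
  define pp where "pp y = p(Suc j := y)" for y
  define C where "C = {X. \<forall>k\<le>j. X k = p k}"
  define E where "E = {X. (\<forall>k\<le>j. X k = p k) \<and> (\<forall>k<Suc n. X (j + k) \<in> A) \<and> X (j + Suc n) \<in> B}"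
  define D where "D y = {X. \<forall>k\<le>Suc j. X k = pp y k}" for y
  define F where "F y = {X. (\<forall>k\<le>Suc j. X k = pp y k) \<and> (\<forall>k<n. X (Suc j + k) \<in> A) \<and> X (Suc j + n) \<in> B}" for y
  have ms: "C \<in> events" "E \<in> events" "D y \<in> events" "F y \<in> events" for y
    unfolding C_def E_def D_def F_def by (intro sets_quenched_Collect, measurable)+
  show ?case
  proof (cases "p j \<in> A")
    case False
    then have "E = {}" by (auto simp: E_def)
    with False show ?thesis unfolding E_def[symmetric] by simp
  next
    case True
    have D: "D y \<inter> E = F y" for y
    proof -
      have "(\<forall>k<Suc n. X (j + k) \<in> A) \<longleftrightarrow> X j \<in> A \<and> (\<forall>k<n. X (Suc j + k) \<in> A)" for X
        by (auto simp: less_Suc_eq_0_disj)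
      moreover have "(\<forall>k\<le>Suc j. X k = pp y k) \<longleftrightarrow> (\<forall>k\<le>j. X k = p k) \<and> X (Suc j) = y" for X
        by (auto simp: pp_def le_Suc_eq)
      ultimately show ?thesis using True by (auto simp: D_def E_def F_def)
    qed
    have DC: "D y \<subseteq> C" for y
      by (auto simp: D_def C_def pp_def split: if_splits)
    have disj: "D (p j + 1) \<inter> D (p j - 1) = {}"
      by (auto simp: D_def pp_def) 
    have pp: "pp y (Suc j) = y" for y by (simp add: pp_def)
    have mD: "measure (quenched e) (D (p j + 1)) = measure (quenched e) C * e (p j)"
      "measure (quenched e) (D (p j - 1)) = measure (quenched e) C * (1 - e (p j))"
      using prob_quenched_prefix_step[of e p j] e by (auto simp: D_def C_def pp_def)
    have "measure (quenched e) (D (p j + 1) \<union> D (p j - 1)) = measure (quenched e) C"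
      using disj ms by (subst finite_measure_Union) (auto simp: mD[simplified] distrib_left[symmetric] right_diff_distrib mult.commute)
    then have null: "measure (quenched e) (C - (D (p j + 1) \<union> D (p j - 1))) = 0"
      using ms DC by (subst finite_measure_Diff) auto
    have "measure (quenched e) E = measure (quenched e) (E \<inter> (D (p j + 1) \<union> D (p j - 1))) + measure (quenched e) (E - (D (p j + 1) \<union> D (p j - 1)))"
      using ms by (subst finite_measure_Union[symmetric]) (auto intro!: arg_cong[where f = "measure _"])
    moreover have "measure (quenched e) (E - (D (p j + 1) \<union> D (p j - 1))) \<le> 0"
      unfolding null[symmetric] using ms by (intro finite_measure_mono) (auto simp: E_def C_def)
    ultimately have "measure (quenched e) E = measure (quenched e) (E \<inter> (D (p j + 1) \<union> D (p j - 1)))"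
      using measure_nonneg[of "quenched e"] by (metis add.right_neutral order_antisym)
    also have "E \<inter> (D (p j + 1) \<union> D (p j - 1)) = F (p j + 1) \<union> F (p j - 1)"
      using D by blast
    also have "measure (quenched e) \<dots> = measure (quenched e) (F (p j + 1)) + measure (quenched e) (F (p j - 1))"
      using ms disj by (intro finite_measure_Union) (auto simp: D[symmetric])
    also have "\<dots> = measure (quenched e) C * survive e A B (Suc n) (p j)"
      unfolding F_def Suc.IH D_def[symmetric] pp mD using True by (simp add: algebra_simps)
    finally show ?thesis unfolding E_def C_def .
  qed
qed

lemma prob_quenched_survive:
  assumes e: "\<And>x. 0 \<le> e x" "\<And>x. e x \<le> 1"
  shows "measure (quenched e) {X. (\<forall>k<n. X k \<in> A) \<and> X n \<in> B} = survive e A B n 0"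
proof -
  interpret prob_space "quenched e" by (rule prob_space_quenched)
  have 1: "measure (quenched e) {X. X 0 = 0} = 1"
    using prob_quenched_path[of e 0 "\<lambda>_. 0"] by simp
  have s: "{X. X 0 = (0::int)} \<in> events"
    by (intro sets_quenched_Collect) measurable
  have "AE X in quenched e. X 0 = 0"
    using 1 s by (subst (asm) prob_eq_1) (auto simp: space_quenched)
  then have "measure (quenched e) {X. (\<forall>k<n. X k \<in> A) \<and> X n \<in> B} =
      measure (quenched e) {X. (\<forall>k\<le>0. X k = 0) \<and> (\<forall>k<n. X (0 + k) \<in> A) \<and> X (0 + n) \<in> B}"
    by (intro measure_eq_AE sets_quenched_Collect) auto
  also have "\<dots> = measure (quenched e) {X. \<forall>k\<le>0. X k = 0} * survive e A B n 0"
    using prob_quenched_prefix_survive[of e 0 "\<lambda>_. 0" n A B] e by simp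
  finally show ?thesis using 1 by simp
qed

lemma hitting_time_greater_iff: "enat n < hitting_time a X \<longleftrightarrow> (\<forall>k\<le>n. X k \<noteq> a)"
proof
  assume h: "enat n < hitting_time a X"
  show "\<forall>k\<le>n. X k \<noteq> a"
  proof (intro allI impI notI)
    fix k assume "k \<le> n" "X k = a"
    then have "hitting_time a X \<le> enat k"
      unfolding hitting_time_def by (intro Inf_lower) auto
    with h \<open>k \<le> n\<close> show False by (metis enat_ord_simps(1) leD order_trans)
  qed
next
  assume h: "\<forall>k\<le>n. X k \<noteq> a"
  have "enat (Suc n) \<le> hitting_time a X"
    unfolding hitting_time_def using h by (intro Inf_greatest) (force simp: not_less_eq_eq[symmetric])
  then show "enat n < hitting_time a X"
    by (metis Suc_ile_eq)
qed

lemma prob_hitting_time_greater: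
  assumes "\<And>x. 0 \<le> e x" "\<And>x. e x \<le> 1"
  shows "\<P>(X in quenched e. hitting_time a X > enat n) = survive e (- {a}) (- {a}) n 0"
proof -
  have "{X \<in> space (quenched e). hitting_time a X > enat n} = {X. (\<forall>k<n. X k \<in> - {a}) \<and> X n \<in> - {a}}"
    by (auto simp: space_quenched hitting_time_greater_iff le_less)
  then show ?thesis using prob_quenched_survive[of e n "- {a}" "- {a}"] assms by simp
qed

lemma prob_position_less:
  assumes "\<And>x. 0 \<le> e x" "\<And>x. e x \<le> 1"
  shows "\<P>(X in quenched e. real_of_int (X n) < y) = survive e UNIV {x. real_of_int x < y} n 0"
proof -
  have "{X \<in> space (quenched e). real_of_int (X n) < y} = {X. (\<forall>k<n. X k \<in> UNIV) \<and> X n \<in> {x. real_of_int x < y}}"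
    by (auto simp: space_quenched)
  then show ?thesis using prob_quenched_survive[of e n UNIV "{x. real_of_int x < y}"] assms by simp
qed

lemma survive_nonneg:
  assumes "\<And>x. 0 \<le> e x" "\<And>x. e x \<le> 1"
  shows "0 \<le> survive e A B n x"
  using assms by (induction n arbitrary: x) auto

lemma survive_mono:
  assumes e: "\<And>x. 0 \<le> e x" "\<And>x. e x \<le> 1" and sub: "A \<subseteq> A'" "B \<subseteq> B'"
  shows "survive e A B n x \<le> survive e A' B' n x"
proof (induction n arbitrary: x)
  case (Suc n)
  have "e x * survive e A B n (x + 1) + (1 - e x) * survive e A B n (x - 1)
      \<le> e x * survive e A' B' n (x + 1) + (1 - e x) * survive e A' B' n (x - 1)"
    using Suc e by (intro add_mono mult_left_mono) auto
  moreover have "0 \<le> e x * survive e A' B' n (x + 1) + (1 - e x) * survive e A' B' n (x - 1)"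
    using e by (auto intro!: add_nonneg_nonneg mult_nonneg_nonneg survive_nonneg)
  ultimately show ?case using sub by (auto simp: indicator_def)
qed (use sub in \<open>auto simp: indicator_def\<close>)

lemma survive_le:
  assumes e: "\<And>x. 0 \<le> e x" "\<And>x. e x \<le> 1"
    and D: "\<And>x. x \<in> D \<Longrightarrow> x \<in> A \<Longrightarrow> x + 1 \<in> D \<and> (x - 1 \<in> D \<or> e x = 1)"
    and init: "\<And>x. x \<in> D \<Longrightarrow> indicator B x \<le> f 0 x"
    and nonneg: "\<And>n x. x \<in> D \<Longrightarrow> 0 \<le> f n x"
    and step: "\<And>n x. x \<in> D \<Longrightarrow> x \<in> A \<Longrightarrow> e x * f n (x + 1) + (1 - e x) * f n (x - 1) \<le> f (Suc n) x"
    and "x \<in> D"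
  shows "survive e A B n x \<le> f n x"
  using \<open>x \<in> D\<close>
proof (induction n arbitrary: x)
  case (Suc n)
  show ?case
  proof (cases "x \<in> A")
    case True
    have "e x * survive e A B n (x + 1) \<le> e x * f n (x + 1)"
      using Suc D True e by (intro mult_left_mono) auto
    moreover have "(1 - e x) * survive e A B n (x - 1) \<le> (1 - e x) * f n (x - 1)"
      using Suc.IH[of "x - 1"] D[OF Suc.prems True] e(2)[of x] by (auto intro: mult_left_mono)
    ultimately show ?thesis using step[OF Suc.prems True, of n] True by simp
  qed (use Suc.prems nonneg in auto)
qed (use init in auto)

lemma survive_ge:
  assumes e: "\<And>x. 0 \<le> e x" "\<And>x. e x \<le> 1"
    and D: "\<And>x. x \<in> D \<Longrightarrow> x \<in> A \<Longrightarrow> x + 1 \<in> D \<and> (x - 1 \<in> D \<or> e x = 1)"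
    and init: "\<And>x. x \<in> D \<Longrightarrow> f 0 x \<le> indicator B x"
    and outside: "\<And>n x. x \<in> D \<Longrightarrow> x \<notin> A \<Longrightarrow> f (Suc n) x \<le> 0"
    and step: "\<And>n x. x \<in> D \<Longrightarrow> x \<in> A \<Longrightarrow> f (Suc n) x \<le> e x * f n (x + 1) + (1 - e x) * f n (x - 1)"
    and "x \<in> D"
  shows "f n x \<le> survive e A B n x"
  using \<open>x \<in> D\<close>
proof (induction n arbitrary: x)
  case (Suc n)
  show ?case
  proof (cases "x \<in> A")
    case True
    have "e x * f n (x + 1) \<le> e x * survive e A B n (x + 1)"
      using Suc D True e by (intro mult_left_mono) auto
    moreover have "(1 - e x) * f n (x - 1) \<le> (1 - e x) * survive e A B n (x - 1)"
      using Suc.IH[of "x - 1"] D[OF Suc.prems True] e(2)[of x] by (auto intro: mult_left_mono)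
    ultimately show ?thesis using step[OF Suc.prems True, of n] True by simp
  qed (use Suc.prems outside in auto)
qed (use init in auto)

lemma survive_le_1:
  assumes "\<And>x. 0 \<le> e x" "\<And>x. e x \<le> 1"
  shows "survive e A B n x \<le> 1"
  using survive_le[of e, OF assms, of UNIV A B "\<lambda>_ _. 1"] by (auto simp: indicator_def)

lemma survive_add_ge:
  assumes e: "\<And>x. 0 \<le> e x" "\<And>x. e x \<le> 1"
    and "0 \<le> c" and c: "\<And>y. y \<in> A \<Longrightarrow> c \<le> survive e UNIV B l y"
  shows "c * survive e A A n x \<le> survive e UNIV B (n + l) x"
proof (induction n arbitrary: x)
  case 0
  show ?case using c[of x] survive_nonneg[of e, OF e, of UNIV B l x] by (auto simp: indicator_def)
next
  case (Suc n)
  have "c * (e x * survive e A A n (x + 1) + (1 - e x) * survive e A A n (x - 1))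
      = e x * (c * survive e A A n (x + 1)) + (1 - e x) * (c * survive e A A n (x - 1))"
    by (simp add: algebra_simps)
  also have "\<dots> \<le> e x * survive e UNIV B (n + l) (x + 1) + (1 - e x) * survive e UNIV B (n + l) (x - 1)"
    using Suc e by (intro add_mono mult_left_mono) auto
  finally show ?case
    using survive_nonneg[of e, OF e, of UNIV B "Suc n + l" x] by (auto simp: indicator_def)
qed

lemma survive_ge_prod_down:
  assumes e: "\<And>x. 0 \<le> e x" "\<And>x. e x \<le> 1"
    and A: "\<And>k. k < l \<Longrightarrow> x - int k \<in> A"
  shows "(\<Prod>k<l. 1 - e (x - int k)) * survive e A B n (x - int l) \<le> survive e A B (n + l) x"
  using A
proof (induction l arbitrary: x)
  case (Suc l)
  have "(\<Prod>k<Suc l. 1 - e (x - int k)) * survive e A B n (x - int (Suc l))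
      = (1 - e x) * ((\<Prod>k<l. 1 - e (x - 1 - int k)) * survive e A B n (x - 1 - int l))"
    by (subst prod.lessThan_Suc_shift) (simp add: algebra_simps)
  also have "\<dots> \<le> (1 - e x) * survive e A B (n + l) (x - 1)"
    using Suc.prems[of "Suc _"] e by (intro mult_left_mono Suc.IH) (auto simp: algebra_simps)
  also have "\<dots> \<le> survive e A B (Suc (n + l)) x"
    using Suc.prems[of 0] e survive_nonneg[of e, OF e, of A B "n + l" "x + 1"] by simp
  finally show ?case by simp
qed simp

lemma survive_antimono_time:
  assumes e: "\<And>x. 0 \<le> e x" "\<And>x. e x \<le> 1" and "n \<le> n'"
  shows "survive e A A n' x \<le> survive e A A n x"
proof -
  have "survive e A A (Suc n) x \<le> survive e A A n x" for n x
  proof (induction n arbitrary: x)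
    case 0
    show ?case using e[of x] e[of "x+1"] by (auto simp: indicator_def)
  next
    case (Suc n)
    show ?case
      unfolding survive.simps(2)[of e A A "Suc n" x] survive.simps(2)[of e A A n x]
      using e Suc.IH by (intro mult_left_mono add_mono) (auto simp del: survive.simps)
  qed
  then show ?thesis
    using \<open>n \<le> n'\<close> by (rule lift_Suc_antimono_le[where f = "\<lambda>n. survive e A A n x"])
qed

text \<open>
  The subsolution is \<open>(1 - q) ^ n * h x\<close>, where \<open>h\<close> is the probability of hitting \<open>i\<close> before \<open>j\<close>; it
  loses the factor \<open>1 - q\<close> only at \<open>i\<close>.
\<close>

lemma survive_trap:
  fixes E :: "int \<Rightarrow> real"
  assumes e: "\<And>x. 0 \<le> e x" "\<And>x. e x \<le> 1" and "i < j"
    and E: "\<And>x. 0 < E x" "\<And>x. i < x \<Longrightarrow> x < j \<Longrightarrow> e x * E x = (1 - e x) * E (x - 1)"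
    and trap: "E i \<le> E (j - 1)"
    and A: "\<And>x. x \<in> A \<Longrightarrow> x < j" "\<And>x. x \<in> A \<Longrightarrow> x + 1 < j \<Longrightarrow> x + 1 \<in> A"
      "\<And>x. x \<in> A \<Longrightarrow> x - 1 \<in> A \<or> e x = 1"
    and x: "x \<in> A" "x \<le> i"
  shows "(1 - E i / E (j - 1)) ^ n \<le> survive e A A n x"
proof -
  define Z where "Z = (\<Sum>k\<in>{i..<j}. E k)"
  define q where "q = E i / E (j - 1)"
  define h where "h x = (if x \<le> i then 1 else (\<Sum>k\<in>{x..<j}. E k) / Z)" for x
  have q: "0 \<le> q" "q \<le> 1" using E(1)[of i] E(1)[of "j-1"] trap by (auto simp: q_def)
  have "E (j - 1) \<le> Z"
    unfolding Z_def using \<open>i < j\<close> by (intro member_le_sum) (auto intro: less_imp_le E)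
  then have Z: "0 < Z" "E i / Z \<le> q"
    using E(1)[of i] E(1)[of "j-1"] by (auto simp: q_def intro!: divide_left_mono mult_pos_pos)
  have split: "(\<Sum>k\<in>{x..<j}. E k) = E x + (\<Sum>k\<in>{x+1..<j}. E k)" if "x < j" for x
  proof -
    have "{x..<j} = insert x {x+1..<j}" using that by auto
    then show ?thesis by simp
  qed
  have h_ge: "h x = (\<Sum>k\<in>{x..<j}. E k) / Z" if "i \<le> x" for x
    using that Z by (auto simp: h_def Z_def)
  have h: "0 \<le> h x" "h x \<le> 1" for x
  proof -
    have "(\<Sum>k\<in>{x..<j}. E k) \<le> Z" if "i \<le> x"
      unfolding Z_def using that E by (intro sum_mono2) (auto intro: less_imp_le)
    then show "0 \<le> h x" "h x \<le> 1"
      using Z by (auto simp: h_def intro!: divide_nonneg_nonneg sum_nonneg less_imp_le[OF E(1)])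
  qed
  have super: "(1 - q) * h x \<le> e x * h (x + 1) + (1 - e x) * h (x - 1)" if "x < j" for x
  proof -
    consider "x < i" | "x = i" | "i < x" by linarith
    then show ?thesis
    proof cases
      case 1 then show ?thesis using q by (simp add: h_def)
    next
      case 2
      have "h (i + 1) = 1 - E i / Z"
        using split[of i] \<open>i < j\<close> Z by (simp add: h_ge Z_def[symmetric] field_simps)
      then have "1 - q \<le> h (i + 1)" using Z by simp
      moreover have "(1 - e i) * h (i + 1) \<le> (1 - e i) * 1"
        using h e by (intro mult_left_mono) auto
      ultimately have "1 - q \<le> e i * h (i + 1) + (1 - e i)" by (simp add: algebra_simps)
      then show ?thesis using 2 by (simp add: h_def)
    next
      case 3
      have "e x * h (x + 1) + (1 - e x) * h (x - 1) = h x + ((1 - e x) * E (x - 1) - e x * E x) / Z"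
        using 3 that split[of x] split[of "x - 1"] Z by (simp add: h_ge field_simps)
      also have "\<dots> = h x" using E(2)[of x] 3 that by simp
      finally show ?thesis using q h[of x] by (simp add: mult_left_le_one_le)
    qed
  qed
  have "(1 - q) ^ n * h x \<le> survive e A A n x"
  proof (rule survive_ge[of e "A \<union> {j}"])
    show "x + 1 \<in> A \<union> {j} \<and> (x - 1 \<in> A \<union> {j} \<or> e x = 1)" if "x \<in> A \<union> {j}" "x \<in> A" for x
      using A[of x] that by (cases "x + 1 = j") auto
    show "(1 - q) ^ 0 * h x \<le> indicator A x" if "x \<in> A \<union> {j}" for x
      using that h[of x] h_ge[of j] \<open>i < j\<close> by (cases "x \<in> A") auto
    show "(1 - q) ^ Suc n * h x \<le> 0" if "x \<in> A \<union> {j}" "x \<notin> A" for n x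
      using that h_ge[of j] \<open>i < j\<close> by auto
    show "(1 - q) ^ Suc n * h x \<le> e x * ((1 - q) ^ n * h (x + 1)) + (1 - e x) * ((1 - q) ^ n * h (x - 1))"
      if "x \<in> A" for n x
      using mult_left_mono[OF super[OF A(1)[OF that]], of "(1 - q) ^ n"] q by (simp add: algebra_simps)
  qed (use e x in auto)
  then show ?thesis using x by (simp add: h_def q_def)
qed

lemma exp_le_one_plus_double:
  fixes \<mu> :: real
  assumes "0 \<le> \<mu>" "\<mu> \<le> 1/2"
  shows "exp \<mu> \<le> 1 + 2 * \<mu>"
proof -
  have "1 - \<mu> \<le> exp (- \<mu>)" using exp_ge_add_one_self[of "- \<mu>"] by simp
  then have "exp \<mu> \<le> 1 / (1 - \<mu>)" using assms by (simp add: exp_minus field_simps)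
  also have "\<dots> \<le> 1 + 2 * \<mu>"
  proof -
    have "\<mu> * \<mu> \<le> \<mu> * (1/2)" using assms by (intro mult_left_mono) auto
    then show ?thesis using assms by (simp add: field_simps)
  qed
  finally show ?thesis .
qed

text \<open>
  With \<open>u = W i\<close> and \<open>v = W (i - 1)\<close> this is the one-step supersolution property of
  \<open>\<Prod> (1 + 2 \<mu> W i)\<close>, divided by the factors to the right of \<open>i\<close>.
\<close>

lemma exp_step_le:
  fixes w \<mu> \<delta> u v :: real
  assumes "0 < w" "w < 1" "0 < \<mu>" "0 < \<delta>" "\<delta> \<le> 1" "0 \<le> v"
    and u: "u = 1 + (1 - w) / w + (1 + \<delta>) * ((1 - w) / w) * v" and small: "2 * \<mu> * u \<le> \<delta>"
  shows "exp \<mu> * (w + (1 - w) * ((1 + 2 * \<mu> * v) * (1 + 2 * \<mu> * u))) \<le> 1 + 2 * \<mu> * u"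
proof -
  define r where "r = (1 - w) / w"
  define a where "a = 2 * \<mu> * u"
  define b where "b = 2 * \<mu> * v"
  have r: "0 < r" "w * r = 1 - w" "w * (1 + r) = 1" using assms by (auto simp: r_def field_simps)
  have b: "0 \<le> b" using assms by (simp add: b_def)
  have a_eq: "a = 2 * \<mu> * (1 + r) + (1 + \<delta>) * r * b"
    using u by (simp add: a_def b_def r_def algebra_simps)
  have "0 \<le> (1 + \<delta>) * r * b" using r b assms by simp
  then have "2 * \<mu> * (1 + r) \<le> 1" and a0: "0 \<le> a" using a_eq small assms r by (auto simp: a_def)
  moreover have "2 * \<mu> * 1 \<le> 2 * \<mu> * (1 + r)" using assms r by (intro mult_left_mono) auto
  ultimately have lam: "\<mu> \<le> 1/2" by simp
  have "0 \<le> \<mu> * (1 + r) * (1 - a) + r * b * (\<delta> - a)"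
    using assms r b small by (intro add_nonneg_nonneg mult_nonneg_nonneg) (auto simp: a_def)
  also have "\<dots> = (1 - \<mu>) * (1 + a) * (1 + r) - (1 + r * ((1 + b) * (1 + a)))"
    using a_eq by algebra
  finally have "1 + r * ((1 + b) * (1 + a)) \<le> (1 - \<mu>) * (1 + a) * (1 + r)" by simp
  then have "w * (1 + r * ((1 + b) * (1 + a))) \<le> w * ((1 - \<mu>) * (1 + a) * (1 + r))"
    using assms by (intro mult_left_mono) auto
  also have "\<dots> = (1 - \<mu>) * (1 + a) * (w * (1 + r))" by (simp only: mult_ac)
  also have "\<dots> = (1 - \<mu>) * (1 + a)" by (simp only: r mult_1_right)
  also have "w * (1 + r * ((1 + b) * (1 + a))) = w + w * r * ((1 + b) * (1 + a))" by algebra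
  finally have "w + (1 - w) * ((1 + b) * (1 + a)) \<le> (1 - \<mu>) * (1 + a)" by (simp only: r)
  also have "\<dots> \<le> exp (- \<mu>) * (1 + a)"
    using exp_ge_add_one_self[of "- \<mu>"] a0 by (intro mult_right_mono) auto
  finally have "exp \<mu> * (w + (1 - w) * ((1 + b) * (1 + a))) \<le> exp \<mu> * (exp (- \<mu>) * (1 + a))"
    by (intro mult_left_mono) auto
  then show ?thesis by (simp add: a_def b_def mult.assoc[symmetric] exp_add[symmetric])
qed

section \<open>Exponential moments of hitting times\<close>

locale environment =
  fixes e :: "int \<Rightarrow> real"
  assumes env: "0 < e x" "e x < 1"
begin

lemma env_le: "0 \<le> e x" "e x \<le> 1" "0 \<le> reflect_env e x" "reflect_env e x \<le> 1"
  using env[of x] by (auto simp: reflect_env_def)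

lemma rho_pos: "0 < rho e x"
  using env[of x] by (simp add: rho_def)

context
  fixes W :: "int \<Rightarrow> real" and \<delta> \<mu> :: real and m :: int
  assumes W: "\<And>i. 0 \<le> W i" "\<And>i. W i = 1 + rho e i + (1 + \<delta>) * rho e i * W (i - 1)"
    and \<delta>: "0 < \<delta>" "\<delta> \<le> 1" and \<mu>: "0 < \<mu>"
begin

definition lyapunov :: "int \<Rightarrow> real" where
  "lyapunov x = (\<Prod>i\<in>{x..<m}. 1 + 2 * \<mu> * W i)"

lemma lyapunov_ge_1: "1 \<le> lyapunov x"
  unfolding lyapunov_def using W(1) \<mu> by (intro prod_ge_1) auto

lemma lyapunov_rec: "x < m \<Longrightarrow> lyapunov x = (1 + 2 * \<mu> * W x) * lyapunov (x + 1)"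
proof -
  assume "x < m"
  then have "{x..<m} = insert x {x+1..<m}" by auto
  then show ?thesis by (simp add: lyapunov_def)
qed

lemma lyapunov_step:
  assumes "x < m" "2 * \<mu> * W x \<le> \<delta>"
  shows "e x * lyapunov (x + 1) + (1 - e x) * lyapunov (x - 1) \<le> exp (- \<mu>) * lyapunov x"
proof -
  have "exp \<mu> * (e x + (1 - e x) * ((1 + 2 * \<mu> * W (x - 1)) * (1 + 2 * \<mu> * W x))) \<le> 1 + 2 * \<mu> * W x"
    using assms \<delta> \<mu> W(1)[of "x - 1"] env[of x] W(2)[of x]
    by (intro exp_step_le) (auto simp: rho_def)
  then have "e x + (1 - e x) * ((1 + 2 * \<mu> * W (x - 1)) * (1 + 2 * \<mu> * W x)) \<le> exp (- \<mu>) * (1 + 2 * \<mu> * W x)"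
    by (simp add: exp_minus field_simps)
  from mult_right_mono[OF this, of "lyapunov (x + 1)"] lyapunov_ge_1[of "x + 1"]
  show ?thesis
    using assms by (simp add: lyapunov_rec[of x] lyapunov_rec[of "x - 1"] algebra_simps)
qed

lemma lyapunov_le_exp: "lyapunov 0 \<le> exp (2 * \<mu> * (\<Sum>i\<in>{0..<m}. W i))"
proof -
  have "lyapunov 0 \<le> (\<Prod>i\<in>{0..<m}. exp (2 * \<mu> * W i))"
    unfolding lyapunov_def using W(1) \<mu> by (intro prod_mono) (auto simp: exp_ge_add_one_self add_nonneg_nonneg)
  also have "\<dots> = exp (2 * \<mu> * (\<Sum>i\<in>{0..<m}. W i))"
    by (simp add: exp_sum sum_distrib_left)
  finally show ?thesis .
qed

lemma exp_Suc: "exp (- \<mu> * real (Suc n)) = exp (- \<mu> * real n) * exp (- \<mu>)"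
  by (simp add: exp_add[symmetric] algebra_simps)

lemma survive_reflect_le:
  assumes small: "\<And>i. 0 \<le> i \<Longrightarrow> i < m \<Longrightarrow> 2 * \<mu> * W i \<le> \<delta>" and "0 < m"
  shows "survive (reflect_env e) (- {m}) (- {m}) n 0 \<le> exp (- \<mu> * n + 2 * \<mu> * (\<Sum>i\<in>{0..<m}. W i))"
proof -
  have W1: "1 \<le> W i" for i
    using W(2)[of i] W(1)[of "i - 1"] rho_pos[of i] \<delta> mult_nonneg_nonneg[of "(1 + \<delta>) * rho e i" "W (i - 1)"] by auto
  have "survive (reflect_env e) (- {m}) (- {m}) n 0 \<le> exp (- \<mu> * n) * lyapunov 0"
  proof (rule survive_le[where D = "{0..m}"])
    show "0 \<le> exp (- \<mu> * real n) * lyapunov x" for n x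
      using lyapunov_ge_1[of x] by simp
    show "indicator (- {m}) x \<le> exp (- \<mu> * real 0) * lyapunov x" for x
      using order_trans[OF zero_le_one lyapunov_ge_1[of x]] lyapunov_ge_1[of x] by (auto simp: indicator_def)
    show "reflect_env e x * (exp (- \<mu> * real n) * lyapunov (x + 1)) +
        (1 - reflect_env e x) * (exp (- \<mu> * real n) * lyapunov (x - 1)) \<le> exp (- \<mu> * real (Suc n)) * lyapunov x"
      if x: "x \<in> {0..m}" "x \<in> - {m}" for n x
    proof -
      have "reflect_env e x * lyapunov (x + 1) + (1 - reflect_env e x) * lyapunov (x - 1) \<le> exp (- \<mu>) * lyapunov x"
      proof (cases "x = 0")
        case True
        have "\<mu> \<le> \<mu> * W 0" using W1[of 0] \<mu> by simp
        moreover have "2 * \<mu> * W 0 \<le> \<delta>" using small[of 0] x \<open>0 < m\<close> by auto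
        ultimately have "exp \<mu> \<le> 1 + 2 * (\<mu> * W 0)"
          using exp_le_one_plus_double[of \<mu>] \<mu> \<delta> by linarith
        then have "exp \<mu> \<le> 1 + 2 * \<mu> * W 0" by simp
        then have "exp \<mu> * lyapunov 1 \<le> lyapunov 0"
          using lyapunov_rec[of 0] \<open>0 < m\<close> lyapunov_ge_1[of 1] by simp
        then show ?thesis using True by (simp add: reflect_env_def exp_minus field_simps)
      next
        case False
        then show ?thesis using lyapunov_step[of x] small[of x] x by (simp add: reflect_env_def)
      qed
      from mult_left_mono[OF this, of "exp (- \<mu> * n)"] show ?thesis
        unfolding exp_Suc by (simp add: algebra_simps)
    qed
  qed (use env_le \<open>0 < m\<close> in \<open>auto simp: reflect_env_def\<close>)
  also have "\<dots> \<le> exp (- \<mu> * n) * exp (2 * \<mu> * (\<Sum>i\<in>{0..<m}. W i))"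
    by (intro mult_left_mono lyapunov_le_exp) auto
  finally show ?thesis by (simp add: exp_add[symmetric])
qed

lemma survive_env_le:
  fixes \<phi> E :: "int \<Rightarrow> real"
  assumes small: "\<And>i. l < i \<Longrightarrow> i < m \<Longrightarrow> 2 * \<mu> * W i \<le> \<delta>" and "l < 0" "0 < m"
    and \<phi>: "\<And>x. 0 < \<phi> x" "\<And>x. \<phi> (x + 1) \<le> \<phi> x"
      "\<And>x. e x * \<phi> (x + 1) + (1 - e x) * \<phi> (x - 1) = \<phi> x"
  shows "survive e (- {m}) (- {m}) n 0 \<le> exp (- \<mu> * n + 2 * \<mu> * (\<Sum>i\<in>{0..<m}. W i)) + \<phi> 0 / \<phi> l"
proof -
  have anti: "\<phi> y \<le> \<phi> x" if "x \<le> y" for x y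
    using that by (induction y rule: int_ge_induct) (auto intro: order_trans[OF \<phi>(2)])
  have "survive e (- {m}) (- {m}) n x \<le> exp (- \<mu> * n) * lyapunov x + \<phi> x / \<phi> l" if "x \<le> m" for x
    using that
  proof (induction n arbitrary: x)
    case 0
    show ?case using lyapunov_ge_1[of x] \<phi>(1)[of x] \<phi>(1)[of l]
      by (auto simp: indicator_def intro!: add_increasing2)
  next
    case (Suc n)
    have pos: "0 \<le> exp (- \<mu> * real (Suc n)) * lyapunov x" "0 \<le> \<phi> x / \<phi> l"
      using lyapunov_ge_1[of x] \<phi>(1)[of x] \<phi>(1)[of l] by auto
    consider "x = m" | "x \<le> l" | "l < x" "x < m" using Suc.prems by linarith
    then show ?case
    proof cases
      case 1
      then show ?thesis using pos by simp
    next
      case 2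
      then have "1 \<le> \<phi> x / \<phi> l" using anti[of x l] \<phi>(1)[of l] by simp
      then show ?thesis using pos survive_le_1[of e, OF env_le(1,2), of "-{m}" "-{m}" "Suc n" x] by linarith
    next
      case 3
      have "survive e (- {m}) (- {m}) (Suc n) x = e x * survive e (- {m}) (- {m}) n (x + 1) + (1 - e x) * survive e (- {m}) (- {m}) n (x - 1)"
        using 3 by simp
      also have "\<dots> \<le> e x * (exp (- \<mu> * n) * lyapunov (x + 1) + \<phi> (x + 1) / \<phi> l) + (1 - e x) * (exp (- \<mu> * n) * lyapunov (x - 1) + \<phi> (x - 1) / \<phi> l)"
        using 3 env_le[of x] by (intro add_mono mult_left_mono Suc.IH) auto
      also have "\<dots> = exp (- \<mu> * n) * (e x * lyapunov (x + 1) + (1 - e x) * lyapunov (x - 1)) + (e x * \<phi> (x + 1) + (1 - e x) * \<phi> (x - 1)) / \<phi> l"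
        by (simp add: algebra_simps add_divide_distrib diff_divide_distrib)
      also have "\<dots> \<le> exp (- \<mu> * n) * (exp (- \<mu>) * lyapunov x) + \<phi> x / \<phi> l"
        using 3 small[of x] lyapunov_step[of x] by (intro add_mono mult_left_mono) (auto simp: \<phi>(3))
      also have "\<dots> = exp (- \<mu> * Suc n) * lyapunov x + \<phi> x / \<phi> l"
        unfolding exp_Suc by simp
      finally show ?thesis .
    qed
  qed
  from this[of 0] \<open>0 < m\<close>
  have "survive e (- {m}) (- {m}) n 0 \<le> exp (- \<mu> * n) * lyapunov 0 + \<phi> 0 / \<phi> l" by simp
  also have "\<dots> \<le> exp (- \<mu> * n) * exp (2 * \<mu> * (\<Sum>i\<in>{0..<m}. W i)) + \<phi> 0 / \<phi> l"
    by (intro mult_left_mono add_right_mono lyapunov_le_exp) auto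
  finally show ?thesis by (simp add: exp_add[symmetric])
qed

end

end

lemma survive_UNIV_le:
  assumes e: "\<And>x. 0 \<le> e x" "\<And>x. e x \<le> 1"
    and B: "\<And>x. x \<in> B \<Longrightarrow> x < m" and c: "0 \<le> c" "\<And>n. survive e UNIV B n m \<le> c" and "x \<le> m"
  shows "survive e UNIV B n x \<le> survive e (- {m}) (- {m}) n x + c"
  using \<open>x \<le> m\<close>
proof (induction n arbitrary: x)
  case 0
  then show ?case using B[of x] c by (auto simp: indicator_def)
next
  case (Suc n)
  show ?case
  proof (cases "x = m")
    case True
    then show ?thesis using c(2)[of "Suc n"] by simp
  next
    case False
    have "survive e UNIV B (Suc n) x = e x * survive e UNIV B n (x + 1) + (1 - e x) * survive e UNIV B n (x - 1)"
      by simp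
    also have "\<dots> \<le> e x * (survive e (- {m}) (- {m}) n (x + 1) + c) + (1 - e x) * (survive e (- {m}) (- {m}) n (x - 1) + c)"
      using False Suc.prems e by (intro add_mono mult_left_mono Suc.IH) auto
    also have "\<dots> = survive e (- {m}) (- {m}) (Suc n) x + c"
      using False by (simp add: algebra_simps)
    finally show ?thesis .
  qed
qed

lemma survive_le_superharmonic:
  fixes \<phi> :: "int \<Rightarrow> real"
  assumes e: "\<And>x. 0 \<le> e x" "\<And>x. e x \<le> 1"
    and D: "\<And>x. x \<in> D \<Longrightarrow> x + 1 \<in> D \<and> (x - 1 \<in> D \<or> e x = 1)"
    and \<phi>: "\<And>x. 0 < \<phi> x" "\<And>x. \<phi> (x + 1) \<le> \<phi> x"
      "\<And>x. x \<in> D \<Longrightarrow> e x * \<phi> (x + 1) + (1 - e x) * \<phi> (x - 1) \<le> \<phi> x"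
    and B: "\<And>x. x \<in> B \<Longrightarrow> x \<le> m" and "x \<in> D"
  shows "survive e UNIV B n x \<le> \<phi> x / \<phi> m"
proof (rule survive_le[OF e, where D = D and f = "\<lambda>_ x. \<phi> x / \<phi> m"])
  have anti: "\<phi> y \<le> \<phi> x" if "x \<le> y" for x y
    using that by (induction y rule: int_ge_induct) (auto intro: order_trans[OF \<phi>(2)])
  show "indicator B x \<le> \<phi> x / \<phi> m" for x
    using B[of x] anti[of x m] \<phi>(1)[of x] \<phi>(1)[of m] by (auto simp: indicator_def)
  show "0 \<le> \<phi> x / \<phi> m" for x
    using \<phi>(1)[of x] \<phi>(1)[of m] by simp
  show "e x * (\<phi> (x + 1) / \<phi> m) + (1 - e x) * (\<phi> (x - 1) / \<phi> m) \<le> \<phi> x / \<phi> m" if "x \<in> D" for x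
    using divide_right_mono[OF \<phi>(3)[OF that], of "\<phi> m"] \<phi>(1)[of m] by (simp add: add_divide_distrib)
qed (use D \<open>x \<in> D\<close> in auto)

lemma survive_return_ge:
  fixes e :: "int \<Rightarrow> real"
  assumes e: "\<And>x. 0 \<le> e x" "\<And>x. e x \<le> 1" and "e 0 = 1" and x: "0 \<le> x" "x \<le> int n + 1"
  shows "(1 - e 1) ^ n * (\<Prod>k\<in>{1..x}. 1 - e k) \<le> survive e UNIV {0, 1} n x"
  using x
proof (induction n arbitrary: x)
  case 0
  then have "x = 0 \<or> x = 1" by auto
  then show ?case using e[of 1] by auto
next
  case (Suc n)
  show ?case
  proof (cases "x = 0")
    case True
    then show ?thesis using Suc.IH[of 1] \<open>e 0 = 1\<close> by (simp add: mult.commute)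
  next
    case False
    then have "{1..x} = insert x {1..x-1}" using Suc.prems by auto
    then have "(1 - e 1) ^ Suc n * (\<Prod>k\<in>{1..x}. 1 - e k) = (1 - e 1) * ((1 - e x) * ((1 - e 1) ^ n * (\<Prod>k\<in>{1..x-1}. 1 - e k)))"
      by simp
    also have "\<dots> \<le> 1 * ((1 - e x) * ((1 - e 1) ^ n * (\<Prod>k\<in>{1..x-1}. 1 - e k)))"
      using e by (intro mult_right_mono mult_nonneg_nonneg prod_nonneg zero_le_power) auto
    also have "\<dots> \<le> 1 * ((1 - e x) * survive e UNIV {0, 1} n (x - 1))"
      using Suc.prems False e by (intro mult_left_mono Suc.IH) auto
    also have "\<dots> \<le> survive e UNIV {0, 1} (Suc n) x"
      using e survive_nonneg[of e, OF e, of UNIV "{0,1}" n "x + 1"] by simp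
    finally show ?thesis .
  qed
qed

lemma survive_hitting_le_position:
  assumes e: "\<And>x. 0 \<le> e x" "\<And>x. e x \<le> 1" and B: "{..<m} \<subseteq> B" and "x < m"
  shows "survive e (- {m}) (- {m}) n x \<le> survive e UNIV B n x"
proof -
  have "survive e (- {m}) (- {m}) n x \<le> (if x = m then 0 else survive e UNIV B n x)" if "x \<le> m" for x
    using that
  proof (induction n arbitrary: x)
    case 0
    then show ?case using B by (auto simp: indicator_def subset_iff)
  next
    case (Suc n)
    show ?case
    proof (cases "x = m")
      case False
      have "survive e (- {m}) (- {m}) n y \<le> survive e UNIV B n y" if "y \<le> m" for y
        using Suc.IH[OF that] survive_nonneg[of e, OF e, of UNIV B n y] by (auto split: if_splits)
      then have "e x * survive e (- {m}) (- {m}) n (x + 1) + (1 - e x) * survive e (- {m}) (- {m}) n (x - 1)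
          \<le> e x * survive e UNIV B n (x + 1) + (1 - e x) * survive e UNIV B n (x - 1)"
        using False Suc.prems e by (intro add_mono mult_left_mono) auto
      then show ?thesis using False by simp
    qed simp
  qed
  from this[of x] \<open>x < m\<close> show ?thesis by simp
qed

section \<open>Quenched upper bounds\<close>

definition potential :: "(int \<Rightarrow> real) \<Rightarrow> int \<Rightarrow> real" where
  "potential e k = (\<Sum>i\<in>{1..k}. ln (rho e i)) - (\<Sum>i\<in>{k+1..0}. ln (rho e i))"

lemma potential_step: "potential e k = potential e (k - 1) + ln (rho e k)"
proof (cases "1 \<le> k")
  case True
  then have "{1..k} = insert k {1..k-1}" by auto
  then show ?thesis using True by (simp add: potential_def)
next
  case False
  then have "{k..0} = insert k {k+1..0}" by auto
  then show ?thesis using False by (simp add: potential_def)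
qed

definition resolvent_bound :: "(int \<Rightarrow> real) \<Rightarrow> real \<Rightarrow> real \<Rightarrow> bool" where
  "resolvent_bound e p q \<longleftrightarrow> (\<exists>W \<delta> C. 0 < \<delta> \<and> \<delta> \<le> 1 \<and>
     (\<forall>i. 0 \<le> W i \<and> W i = 1 + rho e i + (1 + \<delta>) * rho e i * W (i - 1)) \<and>
     (\<forall>i. W i \<le> C * (1 + \<bar>real_of_int i\<bar>) powr p) \<and>
     (\<forall>m\<ge>0. (\<Sum>i\<in>{0..<m}. W i) \<le> C * (1 + real_of_int m) powr q))"

definition potential_drift :: "(int \<Rightarrow> real) \<Rightarrow> bool" where
  "potential_drift e \<longleftrightarrow> (\<exists>C c. 0 < c \<and> 0 < C \<and>
     (\<forall>k. exp (potential e (int k)) \<le> C * exp (- c * real k) \<and>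
          exp (c * real k) \<le> C * exp (potential e (- int k))))"

definition ellipticity_bound :: "(int \<Rightarrow> real) \<Rightarrow> real \<Rightarrow> bool" where
  "ellipticity_bound e q \<longleftrightarrow> (\<exists>C>0. \<forall>N.
     (\<Sum>i\<in>{- int N..int N}. ln (1 + 1 / rho e i)) \<le> C * (1 + real N) powr q)"

text \<open>
  \<open>b m\<close> is the left end of the window of length \<open>m\<close>: \<open>0\<close> for traps on the right of the origin,
  \<open>- m\<close> for traps on its left.
\<close>

definition deep_traps :: "(int \<Rightarrow> real) \<Rightarrow> (nat \<Rightarrow> int) \<Rightarrow> real \<Rightarrow> bool" where
  "deep_traps e b p \<longleftrightarrow> (\<forall>\<^sub>F m in sequentially. \<exists>i j. b m \<le> i \<and> i < j \<and> j \<le> b m + int m \<and>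
     p * ln (real m) \<le> potential e (j - 1) - potential e i)"

lemma floor_powr_bounds:
  fixes b :: real
  assumes "1 \<le> n" "0 \<le> b"
  shows "1 \<le> \<lfloor>real n powr b\<rfloor>" "real_of_int \<lfloor>real n powr b\<rfloor> \<le> real n powr b"
    "real n powr b - 1 \<le> real_of_int \<lfloor>real n powr b\<rfloor>"
proof -
  have "1 \<le> real n powr b" using assms by (intro ge_one_powr_ge_zero) auto
  then show "1 \<le> \<lfloor>real n powr b\<rfloor>" "real_of_int \<lfloor>real n powr b\<rfloor> \<le> real n powr b"
    "real n powr b - 1 \<le> real_of_int \<lfloor>real n powr b\<rfloor>" by linarith+
qed

lemma filterlim_nat_floor_powr:
  fixes b :: real
  assumes "0 < b"
  shows "filterlim (\<lambda>n. nat \<lfloor>real n powr b\<rfloor>) sequentially sequentially"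
  using assms by real_asymp

context environment
begin

lemma exp_potential_balance:
  "e x * exp (potential e x) = (1 - e x) * exp (potential e (x - 1))"
proof -
  have "exp (potential e x) = exp (potential e (x - 1)) * rho e x"
    using potential_step[of e x] rho_pos[of x] by (simp add: exp_add)
  then show ?thesis using env[of x] by (simp add: rho_def)
qed

lemma ln_one_plus_inverse_rho: "ln (1 + 1 / rho e x) = - ln (1 - e x)" "0 \<le> ln (1 + 1 / rho e x)"
proof -
  have "1 + 1 / rho e x = 1 / (1 - e x)" using env[of x] by (simp add: rho_def field_simps)
  then show "ln (1 + 1 / rho e x) = - ln (1 - e x)" using env[of x] by (simp add: ln_div)
  show "0 \<le> ln (1 + 1 / rho e x)" using rho_pos[of x] by (intro ln_ge_zero) simp
qed

lemma harmonic_obtains: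
  assumes "potential_drift e"
  obtains \<phi> C c where "0 < c" "0 < C" "\<And>x. 0 < \<phi> x" "\<And>x. \<phi> (x + 1) \<le> \<phi> x"
    "\<And>x. e x * \<phi> (x + 1) + (1 - e x) * \<phi> (x - 1) = \<phi> x"
    "\<And>k. \<phi> (int k) \<le> C * exp (- c * real k)" "\<And>k. exp (c * real k) \<le> C * \<phi> (- int k)"
    "\<And>x. exp (potential e x) \<le> \<phi> x"
proof -
  obtain C c where c: "0 < c" "0 < C"
    and up: "\<And>k. exp (potential e (int k)) \<le> C * exp (- c * real k)"
    and down: "\<And>k. exp (c * real k) \<le> C * exp (potential e (- int k))"
    using assms unfolding potential_drift_def by blast
  define E where "E x = exp (potential e x)" for x
  define \<phi> where "\<phi> x = (\<Sum>n. E (x + int n))" for x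
  define g where "g = exp (- c)"
  have g: "0 < g" "g < 1" using c by (auto simp: g_def)
  have pw: "exp (- c * real k) = g ^ k" for k by (simp add: g_def exp_of_nat_mult[symmetric] mult.commute)
  have E: "0 < E x" for x by (simp add: E_def)
  have summable_nat: "summable (\<lambda>n. E (int k + int n))" for k
  proof (rule summable_comparison_test'[where N = 0])
    show "summable (\<lambda>n. C * g ^ k * g ^ n)" using g by (intro summable_mult summable_geometric) auto
    show "norm (E (int k + int n)) \<le> C * g ^ k * g ^ n" for n
      using up[of "k + n"] unfolding pw by (simp add: E_def power_add)
  qed
  have summable: "summable (\<lambda>n. E (x + int n))" for x
  proof (rule summable_iff_shift[THEN iffD1])
    have "int (nat (x + \<bar>x\<bar>)) + int n = x + int (n + nat \<bar>x\<bar>)" for n by simp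
    then show "summable (\<lambda>n. E (x + int (n + nat \<bar>x\<bar>)))"
      using summable_nat[of "nat (x + \<bar>x\<bar>)"] by (simp add: add_ac)
  qed
  have rec: "\<phi> x = E x + \<phi> (x + 1)" for x
  proof -
    have "(\<Sum>n. E (x + int (Suc n))) = \<phi> x - E x"
      unfolding \<phi>_def using suminf_split_head[OF summable[of x]] by simp
    then show ?thesis unfolding \<phi>_def[of "x+1"] by (simp add: algebra_simps)
  qed
  have pos: "0 < \<phi> x" for x
    unfolding \<phi>_def using summable E by (rule suminf_pos)
  show ?thesis
  proof (rule that[of c "max C (C / (1 - g))" \<phi>])
    show "\<phi> (x + 1) \<le> \<phi> x" for x using rec[of x] E[of x] by simp
    show "exp (potential e x) \<le> \<phi> x" for x using rec[of x] pos[of "x + 1"] by (simp add: E_def)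
    show "e x * \<phi> (x + 1) + (1 - e x) * \<phi> (x - 1) = \<phi> x" for x
      using rec[of x] rec[of "x - 1"] exp_potential_balance[of x] by (simp add: E_def algebra_simps)
    show "\<phi> (int k) \<le> max C (C / (1 - g)) * exp (- c * real k)" for k
    proof -
      have "\<phi> (int k) \<le> (\<Sum>n. C * g ^ k * g ^ n)"
        unfolding \<phi>_def
      proof (rule suminf_le[OF _ summable])
        show "E (int k + int n) \<le> C * g ^ k * g ^ n" for n
          using up[of "k + n"] unfolding pw by (simp add: E_def power_add)
      qed (use g in \<open>intro summable_mult summable_geometric, auto\<close>)
      also have "\<dots> = C / (1 - g) * g ^ k"
        using g by (subst suminf_mult) (auto simp: suminf_geometric summable_geometric)
      also have "\<dots> \<le> max C (C / (1 - g)) * g ^ k" using g by (intro mult_right_mono) auto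
      finally show ?thesis unfolding pw .
    qed
    show "exp (c * real k) \<le> max C (C / (1 - g)) * \<phi> (- int k)" for k
    proof -
      have "C * exp (potential e (- int k)) \<le> max C (C / (1 - g)) * \<phi> (- int k)"
        using rec[of "- int k"] pos[of "- int k + 1"] c by (intro mult_mono) (auto simp: E_def)
      then show ?thesis using down[of k] by simp
    qed
  qed (use c pos in auto)
qed

lemma survive_reflect_asymp:
  assumes R: "resolvent_bound e p q" and "0 < b" "0 < p" "0 < q" "b * p < \<sigma>" "\<sigma> < 1" "b * q < 1"
    and \<theta>: "0 < \<theta>" "\<theta> < 1 - \<sigma>"
  shows "\<forall>\<^sub>F n in sequentially.
    survive (reflect_env e) (- {\<lfloor>real n powr b\<rfloor>}) (- {\<lfloor>real n powr b\<rfloor>}) n 0 \<le> exp (- (real n powr \<theta>))"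
proof -
  obtain W \<delta> C where \<delta>: "0 < \<delta>" "\<delta> \<le> 1"
    and W: "\<And>i. 0 \<le> W i" "\<And>i. W i = 1 + rho e i + (1 + \<delta>) * rho e i * W (i - 1)"
    and Wp: "\<And>i. W i \<le> C * (1 + \<bar>real_of_int i\<bar>) powr p"
    and Wq: "\<And>m. 0 \<le> m \<Longrightarrow> (\<Sum>i\<in>{0..<m}. W i) \<le> C * (1 + real_of_int m) powr q"
    using R unfolding resolvent_bound_def by blast
  have "0 < W 0" using W(2)[of 0] W(1)[of "0 - 1"] rho_pos[of 0] \<delta> by (auto intro!: add_pos_nonneg)
  then have C: "0 < C" using Wp[of 0] by simp
  have "\<forall>\<^sub>F x in at_top. 2 * C * (x powr (-\<sigma>) * (1 + x powr b) powr p) \<le> \<delta>"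
    using assms C \<delta> by real_asymp
  moreover have "\<forall>\<^sub>F x in at_top. - (x powr (-\<sigma>)) * x + 2 * x powr (-\<sigma>) * (C * (1 + x powr b) powr q) \<le> - (x powr \<theta>)"
    using assms C by real_asymp
  ultimately have "\<forall>\<^sub>F x in at_top. 2 * C * (x powr (-\<sigma>) * (1 + x powr b) powr p) \<le> \<delta> \<and>
      - (x powr (-\<sigma>)) * x + 2 * x powr (-\<sigma>) * (C * (1 + x powr b) powr q) \<le> - (x powr \<theta>)"
    by (rule eventually_conj)
  then have "\<forall>\<^sub>F n in sequentially. 2 * C * (real n powr (-\<sigma>) * (1 + real n powr b) powr p) \<le> \<delta> \<and>
      - (real n powr (-\<sigma>)) * real n + 2 * real n powr (-\<sigma>) * (C * (1 + real n powr b) powr q) \<le> - (real n powr \<theta>)"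
    by (rule eventually_compose_filterlim[OF _ filterlim_real_sequentially])
  then show ?thesis
    using eventually_ge_at_top[of 1]
  proof eventually_elim
    case (elim n)
    define m where "m = \<lfloor>real n powr b\<rfloor>"
    define \<mu> where "\<mu> = real n powr (-\<sigma>)"
    have m: "1 \<le> m" "real_of_int m \<le> real n powr b"
      using floor_powr_bounds[of n b] elim assms by (auto simp: m_def)
    have \<mu>: "0 < \<mu>" using elim by (simp add: \<mu>_def)
    have "survive (reflect_env e) (- {m}) (- {m}) n 0 \<le> exp (- \<mu> * n + 2 * \<mu> * (\<Sum>i\<in>{0..<m}. W i))"
    proof (rule survive_reflect_le[OF W \<delta> \<mu>])
      fix i assume i: "0 \<le> i" "i < m"
      have "(1 + \<bar>real_of_int i\<bar>) powr p \<le> (1 + real n powr b) powr p"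
        using i m assms by (intro powr_mono2) auto
      then have "W i \<le> C * (1 + real n powr b) powr p"
        using Wp[of i] C by (meson mult_left_mono less_imp_le order_trans)
      then have "2 * \<mu> * W i \<le> 2 * \<mu> * (C * (1 + real n powr b) powr p)"
        using \<mu> by (intro mult_left_mono) auto
      also have "\<dots> = 2 * C * (real n powr (-\<sigma>) * (1 + real n powr b) powr p)"
        by (simp add: \<mu>_def)
      also have "\<dots> \<le> \<delta>" using elim by blast
      finally show "2 * \<mu> * W i \<le> \<delta>" .
    qed (use m in auto)
    also have "\<dots> \<le> exp (- (real n powr \<theta>))"
    proof -
      have "(1 + real_of_int m) powr q \<le> (1 + real n powr b) powr q"
        using m assms by (intro powr_mono2) auto
      then have "(\<Sum>i\<in>{0..<m}. W i) \<le> C * (1 + real n powr b) powr q"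
        using Wq[of m] m C by (meson mult_left_mono less_imp_le order_trans zero_le_one)
      then have "2 * \<mu> * (\<Sum>i\<in>{0..<m}. W i) \<le> 2 * \<mu> * (C * (1 + real n powr b) powr q)"
        using \<mu> by (intro mult_left_mono) auto
      moreover have "- \<mu> * real n + 2 * \<mu> * (C * (1 + real n powr b) powr q) \<le> - (real n powr \<theta>)"
        using elim unfolding \<mu>_def by blast
      ultimately show ?thesis unfolding exp_le_cancel_iff by linarith
    qed
    finally show ?case unfolding m_def .
  qed
qed

lemma survive_env_asymp:
  assumes R: "resolvent_bound e p q" and drift: "potential_drift e"
    and "0 < a" "a \<le> b" "0 < p" "0 < q" "b * p < \<sigma>" "\<sigma> < 1" "a * q < 1"
    and \<theta>: "0 < \<theta>" "\<theta> < 1 - \<sigma>" "\<theta> < b"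
  shows "\<forall>\<^sub>F n in sequentially.
    survive e (- {\<lfloor>real n powr a\<rfloor>}) (- {\<lfloor>real n powr a\<rfloor>}) n 0 \<le> exp (- (real n powr \<theta>))"
proof -
  obtain W \<delta> C where \<delta>: "0 < \<delta>" "\<delta> \<le> 1"
    and W: "\<And>i. 0 \<le> W i" "\<And>i. W i = 1 + rho e i + (1 + \<delta>) * rho e i * W (i - 1)"
    and Wp: "\<And>i. W i \<le> C * (1 + \<bar>real_of_int i\<bar>) powr p"
    and Wq: "\<And>m. 0 \<le> m \<Longrightarrow> (\<Sum>i\<in>{0..<m}. W i) \<le> C * (1 + real_of_int m) powr q"
    using R unfolding resolvent_bound_def by blast
  obtain \<phi> D c where c: "0 < c" "0 < D" and \<phi>: "\<And>x. 0 < \<phi> x" "\<And>x. \<phi> (x + 1) \<le> \<phi> x"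
    "\<And>x. e x * \<phi> (x + 1) + (1 - e x) * \<phi> (x - 1) = \<phi> x"
    and \<phi>D: "\<And>k. exp (c * real k) \<le> D * \<phi> (- int k)"
    using harmonic_obtains[OF drift] by metis
  have b: "0 < b" using assms by simp
  have "0 < W 0" using W(2)[of 0] W(1)[of "0 - 1"] rho_pos[of 0] \<delta> by (auto intro!: add_pos_nonneg)
  then have C: "0 < C" using Wp[of 0] by simp
  define G where "G = \<phi> 0 * D * exp c"
  have G: "0 < G" using \<phi>(1)[of 0] c by (simp add: G_def)
  have "\<forall>\<^sub>F x in at_top. 2 * C * (x powr (-\<sigma>) * (1 + x powr b) powr p) \<le> \<delta>"
    using assms b C \<delta> by real_asymp
  moreover have "\<forall>\<^sub>F x in at_top. - (x powr (-\<sigma>)) * x + 2 * x powr (-\<sigma>) * (C * (1 + x powr a) powr q) \<le> - 2 * (x powr \<theta>)"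
    using assms C by real_asymp
  moreover have "\<forall>\<^sub>F x in at_top. exp (- 2 * (x powr \<theta>)) \<le> exp (- (x powr \<theta>)) / 2"
    using assms by real_asymp
  moreover have "\<forall>\<^sub>F x in at_top. G * exp (- c * x powr b) \<le> exp (- (x powr \<theta>)) / 2"
    using assms c G by real_asymp
  ultimately have "\<forall>\<^sub>F x in at_top. 2 * C * (x powr (-\<sigma>) * (1 + x powr b) powr p) \<le> \<delta> \<and>
      - (x powr (-\<sigma>)) * x + 2 * x powr (-\<sigma>) * (C * (1 + x powr a) powr q) \<le> - 2 * (x powr \<theta>) \<and>
      exp (- 2 * (x powr \<theta>)) \<le> exp (- (x powr \<theta>)) / 2 \<and>
      G * exp (- c * x powr b) \<le> exp (- (x powr \<theta>)) / 2"
    by (intro eventually_conj)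
  then have "\<forall>\<^sub>F n in sequentially. 2 * C * (real n powr (-\<sigma>) * (1 + real n powr b) powr p) \<le> \<delta> \<and>
      - (real n powr (-\<sigma>)) * real n + 2 * real n powr (-\<sigma>) * (C * (1 + real n powr a) powr q) \<le> - 2 * (real n powr \<theta>) \<and>
      exp (- 2 * (real n powr \<theta>)) \<le> exp (- (real n powr \<theta>)) / 2 \<and>
      G * exp (- c * real n powr b) \<le> exp (- (real n powr \<theta>)) / 2"
    by (rule eventually_compose_filterlim[OF _ filterlim_real_sequentially])
  then show ?thesis
    using eventually_ge_at_top[of 1]
  proof eventually_elim
    case (elim n)
    define m where "m = \<lfloor>real n powr a\<rfloor>"
    define l where "l = \<lfloor>real n powr b\<rfloor>"
    define \<mu> where "\<mu> = real n powr (-\<sigma>)"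
    have m: "1 \<le> m" "real_of_int m \<le> real n powr a"
      using floor_powr_bounds[of n a] elim assms by (auto simp: m_def)
    have l: "1 \<le> l" "real_of_int l \<le> real n powr b" "real n powr b - 1 \<le> real_of_int l"
      using floor_powr_bounds[of n b] elim b by (auto simp: l_def)
    have ab: "real n powr a \<le> real n powr b" using assms elim by (intro powr_mono) auto
    have \<mu>: "0 < \<mu>" using elim by (simp add: \<mu>_def)
    have "survive e (- {m}) (- {m}) n 0 \<le> exp (- \<mu> * n + 2 * \<mu> * (\<Sum>i\<in>{0..<m}. W i)) + \<phi> 0 / \<phi> (- l)"
    proof (rule survive_env_le[OF W \<delta> \<mu> _ _ _ \<phi>])
      fix i assume i: "- l < i" "i < m"
      then have "real_of_int (- l) \<le> real_of_int i" "real_of_int i \<le> real_of_int m" by linarith+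
      then have "\<bar>real_of_int i\<bar> \<le> real n powr b" using m l ab by simp
      then have "(1 + \<bar>real_of_int i\<bar>) powr p \<le> (1 + real n powr b) powr p"
        using assms by (intro powr_mono2) auto
      then have "W i \<le> C * (1 + real n powr b) powr p"
        using Wp[of i] C by (meson mult_left_mono less_imp_le order_trans)
      then have "2 * \<mu> * W i \<le> 2 * \<mu> * (C * (1 + real n powr b) powr p)"
        using \<mu> by (intro mult_left_mono) auto
      also have "\<dots> = 2 * C * (real n powr (-\<sigma>) * (1 + real n powr b) powr p)"
        by (simp add: \<mu>_def)
      also have "\<dots> \<le> \<delta>" using elim by blast
      finally show "2 * \<mu> * W i \<le> \<delta>" .
    qed (use m l in auto)
    also have "exp (- \<mu> * n + 2 * \<mu> * (\<Sum>i\<in>{0..<m}. W i)) \<le> exp (- 2 * (real n powr \<theta>))"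
    proof -
      have "(1 + real_of_int m) powr q \<le> (1 + real n powr a) powr q"
        using m assms by (intro powr_mono2) auto
      then have "(\<Sum>i\<in>{0..<m}. W i) \<le> C * (1 + real n powr a) powr q"
        using Wq[of m] m C by (meson mult_left_mono less_imp_le order_trans zero_le_one)
      then have "2 * \<mu> * (\<Sum>i\<in>{0..<m}. W i) \<le> 2 * \<mu> * (C * (1 + real n powr a) powr q)"
        using \<mu> by (intro mult_left_mono) auto
      moreover have "- \<mu> * real n + 2 * \<mu> * (C * (1 + real n powr a) powr q) \<le> - 2 * (real n powr \<theta>)"
        using elim unfolding \<mu>_def by blast
      ultimately show ?thesis unfolding exp_le_cancel_iff by linarith
    qed
    also have "\<phi> 0 / \<phi> (- l) \<le> G * exp (- c * real n powr b)"
    proof -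
      have "exp (c * real_of_int l) \<le> D * \<phi> (- l)" using \<phi>D[of "nat l"] l by simp
      moreover have "exp (c * real n powr b) \<le> exp c * exp (c * real_of_int l)"
        using mult_left_mono[OF l(3), of c] c by (simp add: exp_add[symmetric] algebra_simps)
      ultimately have "exp (c * real n powr b) \<le> exp c * (D * \<phi> (- l))"
        by (meson exp_ge_zero mult_left_mono order_trans)
      then have "exp (c * real n powr b) * \<phi> 0 \<le> exp c * (D * \<phi> (- l)) * \<phi> 0"
        using \<phi>(1)[of 0] by (intro mult_right_mono) auto
      then show ?thesis using \<phi>(1)[of "-l"] by (simp add: G_def exp_minus field_simps)
    qed
    finally show ?case using elim unfolding m_def by linarith
  qed
qed

end

lemma (in environment) position_asymp:
  assumes drift: "potential_drift e" and ell: "ellipticity_bound e \<eta>"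
    and e': "e' = e \<or> e' = reflect_env e"
    and ab: "0 < a" "a < b" "a * \<eta> < b" "0 < \<eta>" and \<theta>: "0 < \<theta>" "\<theta> < \<theta>'" "\<theta> < b"
    and hit: "\<forall>\<^sub>F n in sequentially.
      survive e' (- {\<lfloor>real n powr b\<rfloor>}) (- {\<lfloor>real n powr b\<rfloor>}) n 0 \<le> exp (- (real n powr \<theta>'))"
  shows "\<forall>\<^sub>F n in sequentially.
    survive e' UNIV {x. real_of_int x < real n powr a} n 0 \<le> exp (- (real n powr \<theta>))"
proof -
  obtain \<phi> D c where c: "0 < c" "0 < D" and \<phi>: "\<And>x. 0 < \<phi> x" "\<And>x. \<phi> (x + 1) \<le> \<phi> x"
    "\<And>x. e x * \<phi> (x + 1) + (1 - e x) * \<phi> (x - 1) = \<phi> x"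
    and \<phi>D: "\<And>k. \<phi> (int k) \<le> D * exp (- c * real k)" "\<And>x. exp (potential e x) \<le> \<phi> x"
    using harmonic_obtains[OF drift] by metis
  obtain C where C: "0 < C" "\<And>N. (\<Sum>i\<in>{- int N..int N}. ln (1 + 1 / rho e i)) \<le> C * (1 + real N) powr \<eta>"
    using ell unfolding ellipticity_bound_def by blast
  have e'_range: "0 \<le> e' x" "e' x \<le> 1" for x using e' env_le by auto
  have "\<forall>\<^sub>F x in at_top. D * exp c * exp (- c * x powr b + C * (1 + x powr a) powr \<eta>) \<le> exp (- (x powr \<theta>)) / 2"
    using assms c C by real_asymp
  moreover have "\<forall>\<^sub>F x in at_top. exp (- (x powr \<theta>')) \<le> exp (- (x powr \<theta>)) / 2"
    using assms by real_asymp
  moreover have "\<forall>\<^sub>F x in at_top. x powr a \<le> x powr b - 1"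
    using assms by real_asymp
  ultimately have "\<forall>\<^sub>F x in at_top.
      D * exp c * exp (- c * x powr b + C * (1 + x powr a) powr \<eta>) \<le> exp (- (x powr \<theta>)) / 2 \<and>
      exp (- (x powr \<theta>')) \<le> exp (- (x powr \<theta>)) / 2 \<and> x powr a \<le> x powr b - 1"
    by (intro eventually_conj)
  then have "\<forall>\<^sub>F n in sequentially.
      D * exp c * exp (- c * real n powr b + C * (1 + real n powr a) powr \<eta>) \<le> exp (- (real n powr \<theta>)) / 2 \<and>
      exp (- (real n powr \<theta>')) \<le> exp (- (real n powr \<theta>)) / 2 \<and> real n powr a \<le> real n powr b - 1"
    by (rule eventually_compose_filterlim[OF _ filterlim_real_sequentially])
  then show ?thesis
    using hit eventually_ge_at_top[of 1]
  proof eventually_elim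
    case (elim n)
    define m where "m = \<lfloor>real n powr a\<rfloor>"
    define l where "l = \<lfloor>real n powr b\<rfloor>"
    define B where "B = {x. real_of_int x < real n powr a}"
    have m: "1 \<le> m" "real_of_int m \<le> real n powr a"
      using floor_powr_bounds[of n a] elim ab by (auto simp: m_def)
    have l: "1 \<le> l" "real_of_int l \<le> real n powr b" "real n powr b - 1 \<le> real_of_int l"
      using floor_powr_bounds[of n b] elim ab by (auto simp: l_def)
    have B: "x \<le> m" if "x \<in> B" for x using that by (simp add: B_def m_def le_floor_iff)
    have return: "survive e' UNIV B k l \<le> \<phi> l / \<phi> m" for k
    proof (rule survive_le_superharmonic[OF e'_range, where D = "if e' = e then UNIV else {0..}"])
      show "e' x * \<phi> (x + 1) + (1 - e' x) * \<phi> (x - 1) \<le> \<phi> x" for x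
        using e' \<phi>(3)[of x] \<phi>(2)[of x] by (auto simp: reflect_env_def)
    qed (use e' l B \<phi> in \<open>auto simp: reflect_env_def split: if_splits\<close>)
    have "survive e' UNIV B n 0 \<le> survive e' (- {l}) (- {l}) n 0 + \<phi> l / \<phi> m"
    proof (rule survive_UNIV_le[OF e'_range _ _ return])
      show "x < l" if "x \<in> B" for x using that elim l by (simp add: B_def)
    qed (use l \<phi>(1) in \<open>auto intro: less_imp_le\<close>)
    also have "survive e' (- {l}) (- {l}) n 0 \<le> exp (- (real n powr \<theta>)) / 2"
      using elim unfolding l_def by linarith
    also have "\<phi> l / \<phi> m \<le> D * exp c * exp (- c * real n powr b + C * (1 + real n powr a) powr \<eta>)"
    proof -
      have "- potential e m = (\<Sum>i\<in>{1..m}. - ln (rho e i))"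
        using m by (simp add: potential_def sum_negf)
      also have "\<dots> \<le> (\<Sum>i\<in>{1..m}. ln (1 + 1 / rho e i))"
      proof (rule sum_mono)
        fix i
        have "- ln (rho e i) = ln (1 / rho e i)" using rho_pos[of i] by (simp add: ln_div)
        also have "\<dots> \<le> ln (1 + 1 / rho e i)" using rho_pos[of i] by (simp add: add_pos_pos)
        finally show "- ln (rho e i) \<le> ln (1 + 1 / rho e i)" .
      qed
      also have "\<dots> \<le> (\<Sum>i\<in>{- int (nat m)..int (nat m)}. ln (1 + 1 / rho e i))"
        using m by (intro sum_mono2 ln_one_plus_inverse_rho) auto
      also have "\<dots> \<le> C * (1 + real_of_int m) powr \<eta>" using C(2)[of "nat m"] m by simp
      also have "\<dots> \<le> C * (1 + real n powr a) powr \<eta>"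
        using m C ab by (intro mult_left_mono powr_mono2) auto
      finally have "exp (- (C * (1 + real n powr a) powr \<eta>)) \<le> exp (potential e m)" by simp
      then have m_ge: "exp (- (C * (1 + real n powr a) powr \<eta>)) \<le> \<phi> m" using \<phi>D(2)[of m] by linarith
      have "- c * real_of_int l \<le> c - c * real n powr b"
        using mult_left_mono[OF l(3), of c] c by (simp add: algebra_simps)
      then have "exp (- c * real_of_int l) \<le> exp (c - c * real n powr b)" by simp
      then have "D * exp (- c * real_of_int l) \<le> D * exp (c - c * real n powr b)"
        using c by (intro mult_left_mono) auto
      then have "\<phi> l \<le> D * exp (c - c * real n powr b)"
        using \<phi>D(1)[of "nat l"] l by simp
      then have "\<phi> l / \<phi> m \<le> D * exp (c - c * real n powr b) / exp (- (C * (1 + real n powr a) powr \<eta>))"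
        using m_ge \<phi>(1)[of l] by (intro frac_le) (auto intro: less_imp_le)
      also have "\<dots> = D * exp c * exp (- c * real n powr b + C * (1 + real n powr a) powr \<eta>)"
        by (simp add: exp_diff exp_add exp_minus field_simps)
      finally show ?thesis .
    qed
    also note elim(1)[THEN conjunct1]
    finally show ?case unfolding B_def by simp
  qed
qed

section \<open>Quenched lower bounds\<close>

context environment
begin

lemma survive_trap_exp:
  assumes e': "\<And>x. 0 \<le> e' x" "\<And>x. e' x \<le> 1" and same: "\<And>x. i < x \<Longrightarrow> x < j \<Longrightarrow> e' x = e x"
    and "i < j" and deep: "u \<le> potential e (j - 1) - potential e i" and u: "exp (- u) \<le> 1 / 2"
    and A: "\<And>x. x \<in> A \<Longrightarrow> x < j" "\<And>x. x \<in> A \<Longrightarrow> x + 1 < j \<Longrightarrow> x + 1 \<in> A"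
      "\<And>x. x \<in> A \<Longrightarrow> x - 1 \<in> A \<or> e' x = 1"
    and x: "x \<in> A" "x \<le> i"
  shows "exp (- 2 * real n * exp (- u)) \<le> survive e' A A n x"
proof -
  define q where "q = exp (potential e i) / exp (potential e (j - 1))"
  have q: "0 \<le> q" "q \<le> exp (- u)"
    using deep by (auto simp: q_def exp_diff[symmetric])
  have "0 \<le> u"
  proof (rule ccontr)
    assume "\<not> 0 \<le> u"
    then have "1 \<le> exp (- u)" by simp
    with u show False by simp
  qed
  have "- 2 * q \<le> - q - 2 * q\<^sup>2"
    using q u mult_left_mono[of q "1/2" q] by (simp add: power2_eq_square)
  also have "\<dots> \<le> ln (1 - q)" using q u by (intro ln_one_minus_pos_lower_bound) auto
  finally have "exp (- 2 * q) \<le> 1 - q"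
    using q u by (subst (asm) ln_ge_iff) auto
  have "exp (- 2 * real n * exp (- u)) \<le> exp (- 2 * real n * q)"
    using q by (simp add: mult_left_mono)
  also have "\<dots> = exp (- 2 * q) ^ n"
    by (simp add: exp_of_nat_mult[symmetric] mult_ac)
  also have "\<dots> \<le> (1 - q) ^ n"
    using \<open>exp (- 2 * q) \<le> 1 - q\<close> by (intro power_mono) auto
  also have "\<dots> \<le> survive e' A A n x"
    unfolding q_def
  proof (rule survive_trap[OF e' \<open>i < j\<close> _ _ _ A x])
    show "e' x * exp (potential e x) = (1 - e' x) * exp (potential e (x - 1))" if "i < x" "x < j" for x
      using exp_potential_balance[of x] same[OF that] by simp
    show "exp (potential e i) \<le> exp (potential e (j - 1))" using deep \<open>0 \<le> u\<close> by simp
  qed auto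
  finally show ?thesis .
qed

lemma deep_traps_powr:
  assumes "deep_traps e b p" "0 < a"
  shows "\<forall>\<^sub>F n in sequentially. \<exists>i j. b (nat \<lfloor>real n powr a\<rfloor>) \<le> i \<and> i < j \<and>
      j \<le> b (nat \<lfloor>real n powr a\<rfloor>) + \<lfloor>real n powr a\<rfloor> \<and>
      p * ln (real_of_int \<lfloor>real n powr a\<rfloor>) \<le> potential e (j - 1) - potential e i"
  using eventually_compose_filterlim[OF assms(1)[unfolded deep_traps_def] filterlim_nat_floor_powr[OF assms(2)]]
    eventually_ge_at_top[of 1]
proof eventually_elim
  case (elim n)
  then have "1 \<le> \<lfloor>real n powr a\<rfloor>" using floor_powr_bounds[of n a] assms by auto
  then show ?case using elim by simp
qed

lemma exp_ln_floor_powr_le: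
  fixes p m y :: real
  assumes "0 < p" "1 \<le> m" "y - 1 \<le> m" "1 < y"
  shows "exp (- (p * ln m)) \<le> (y - 1) powr (- p)"
proof -
  have "exp (- (p * ln m)) = m powr (- p)" using assms by (simp add: powr_def)
  also have "\<dots> \<le> (y - 1) powr (- p)" using assms by (intro powr_mono2') auto
  finally show ?thesis .
qed

lemma hitting_trap_asymp:
  assumes traps: "deep_traps e (\<lambda>_. 0) p" and "0 < a" "0 < p" and \<theta>: "1 - a * p < \<theta>" "0 < \<theta>"
    and e': "e' = e \<or> e' = reflect_env e"
  shows "\<forall>\<^sub>F n in sequentially.
    exp (- (real n powr \<theta>)) \<le> survive e' (- {\<lfloor>real n powr a\<rfloor>}) (- {\<lfloor>real n powr a\<rfloor>}) n 0"
proof -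
  have e'_range: "0 \<le> e' x" "e' x \<le> 1" for x using e' env_le by auto
  have "\<forall>\<^sub>F x in at_top. 2 * x * (x powr a - 1) powr (- p) \<le> x powr \<theta>"
    using assms by real_asymp
  moreover have "\<forall>\<^sub>F x in at_top. (x powr a - 1) powr (- p) \<le> 1 / 2"
    using assms by real_asymp
  moreover have "\<forall>\<^sub>F x in at_top. 1 < x powr a"
    using assms by real_asymp
  ultimately have "\<forall>\<^sub>F x in at_top. 2 * x * (x powr a - 1) powr (- p) \<le> x powr \<theta> \<and>
      (x powr a - 1) powr (- p) \<le> 1 / 2 \<and> 1 < x powr a"
    by (intro eventually_conj)
  then have "\<forall>\<^sub>F n in sequentially. 2 * real n * (real n powr a - 1) powr (- p) \<le> real n powr \<theta> \<and>
      (real n powr a - 1) powr (- p) \<le> 1 / 2 \<and> 1 < real n powr a"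
    by (rule eventually_compose_filterlim[OF _ filterlim_real_sequentially])
  then show ?thesis
    using deep_traps_powr[OF traps \<open>0 < a\<close>] eventually_ge_at_top[of 1]
  proof eventually_elim
    case (elim n)
    define m where "m = \<lfloor>real n powr a\<rfloor>"
    define u where "u = p * ln (real_of_int m)"
    have m: "1 \<le> m" "real_of_int m \<le> real n powr a" "real n powr a - 1 \<le> real_of_int m"
      using floor_powr_bounds[of n a] elim assms by (auto simp: m_def)
    have u: "exp (- u) \<le> (real n powr a - 1) powr (- p)"
      unfolding u_def using assms m elim by (intro exp_ln_floor_powr_le) auto
    from elim obtain i j where ij: "0 \<le> i" "i < j" "j \<le> m" "u \<le> potential e (j - 1) - potential e i"
      unfolding m_def u_def by auto
    have "exp (- 2 * real n * exp (- u)) \<le> survive e' {..<j} {..<j} n 0"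
    proof (rule survive_trap_exp[OF e'_range _ ij(2,4)])
      show "e' x = e x" if "i < x" for x using e' that ij by (auto simp: reflect_env_def)
    qed (use u elim ij in auto)
    also have "\<dots> \<le> survive e' (- {m}) (- {m}) n 0"
      using ij by (intro survive_mono e'_range) auto
    finally have "exp (- 2 * real n * exp (- u)) \<le> survive e' (- {m}) (- {m}) n 0" .
    moreover have "2 * real n * exp (- u) \<le> 2 * real n * (real n powr a - 1) powr (- p)"
      using u by (intro mult_left_mono) auto
    then have "2 * real n * exp (- u) \<le> real n powr \<theta>" using elim by linarith
    then have "exp (- (real n powr \<theta>)) \<le> exp (- 2 * real n * exp (- u))" by simp
    ultimately show ?case unfolding m_def by linarith
  qed
qed

lemma prod_one_minus_env: "finite I \<Longrightarrow> (\<Prod>k\<in>I. 1 - e k) = exp (- (\<Sum>k\<in>I. ln (1 + 1 / rho e k)))"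
  using env by (simp add: ln_one_plus_inverse_rho sum_negf exp_sum)

lemma hitting_left_trap_asymp:
  assumes traps: "deep_traps e (\<lambda>m. - int m) p" and ell: "ellipticity_bound e \<eta>"
    and "0 < a" "0 < p" "0 < \<eta>" "0 \<le> b" and \<theta>: "1 - a * p < \<theta>" "a * \<eta> < \<theta>"
  shows "\<forall>\<^sub>F n in sequentially.
    exp (- (real n powr \<theta>)) \<le> survive e (- {\<lfloor>real n powr b\<rfloor>}) (- {\<lfloor>real n powr b\<rfloor>}) n 0"
proof -
  obtain C where C: "0 < C" "\<And>N. (\<Sum>i\<in>{- int N..int N}. ln (1 + 1 / rho e i)) \<le> C * (1 + real N) powr \<eta>"
    using ell unfolding ellipticity_bound_def by blast
  have "0 < \<theta>" using assms mult_pos_pos[of a \<eta>] by linarith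
  then have "\<forall>\<^sub>F x in at_top. C * (1 + x powr a) powr \<eta> \<le> x powr \<theta> / 2"
    using assms C(1) by real_asymp
  moreover have "\<forall>\<^sub>F x in at_top. 2 * x * (x powr a - 1) powr (- p) \<le> x powr \<theta> / 2"
    using assms \<open>0 < \<theta>\<close> by real_asymp
  moreover have "\<forall>\<^sub>F x in at_top. (x powr a - 1) powr (- p) \<le> 1 / 2"
    using assms by real_asymp
  moreover have "\<forall>\<^sub>F x in at_top. 1 < x powr a"
    using assms by real_asymp
  ultimately have "\<forall>\<^sub>F x in at_top. C * (1 + x powr a) powr \<eta> \<le> x powr \<theta> / 2 \<and>
      2 * x * (x powr a - 1) powr (- p) \<le> x powr \<theta> / 2 \<and>
      (x powr a - 1) powr (- p) \<le> 1 / 2 \<and> 1 < x powr a"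
    by (intro eventually_conj)
  then have "\<forall>\<^sub>F n in sequentially. C * (1 + real n powr a) powr \<eta> \<le> real n powr \<theta> / 2 \<and>
      2 * real n * (real n powr a - 1) powr (- p) \<le> real n powr \<theta> / 2 \<and>
      (real n powr a - 1) powr (- p) \<le> 1 / 2 \<and> 1 < real n powr a"
    by (rule eventually_compose_filterlim[OF _ filterlim_real_sequentially])
  then show ?thesis
    using deep_traps_powr[OF traps \<open>0 < a\<close>] eventually_ge_at_top[of 1]
  proof eventually_elim
    case (elim n)
    define m where "m = \<lfloor>real n powr a\<rfloor>"
    define u where "u = p * ln (real_of_int m)"
    have m: "1 \<le> m" "real_of_int m \<le> real n powr a" "real n powr a - 1 \<le> real_of_int m"
      using floor_powr_bounds[of n a] elim assms by (auto simp: m_def)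
    have u: "exp (- u) \<le> (real n powr a - 1) powr (- p)"
      unfolding u_def using assms m elim by (intro exp_ln_floor_powr_le) auto
    from elim obtain i j where ij: "- m \<le> i" "i < j" "j \<le> 0" "u \<le> potential e (j - 1) - potential e i"
      using m unfolding m_def u_def by auto
    define l where "l = nat (- i)"
    have l: "- int l = i" using ij by (simp add: l_def)
    have b: "1 \<le> \<lfloor>real n powr b\<rfloor>"
      using floor_powr_bounds[of n b] elim assms by auto
    have "exp (- 2 * real n * exp (- u)) \<le> survive e {..<j} {..<j} n i"
      by (rule survive_trap_exp[OF env_le(1,2) _ ij(2,4)]) (use u elim ij in auto)
    also have "\<dots> \<le> survive e {..<1} {..<1} n i"
      using ij by (intro survive_mono env_le) auto
    finally have "(\<Prod>k<l. 1 - e (0 - int k)) * exp (- 2 * real n * exp (- u))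
        \<le> (\<Prod>k<l. 1 - e (0 - int k)) * survive e {..<1} {..<1} n (0 - int l)"
      using env_le(2) l by (intro mult_left_mono prod_nonneg) auto
    also have "\<dots> \<le> survive e {..<1} {..<1} (n + l) 0"
      by (intro survive_ge_prod_down env_le) auto
    also have "\<dots> \<le> survive e {..<1} {..<1} n 0"
      by (intro survive_antimono_time env_le) auto
    also have "\<dots> \<le> survive e (- {\<lfloor>real n powr b\<rfloor>}) (- {\<lfloor>real n powr b\<rfloor>}) n 0"
      using b by (intro survive_mono env_le) auto
    finally have main: "(\<Prod>k<l. 1 - e (0 - int k)) * exp (- 2 * real n * exp (- u))
        \<le> survive e (- {\<lfloor>real n powr b\<rfloor>}) (- {\<lfloor>real n powr b\<rfloor>}) n 0" .
    have "(\<Prod>k<l. 1 - e (0 - int k)) = (\<Prod>k\<in>(\<lambda>k. - int k) ` {..<l}. 1 - e k)"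
      by (subst prod.reindex) (auto simp: inj_on_def)
    also have "\<dots> = exp (- (\<Sum>k\<in>(\<lambda>k. - int k) ` {..<l}. ln (1 + 1 / rho e k)))"
      by (rule prod_one_minus_env) auto
    also have "\<dots> \<ge> exp (- (C * (1 + real n powr a) powr \<eta>))"
    proof -
      have "(\<Sum>k\<in>(\<lambda>k. - int k) ` {..<l}. ln (1 + 1 / rho e k)) \<le> (\<Sum>i\<in>{- int (nat m)..int (nat m)}. ln (1 + 1 / rho e i))"
        using m ij l by (intro sum_mono2 ln_one_plus_inverse_rho) auto
      also have "\<dots> \<le> C * (1 + real_of_int m) powr \<eta>" using C(2)[of "nat m"] m by simp
      also have "\<dots> \<le> C * (1 + real n powr a) powr \<eta>"
        using m C assms by (intro mult_left_mono powr_mono2) auto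
      finally show ?thesis by simp
    qed
    finally have "exp (- (C * (1 + real n powr a) powr \<eta>)) * exp (- 2 * real n * exp (- u))
        \<le> (\<Prod>k<l. 1 - e (0 - int k)) * exp (- 2 * real n * exp (- u))"
      by (intro mult_right_mono) auto
    with main have "exp (- (C * (1 + real n powr a) powr \<eta>)) * exp (- 2 * real n * exp (- u))
        \<le> survive e (- {\<lfloor>real n powr b\<rfloor>}) (- {\<lfloor>real n powr b\<rfloor>}) n 0" by linarith
    moreover have "2 * real n * exp (- u) \<le> 2 * real n * (real n powr a - 1) powr (- p)"
      using u by (intro mult_left_mono) auto
    then have "C * (1 + real n powr a) powr \<eta> + 2 * real n * exp (- u) \<le> real n powr \<theta>"
      using elim by linarith
    then have "exp (- (real n powr \<theta>)) \<le> exp (- (C * (1 + real n powr a) powr \<eta>)) * exp (- 2 * real n * exp (- u))"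
      by (simp add: exp_add[symmetric])
    ultimately show ?case by linarith
  qed
qed

lemma position_return_asymp:
  assumes traps: "deep_traps e (\<lambda>_. 0) p" and ell: "ellipticity_bound e \<eta>"
    and "0 < a" "a < 1" "0 < p" "0 < \<eta>" "0 < b" and \<theta>: "1 - a * p < \<theta>" "a * \<eta> < \<theta>" "a < \<theta>"
  shows "\<forall>\<^sub>F n in sequentially.
    exp (- (real n powr \<theta>)) \<le> survive (reflect_env e) UNIV {x. real_of_int x < real n powr b} n 0"
proof -
  define e' where "e' = reflect_env e"
  obtain C where C: "0 < C" "\<And>N. (\<Sum>i\<in>{- int N..int N}. ln (1 + 1 / rho e i)) \<le> C * (1 + real N) powr \<eta>"
    using ell unfolding ellipticity_bound_def by blast
  define D where "D = ln (1 + 1 / rho e 1)"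
  have D: "0 < D" using rho_pos[of 1] by (simp add: D_def ln_gt_zero)
  have e'_range: "0 \<le> e' x" "e' x \<le> 1" for x using env_le by (auto simp: e'_def)
  have "\<forall>\<^sub>F x in at_top. D * x powr a \<le> x powr \<theta> / 3"
    using assms D by real_asymp
  moreover have "\<forall>\<^sub>F x in at_top. C * (1 + x powr a) powr \<eta> \<le> x powr \<theta> / 3"
    using assms C(1) by real_asymp
  moreover have "\<forall>\<^sub>F x in at_top. 2 * x * (x powr a - 1) powr (- p) \<le> x powr \<theta> / 3"
    using assms by real_asymp
  moreover have "\<forall>\<^sub>F x in at_top. (x powr a - 1) powr (- p) \<le> 1 / 2"
    using assms by real_asymp
  moreover have "\<forall>\<^sub>F x in at_top. 1 < x powr a"
    using assms by real_asymp
  moreover have "\<forall>\<^sub>F x in at_top. x powr a \<le> x"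
    using assms by real_asymp
  moreover have "\<forall>\<^sub>F x in at_top. 1 < x powr b"
    using assms by real_asymp
  ultimately have "\<forall>\<^sub>F x in at_top. D * x powr a \<le> x powr \<theta> / 3 \<and> C * (1 + x powr a) powr \<eta> \<le> x powr \<theta> / 3 \<and>
      2 * x * (x powr a - 1) powr (- p) \<le> x powr \<theta> / 3 \<and>
      (x powr a - 1) powr (- p) \<le> 1 / 2 \<and> 1 < x powr a \<and> x powr a \<le> x \<and> 1 < x powr b"
    by (intro eventually_conj)
  then have "\<forall>\<^sub>F n in sequentially. D * real n powr a \<le> real n powr \<theta> / 3 \<and> C * (1 + real n powr a) powr \<eta> \<le> real n powr \<theta> / 3 \<and>
      2 * real n * (real n powr a - 1) powr (- p) \<le> real n powr \<theta> / 3 \<and>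
      (real n powr a - 1) powr (- p) \<le> 1 / 2 \<and> 1 < real n powr a \<and> real n powr a \<le> real n \<and> 1 < real n powr b"
    by (rule eventually_compose_filterlim[OF _ filterlim_real_sequentially])
  then show ?thesis
    using deep_traps_powr[OF traps \<open>0 < a\<close>] eventually_ge_at_top[of 1]
  proof eventually_elim
    case (elim n)
    define m where "m = \<lfloor>real n powr a\<rfloor>"
    define l where "l = nat m"
    define u where "u = p * ln (real_of_int m)"
    have m: "1 \<le> m" "real_of_int m \<le> real n powr a" "real n powr a - 1 \<le> real_of_int m"
      using floor_powr_bounds[of n a] elim assms by (auto simp: m_def)
    have l: "int l = m" using m by (simp add: l_def)
    have "real l \<le> real n powr a" using m l by (simp add: l_def)
    then have "l \<le> n" using elim by linarith
    have u: "exp (- u) \<le> (real n powr a - 1) powr (- p)"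
      unfolding u_def using assms m elim by (intro exp_ln_floor_powr_le) auto
    from elim obtain i j where ij: "0 \<le> i" "i < j" "j \<le> m" "u \<le> potential e (j - 1) - potential e i"
      unfolding m_def u_def by auto
    define c where "c = exp (- (D * real n powr a + C * (1 + real n powr a) powr \<eta>))"
    have return: "c \<le> survive e' UNIV {0, 1} l y" if "y \<in> {0..<j}" for y
    proof -
      have "(\<Sum>k\<in>{1..y}. ln (1 + 1 / rho e k)) \<le> (\<Sum>i\<in>{- int l..int l}. ln (1 + 1 / rho e i))"
        using that ij l by (intro sum_mono2 ln_one_plus_inverse_rho) auto
      also have "\<dots> \<le> C * (1 + real l) powr \<eta>" by (rule C)
      also have "\<dots> \<le> C * (1 + real n powr a) powr \<eta>"
        using \<open>real l \<le> real n powr a\<close> C assms by (intro mult_left_mono powr_mono2) auto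
      finally have "(\<Sum>k\<in>{1..y}. ln (1 + 1 / rho e k)) \<le> C * (1 + real n powr a) powr \<eta>" .
      moreover have "real l * D \<le> real n powr a * D"
        using \<open>real l \<le> real n powr a\<close> D by (intro mult_right_mono) auto
      ultimately have "real l * D + (\<Sum>k\<in>{1..y}. ln (1 + 1 / rho e k)) \<le> D * real n powr a + C * (1 + real n powr a) powr \<eta>"
        by (simp only: mult.commute[of D])
      then have "c \<le> exp (- (real l * D)) * exp (- (\<Sum>k\<in>{1..y}. ln (1 + 1 / rho e k)))"
        by (simp add: c_def exp_add[symmetric])
      also have "\<dots> = (1 - e 1) ^ l * (\<Prod>k\<in>{1..y}. 1 - e k)"
        using env[of 1] by (simp add: prod_one_minus_env D_def ln_one_plus_inverse_rho exp_of_nat_mult)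
      also have "\<dots> = (1 - e' 1) ^ l * (\<Prod>k\<in>{1..y}. 1 - e' k)"
        by (auto simp: e'_def reflect_env_def intro!: prod.cong)
      also have "\<dots> \<le> survive e' UNIV {0, 1} l y"
        using that ij l e'_range by (intro survive_return_ge) (auto simp: e'_def reflect_env_def)
      finally show ?thesis .
    qed
    have "exp (- 2 * real n * exp (- u)) \<le> exp (- 2 * real (n - l) * exp (- u))"
      by (simp add: mult_right_mono)
    also have "\<dots> \<le> survive e' {0..<j} {0..<j} (n - l) 0"
      by (rule survive_trap_exp[OF e'_range _ ij(2,4)])
        (use u elim ij in \<open>auto simp: e'_def reflect_env_def\<close>)
    finally have "c * exp (- 2 * real n * exp (- u)) \<le> c * survive e' {0..<j} {0..<j} (n - l) 0"
      by (intro mult_left_mono) (auto simp: c_def)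
    also have "\<dots> \<le> survive e' UNIV {0, 1} (n - l + l) 0"
      using return by (intro survive_add_ge e'_range) (auto simp: c_def)
    also have "\<dots> \<le> survive e' UNIV {x. real_of_int x < real n powr b} n 0"
      using \<open>l \<le> n\<close> elim by (auto intro!: survive_mono e'_range)
    finally have main: "c * exp (- 2 * real n * exp (- u)) \<le> survive e' UNIV {x. real_of_int x < real n powr b} n 0" .
    have "2 * real n * exp (- u) \<le> 2 * real n * (real n powr a - 1) powr (- p)"
      using u by (intro mult_left_mono) auto
    then have "D * real n powr a + C * (1 + real n powr a) powr \<eta> + 2 * real n * exp (- u) \<le> real n powr \<theta>"
      using elim by linarith
    then have "exp (- (real n powr \<theta>)) \<le> c * exp (- 2 * real n * exp (- u))"
      by (simp add: c_def exp_add[symmetric])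
    with main show ?case unfolding e'_def by linarith
  qed
qed

end

lemma log_log_tendsto:
  fixes P :: "nat \<Rightarrow> real"
  assumes "0 < \<theta>"
    and lower: "\<And>t. \<theta> < t \<Longrightarrow> \<forall>\<^sub>F n in sequentially. exp (- (real n powr t)) \<le> P n"
    and upper: "\<And>t. 0 < t \<Longrightarrow> t < \<theta> \<Longrightarrow> \<forall>\<^sub>F n in sequentially. P n \<le> exp (- (real n powr t))"
  shows "(\<lambda>n. ln (- ln (P n)) / ln (real n)) \<longlonglongrightarrow> \<theta>"
proof (rule order_tendstoI)
  fix y assume "y < \<theta>"
  then obtain t where t: "max y 0 < t" "t < \<theta>" using \<open>0 < \<theta>\<close> dense[of "max y 0" \<theta>] by auto
  have "\<forall>\<^sub>F n in sequentially. P n \<le> exp (- (real n powr t))" using upper t by auto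
  then show "\<forall>\<^sub>F n in sequentially. y < ln (- ln (P n)) / ln (real n)"
    using lower[of "\<theta> + 1", simplified] eventually_ge_at_top[of 2]
  proof eventually_elim
    case (elim n)
    have "0 < P n" using elim(2) by (meson exp_gt_zero less_le_trans)
    then have "ln (P n) \<le> - (real n powr t)" using elim(1) by (metis ln_exp ln_le_cancel_iff exp_gt_zero)
    then have "ln (real n powr t) \<le> ln (- ln (P n))" using elim by (intro ln_mono) auto
    then have "t * ln (real n) \<le> ln (- ln (P n))" using elim by (simp add: ln_powr)
    then have "t \<le> ln (- ln (P n)) / ln (real n)" using elim by (simp add: field_simps)
    then show ?case using t by simp
  qed
next
  fix y assume "\<theta> < y"
  then obtain t where t: "\<theta> < t" "t < y" using dense by auto
  have "\<forall>\<^sub>F n in sequentially. exp (- (real n powr t)) \<le> P n" using lower t by auto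
  moreover have "\<forall>\<^sub>F n in sequentially. P n \<le> exp (- (real n powr (\<theta> / 2)))"
    using \<open>0 < \<theta>\<close> by (intro upper) auto
  ultimately show "\<forall>\<^sub>F n in sequentially. ln (- ln (P n)) / ln (real n) < y"
    using eventually_ge_at_top[of 2]
  proof eventually_elim
    case e: (elim n)
    note elim = e(3,2,1)
    have P: "0 < P n" using elim(3) by (meson exp_gt_zero less_le_trans)
    then have "ln (P n) \<le> - (real n powr (\<theta> / 2))" using elim(2) by (metis ln_exp ln_le_cancel_iff exp_gt_zero)
    moreover have "0 < real n powr (\<theta> / 2)" using elim by simp
    ultimately have pos: "0 < - ln (P n)" by linarith
    have "- (real n powr t) \<le> ln (P n)" using elim(3) P by (metis ln_exp ln_le_cancel_iff exp_gt_zero)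
    then have "ln (- ln (P n)) \<le> ln (real n powr t)" using pos by (intro ln_mono) auto
    then have "ln (- ln (P n)) \<le> t * ln (real n)" using elim by (simp add: ln_powr)
    then have "ln (- ln (P n)) / ln (real n) \<le> t" using elim by (simp add: field_simps)
    then show ?case using t by simp
  qed
qed

lemma AE_log_log_tendsto:
  fixes P :: "'a \<Rightarrow> nat \<Rightarrow> real"
  assumes "0 < \<theta>"
    and lower: "\<And>t. \<theta> < t \<Longrightarrow> AE x in M. \<forall>\<^sub>F n in sequentially. exp (- (real n powr t)) \<le> P x n"
    and upper: "\<And>t. 0 < t \<Longrightarrow> t < \<theta> \<Longrightarrow> AE x in M. \<forall>\<^sub>F n in sequentially. P x n \<le> exp (- (real n powr t))"
  shows "AE x in M. (\<lambda>n. ln (- ln (P x n)) / ln (real n)) \<longlonglongrightarrow> \<theta>"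
proof -
  define lo where "lo k = \<theta> + 1 / real (Suc k)" for k
  define up where "up k = \<theta> - \<theta> / real (k + 2)" for k
  have "AE x in M. \<forall>k. \<forall>\<^sub>F n in sequentially. exp (- (real n powr lo k)) \<le> P x n"
    unfolding AE_all_countable by (intro allI lower) (simp add: lo_def)
  moreover have "AE x in M. \<forall>k. \<forall>\<^sub>F n in sequentially. P x n \<le> exp (- (real n powr up k))"
    unfolding AE_all_countable using \<open>0 < \<theta>\<close> by (intro allI upper) (auto simp: up_def field_simps intro!: add_pos_nonneg)
  ultimately show ?thesis
  proof eventually_elim
    case (elim x)
    show ?case
    proof (rule log_log_tendsto[OF \<open>0 < \<theta>\<close>])
      fix t assume "\<theta> < t"
      then obtain k where "1 / real (Suc k) < t - \<theta>" using reals_Archimedean[of "t - \<theta>"] by (auto simp: inverse_eq_divide)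
      then have "lo k \<le> t" by (simp add: lo_def)
      from elim(1)[THEN spec, of k] eventually_ge_at_top[of 1]
      show "\<forall>\<^sub>F n in sequentially. exp (- (real n powr t)) \<le> P x n"
      proof eventually_elim
        case (elim n)
        have "real n powr lo k \<le> real n powr t" using elim \<open>lo k \<le> t\<close> by (intro powr_mono) auto
        then show ?case using elim by (meson exp_le_cancel_iff neg_le_iff_le order_trans)
      qed
    next
      fix t assume "0 < t" "t < \<theta>"
      then obtain k where k: "1 / real (Suc k) < (\<theta> - t) / \<theta>" using reals_Archimedean[of "(\<theta> - t) / \<theta>"] by (auto simp: inverse_eq_divide)
      have "1 / real (k + 2) \<le> 1 / real (Suc k)" by (simp add: frac_le)
      with k have "1 / real (k + 2) \<le> (\<theta> - t) / \<theta>" by linarith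
      then have "t \<le> up k" using \<open>0 < \<theta>\<close> mult_left_mono[of "1 / real (k + 2)" "(\<theta> - t) / \<theta>" \<theta>] by (simp add: up_def)
      from elim(2)[THEN spec, of k] eventually_ge_at_top[of 1]
      show "\<forall>\<^sub>F n in sequentially. P x n \<le> exp (- (real n powr t))"
      proof eventually_elim
        case (elim n)
        have "real n powr t \<le> real n powr up k" using elim \<open>t \<le> up k\<close> by (intro powr_mono) auto
        then show ?case using elim by (meson exp_le_cancel_iff neg_le_iff_le order_trans)
      qed
    qed
  qed
qed

section \<open>Moments of the environment\<close>

lemma (in prob_space) AE_polynomial_bound:
  fixes f :: "int \<Rightarrow> 'a \<Rightarrow> ennreal"
  assumes [measurable]: "\<And>i. f i \<in> borel_measurable M"
    and A: "\<And>i. (\<integral>\<^sup>+x. f i x \<partial>M) \<le> ennreal A" and "1 < \<eta>"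
  shows "AE x in M. \<exists>C>0. \<forall>N. (\<Sum>i\<in>{- int N..int N}. f i x) \<le> ennreal (C * (1 + real N) powr \<eta>)"
proof -
  define w where "w n = ennreal (real (Suc n) powr (- \<eta>))" for n
  define X where "X x = (\<Sum>n. (f (int n) x + f (- int n) x) * w n)" for x
  have "(\<integral>\<^sup>+x. X x \<partial>M) = (\<Sum>n. (\<integral>\<^sup>+x. (f (int n) x + f (- int n) x) * w n \<partial>M))"
    unfolding X_def by (intro nn_integral_suminf) measurable
  also have "\<dots> \<le> (\<Sum>n. (ennreal A + ennreal A) * w n)"
  proof (intro suminf_le allI summableI)
    fix n
    have "(\<integral>\<^sup>+x. (f (int n) x + f (- int n) x) * w n \<partial>M)
        = ((\<integral>\<^sup>+x. f (int n) x \<partial>M) + (\<integral>\<^sup>+x. f (- int n) x \<partial>M)) * w n"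
      by (simp add: nn_integral_multc nn_integral_add)
    also have "\<dots> \<le> (ennreal A + ennreal A) * w n"
      using A by (intro mult_right_mono add_mono) auto
    finally show "(\<integral>\<^sup>+x. (f (int n) x + f (- int n) x) * w n \<partial>M) \<le> (ennreal A + ennreal A) * w n" .
  qed
  also have "\<dots> = (ennreal A + ennreal A) * (\<Sum>n. w n)"
    by (rule ennreal_suminf_cmult)
  also have "\<dots> < \<infinity>"
  proof -
    have "summable (\<lambda>n. real (Suc n) powr (- \<eta>))"
      using \<open>1 < \<eta>\<close> by (subst summable_Suc_iff) (simp add: summable_real_powr_iff)
    then have "(\<Sum>n. w n) = ennreal (\<Sum>n. real (Suc n) powr (- \<eta>))"
      unfolding w_def by (intro suminf_ennreal_eq summable_sums) auto
    then show ?thesis by (simp add: ennreal_mult_less_top)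
  qed
  finally have fin: "(\<integral>\<^sup>+x. X x \<partial>M) \<noteq> \<infinity>" by simp
  have [measurable]: "X \<in> borel_measurable M" unfolding X_def by measurable
  have "AE x in M. X x \<noteq> \<infinity>" using fin by (intro nn_integral_noteq_infinite) auto
  then show ?thesis
  proof eventually_elim
    case (elim x)
    obtain r where r: "0 \<le> r" "X x = ennreal r" using elim by (cases "X x") auto
    have "(\<Sum>i\<in>{- int N..int N}. f i x) \<le> ennreal ((r + 1) * (1 + real N) powr \<eta>)" for N
    proof -
      have "{- int N..int N} \<subseteq> int ` {..N} \<union> (\<lambda>n. - int n) ` {..N}"
      proof
        fix i assume "i \<in> {- int N..int N}"
        then show "i \<in> int ` {..N} \<union> (\<lambda>n. - int n) ` {..N}"
          by (cases "0 \<le> i") (auto intro: image_eqI[of _ _ "nat i"] image_eqI[of _ _ "nat (- i)"])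
      qed
      then have "(\<Sum>i\<in>{- int N..int N}. f i x) \<le> (\<Sum>i\<in>int ` {..N} \<union> (\<lambda>n. - int n) ` {..N}. f i x)"
        by (intro sum_mono2) auto
      also have "\<dots> \<le> (\<Sum>i\<in>int ` {..N}. f i x) + (\<Sum>i\<in>(\<lambda>n. - int n) ` {..N}. f i x)"
        by (subst sum.union_inter[symmetric]) auto
      also have "\<dots> = (\<Sum>n\<le>N. f (int n) x + f (- int n) x)"
        by (simp add: sum.reindex inj_on_def sum.distrib)
      also have "\<dots> \<le> (\<Sum>n\<le>N. (f (int n) x + f (- int n) x) * w n * ennreal ((1 + real N) powr \<eta>))"
      proof (rule sum_mono)
        fix n assume "n \<in> {..N}"
        then have "real (Suc n) powr \<eta> \<le> (1 + real N) powr \<eta>" using \<open>1 < \<eta>\<close> by (intro powr_mono2) auto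
        then have "1 \<le> real (Suc n) powr (- \<eta>) * (1 + real N) powr \<eta>"
          by (simp add: powr_minus field_simps)
        then have "1 \<le> w n * ennreal ((1 + real N) powr \<eta>)"
          unfolding w_def by (subst ennreal_mult[symmetric]) (auto simp: ennreal_1[symmetric] simp del: ennreal_1 intro!: ennreal_leI)
        from mult_left_mono[OF this, of "f (int n) x + f (- int n) x"]
        show "f (int n) x + f (- int n) x \<le> (f (int n) x + f (- int n) x) * w n * ennreal ((1 + real N) powr \<eta>)"
          by (simp add: mult.assoc)
      qed
      also have "\<dots> = (\<Sum>n\<le>N. (f (int n) x + f (- int n) x) * w n) * ennreal ((1 + real N) powr \<eta>)"
        by (simp add: sum_distrib_right)
      also have "\<dots> \<le> X x * ennreal ((1 + real N) powr \<eta>)"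
        unfolding X_def by (intro mult_right_mono sum_le_suminf) auto
      also have "\<dots> = ennreal (r * (1 + real N) powr \<eta>)"
        using r by (simp add: ennreal_mult)
      also have "\<dots> \<le> ennreal ((r + 1) * (1 + real N) powr \<eta>)"
        using r by (intro ennreal_leI mult_right_mono) auto
      finally show ?thesis .
    qed
    then show ?case using r by (intro exI[of _ "r + 1"]) auto
  qed
qed

lemma powr_weighted_mean:
  fixes y t :: real
  assumes "0 < y" "0 < t" "t < 1"
  shows "y powr t \<le> (1 - t) + t * y" "y powr t = (1 - t) + t * y \<Longrightarrow> y = 1"
proof -
  define u where "u = ln y"
  have u: "y = exp u" using assms by (simp add: u_def)
  have eq: "(1 - t) + t * exp u - exp (t * u) =
      exp (t * u) * ((1 - t) * (exp (- (t * u)) - (1 - t * u)) + t * (exp ((1 - t) * u) - (1 + (1 - t) * u)))"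
  proof -
    have "exp (t * u) * exp (- (t * u)) = 1" "exp (t * u) * exp ((1 - t) * u) = exp u"
      by (simp_all add: exp_add[symmetric] algebra_simps)
    then show ?thesis by algebra
  qed
  have nonneg: "0 \<le> exp (- (t * u)) - (1 - t * u)" "0 \<le> exp ((1 - t) * u) - (1 + (1 - t) * u)"
    using exp_ge_add_one_self[of "- (t * u)"] exp_ge_add_one_self[of "(1 - t) * u"] by auto
  have "0 \<le> (1 - t) + t * exp u - exp (t * u)"
    unfolding eq using nonneg assms by (intro mult_nonneg_nonneg add_nonneg_nonneg) auto
  then show "y powr t \<le> (1 - t) + t * y" using assms by (simp add: powr_def u_def)
  assume "y powr t = (1 - t) + t * y"
  then have "(1 - t) + t * exp u - exp (t * u) = 0" using assms by (simp add: powr_def u_def)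
  then have "(1 - t) * (exp (- (t * u)) - (1 - t * u)) + t * (exp ((1 - t) * u) - (1 + (1 - t) * u)) = 0"
    unfolding eq by simp
  then have "(1 - t) * (exp (- (t * u)) - (1 - t * u)) = 0"
    using nonneg assms by (subst (asm) add_nonneg_eq_0_iff) auto
  then have "exp (- (t * u)) = 1 - t * u" using assms by simp
  then have "ln (exp (- (t * u))) = exp (- (t * u)) - 1" unfolding ln_exp by linarith
  then have "exp (- (t * u)) = 1" by (intro ln_eq_minus_one) auto
  then show "y = 1" using assms u by simp
qed

lemma ln_one_plus_inverse_le:
  fixes y \<epsilon> :: real
  assumes "0 < y" "0 < \<epsilon>" "\<epsilon> \<le> 1"
  shows "ln (1 + 1 / y) \<le> (2 / \<epsilon>) * (1 + y powr (- \<epsilon>))"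
proof -
  define z where "z = 1 / y"
  have z: "0 < z" using assms by (simp add: z_def)
  have "ln (1 + z) = ln ((1 + z) powr \<epsilon>) / \<epsilon>" using assms z by (simp add: ln_powr)
  also have "\<dots> \<le> (1 + z) powr \<epsilon> / \<epsilon>"
    using assms z ln_bound[of "(1 + z) powr \<epsilon>"] by (intro divide_right_mono) auto
  also have "(1 + z) powr \<epsilon> \<le> 2 * (1 + z powr \<epsilon>)"
  proof -
    have "(1 + z) powr \<epsilon> \<le> (2 * max 1 z) powr \<epsilon>" using assms z by (intro powr_mono2) auto
    also have "\<dots> = 2 powr \<epsilon> * max 1 z powr \<epsilon>" by (simp add: powr_mult)
    also have "\<dots> \<le> 2 powr 1 * (1 + z powr \<epsilon>)"
      using assms by (intro mult_mono powr_mono) (auto simp: max_def)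
    finally show ?thesis by simp
  qed
  also have "z powr \<epsilon> = y powr (- \<epsilon>)"
    using assms by (simp add: z_def powr_minus powr_divide inverse_eq_divide)
  finally show ?thesis using assms by (simp add: z_def divide_right_mono)
qed

locale iid_ratios = prob_space M for M :: "'a measure" +
  fixes R :: "int \<Rightarrow> 'a \<Rightarrow> real" and \<kappa> :: real
  assumes indep: "indep_vars (\<lambda>_. borel) R UNIV"
    and ident: "distr M borel (R i) = distr M borel (R 0)"
    and pos: "x \<in> space M \<Longrightarrow> 0 < R i x"
    and transient: "expectation (\<lambda>x. ln (R 0 x)) < 0"
    and kappa_pos: "0 < \<kappa>"
    and kappa_integrable: "integrable M (\<lambda>x. R 0 x powr \<kappa>)"
    and kappa_one: "expectation (\<lambda>x. R 0 x powr \<kappa>) = 1"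
begin

definition moment :: "real \<Rightarrow> real" where
  "moment s = expectation (\<lambda>x. R 0 x powr s)"

lemma measurable_R [measurable]: "R i \<in> borel_measurable M"
  using indep unfolding indep_vars_def by auto

lemma nn_integral_R:
  assumes [measurable]: "g \<in> borel_measurable borel"
  shows "(\<integral>\<^sup>+x. g (R i x) \<partial>M) = (\<integral>\<^sup>+x. g (R 0 x) \<partial>M)"
  using nn_integral_distr[of "R i" M borel g] nn_integral_distr[of "R 0" M borel g] ident[of i] by simp

lemma nn_integral_prod_R:
  assumes "finite I" and [measurable]: "\<And>i. g i \<in> borel_measurable borel"
  shows "(\<integral>\<^sup>+x. (\<Prod>i\<in>I. g i (R i x)) \<partial>M) = (\<Prod>i\<in>I. \<integral>\<^sup>+x. g i (R 0 x) \<partial>M)"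
proof -
  have "indep_vars (\<lambda>_. borel) (\<lambda>i x. g i (R i x)) I"
    by (rule indep_vars_compose2[OF indep_vars_subset[OF indep]]) auto
  then have "(\<integral>\<^sup>+x. (\<Prod>i\<in>I. g i (R i x)) \<partial>M) = (\<Prod>i\<in>I. \<integral>\<^sup>+x. g i (R i x) \<partial>M)"
    using assms by (intro indep_vars_nn_integral) auto
  also have "\<dots> = (\<Prod>i\<in>I. \<integral>\<^sup>+x. g i (R 0 x) \<partial>M)"
    by (intro prod.cong nn_integral_R) auto
  finally show ?thesis .
qed

lemma integrable_moment:
  assumes "0 \<le> s" "s \<le> \<kappa>"
  shows "integrable M (\<lambda>x. R 0 x powr s)"
proof (rule Bochner_Integration.integrable_bound[where f = "\<lambda>x. 1 + R 0 x powr \<kappa>"])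
  show "AE x in M. norm (R 0 x powr s) \<le> norm (1 + R 0 x powr \<kappa>)"
  proof (rule AE_I2)
    fix x assume x: "x \<in> space M"
    show "norm (R 0 x powr s) \<le> norm (1 + R 0 x powr \<kappa>)"
    proof (cases "R 0 x \<le> 1")
      case True
      then have "R 0 x powr s \<le> 1" using assms pos[OF x, of 0] by (intro powr_le1) auto
      then show ?thesis by (simp add: add_increasing2)
    next
      case False
      then have "R 0 x powr s \<le> R 0 x powr \<kappa>" using assms by (intro powr_mono) auto
      then show ?thesis by simp
    qed
  qed
qed (use kappa_integrable in auto)

lemma nn_integral_moment:
  assumes "0 \<le> s" "s \<le> \<kappa>"
  shows "(\<integral>\<^sup>+x. ennreal (R 0 x powr s) \<partial>M) = ennreal (moment s)"
  unfolding moment_def by (rule nn_integral_eq_integral[OF integrable_moment[OF assms]]) auto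

lemma moment_pos:
  assumes "0 \<le> s" "s \<le> \<kappa>"
  shows "0 < moment s"
proof -
  have "moment s \<noteq> 0"
  proof
    assume "moment s = 0"
    then have "AE x in M. R 0 x powr s = 0"
      unfolding moment_def using integrable_moment[OF assms] by (subst (asm) integral_nonneg_eq_0_iff_AE) auto
    moreover have "AE x in M. 0 < R 0 x" using pos by (intro AE_I2)
    ultimately have "AE x in M. False" by eventually_elim auto
    then show False by simp
  qed
  moreover have "0 \<le> moment s" unfolding moment_def by (intro integral_nonneg_AE) auto
  ultimately show ?thesis by simp
qed

lemma moment_less_1:
  assumes "0 < s" "s < \<kappa>"
  shows "moment s < 1"
proof (rule ccontr)
  assume "\<not> moment s < 1"
  define t where "t = s / \<kappa>"
  have t: "0 < t" "t < 1" using assms by (auto simp: t_def)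
  have eq: "R 0 x powr s = (R 0 x powr \<kappa>) powr t" for x
    using assms by (simp add: powr_powr t_def)
  define g where "g x = (1 - t) + t * R 0 x powr \<kappa> - R 0 x powr s" for x
  have int: "integrable M g"
    unfolding g_def using kappa_integrable integrable_moment[of s] assms by auto
  have "expectation g = 1 - moment s"
    unfolding g_def moment_def using kappa_integrable integrable_moment[of s] assms kappa_one
    by (simp add: prob_space)
  moreover have nonneg: "AE x in M. 0 \<le> g x"
  proof (rule AE_I2)
    fix x assume "x \<in> space M"
    then have "0 < R 0 x powr \<kappa>" using pos[of x 0] by simp
    then show "0 \<le> g x" unfolding g_def eq using powr_weighted_mean(1)[OF _ t] by simp
  qed
  then have "0 \<le> expectation g" by (rule integral_nonneg_AE)
  ultimately have "expectation g = 0" using \<open>\<not> moment s < 1\<close> by simp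
  then have "AE x in M. g x = 0"
    using integral_nonneg_eq_0_iff_AE[OF int nonneg] by simp
  moreover have "AE x in M. 0 < R 0 x" using pos by (intro AE_I2)
  ultimately have "AE x in M. ln (R 0 x) = 0"
  proof eventually_elim
    case (elim x)
    then have "(R 0 x powr \<kappa>) powr t = (1 - t) + t * R 0 x powr \<kappa>" "0 < R 0 x powr \<kappa>"
      unfolding g_def eq by simp_all
    then have "R 0 x powr \<kappa> = 1"
      by (intro powr_weighted_mean(2)[OF _ t])
    then show ?case using elim kappa_pos by (simp add: powr_def)
  qed
  then have "expectation (\<lambda>x. ln (R 0 x)) = 0"
    by (rule integral_eq_zero_AE)
  then show False using transient by simp
qed

lemma AE_prod_exp_decay:
  assumes I: "\<And>k. finite (I k)" "\<And>k. card (I k) = k"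
  obtains c where "0 < c" "AE x in M. \<exists>C>0. \<forall>k. (\<Prod>i\<in>I k. R i x) \<le> C * exp (- c * real k)"
proof -
  define s where "s = \<kappa> / 2"
  have s: "0 < s" "s < \<kappa>" using kappa_pos by (auto simp: s_def)
  define m where "m = moment s"
  have m: "0 < m" "m < 1" using moment_less_1[of s] moment_pos[of s] s by (auto simp: m_def)
  define c where "c = - ln m / (2 * s)"
  have c: "0 < c" using m s by (simp add: c_def divide_neg_pos)
  have cs: "exp (c * s) * m = exp (ln m / 2)"
  proof -
    have "exp (c * s) * m = exp (c * s + ln m)" using m by (simp add: exp_add)
    also have "c * s + ln m = ln m / 2" using s by (simp add: c_def field_simps)
    finally show ?thesis .
  qed
  define \<theta> where "\<theta> = exp (ln m / 2)"
  have \<theta>: "0 < \<theta>" "\<theta> < 1" using m by (auto simp: \<theta>_def)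
  define Y where "Y k x = (\<Prod>i\<in>I k. ennreal (exp (c * s) * R i x powr s))" for k x
  have [measurable]: "Y k \<in> borel_measurable M" for k unfolding Y_def by measurable
  have "(\<integral>\<^sup>+x. Y k x \<partial>M) = ennreal (\<theta> ^ k)" for k
  proof -
    have "(\<integral>\<^sup>+x. Y k x \<partial>M) = (\<Prod>i\<in>I k. \<integral>\<^sup>+x. ennreal (exp (c * s) * R 0 x powr s) \<partial>M)"
      unfolding Y_def by (rule nn_integral_prod_R) (auto intro: I)
    also have "(\<integral>\<^sup>+x. ennreal (exp (c * s) * R 0 x powr s) \<partial>M) = ennreal (exp (c * s)) * ennreal m"
      using s by (simp add: ennreal_mult nn_integral_cmult nn_integral_moment m_def)
    also have "\<dots> = ennreal \<theta>"
      using m cs by (simp add: ennreal_mult[symmetric] \<theta>_def)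
    finally show ?thesis using \<theta> by (simp add: I ennreal_power)
  qed
  then have "(\<integral>\<^sup>+x. (\<Sum>k. Y k x) \<partial>M) = (\<Sum>k. ennreal (\<theta> ^ k))"
    by (subst nn_integral_suminf) auto
  also have "\<dots> = ennreal (\<Sum>k. \<theta> ^ k)"
    using \<theta> by (intro suminf_ennreal_eq summable_sums summable_geometric) auto
  finally have "(\<integral>\<^sup>+x. (\<Sum>k. Y k x) \<partial>M) \<noteq> \<infinity>" by simp
  then have "AE x in M. (\<Sum>k. Y k x) \<noteq> \<infinity>"
    by (intro nn_integral_noteq_infinite) auto
  then have "AE x in M. \<exists>C>0. \<forall>k. (\<Prod>i\<in>I k. R i x) \<le> C * exp (- c * real k)"
    using AE_space
  proof eventually_elim
    case (elim x)
    obtain r where r: "0 \<le> r" "(\<Sum>k. Y k x) = ennreal r" using elim by (cases "\<Sum>k. Y k x") auto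
    have "(\<Prod>i\<in>I k. R i x) \<le> (r + 1) powr (1 / s) * exp (- c * real k)" for k
    proof -
      define P where "P = (\<Prod>i\<in>I k. R i x)"
      have P: "0 < P" unfolding P_def using pos[OF elim(2)] by (intro prod_pos) auto
      have "Y k x = ennreal (\<Prod>i\<in>I k. exp (c * s) * R i x powr s)"
        unfolding Y_def by (intro prod_ennreal) auto
      also have "(\<Prod>i\<in>I k. exp (c * s) * R i x powr s) = (exp (c * real k) * P) powr s"
        using pos[OF elim(2)] P unfolding P_def
        by (simp add: prod.distrib I powr_mult prod_powr_distrib less_imp_le exp_powr_real exp_of_nat_mult[symmetric] mult_ac)
      finally have "ennreal ((exp (c * real k) * P) powr s) \<le> (\<Sum>k. Y k x)"
        using sum_le_suminf[of "\<lambda>k. Y k x" "{k}"] by simp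
      then have "(exp (c * real k) * P) powr s \<le> r + 1"
        using r by simp
      then have "((exp (c * real k) * P) powr s) powr (1 / s) \<le> (r + 1) powr (1 / s)"
        using s by (intro powr_mono2) auto
      then have "exp (c * real k) * P \<le> (r + 1) powr (1 / s)"
        using s P by (simp add: powr_powr)
      then show ?thesis unfolding P_def[symmetric] by (simp add: exp_minus field_simps)
    qed
    then show ?case using r by (intro exI[of _ "(r + 1) powr (1 / s)"]) auto
  qed
  with c show ?thesis by (rule that)
qed

lemma AE_potential_drift:
  assumes rho: "\<And>x i. x \<in> space M \<Longrightarrow> rho (\<omega> x) i = R i x"
  shows "AE x in M. potential_drift (\<omega> x)"
proof -
  obtain c where c: "0 < c" "AE x in M. \<exists>C>0. \<forall>k. (\<Prod>i\<in>{1..int k}. R i x) \<le> C * exp (- c * real k)"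
    using AE_prod_exp_decay[of "\<lambda>k. {1..int k}"] by auto
  obtain d where d: "0 < d" "AE x in M. \<exists>C>0. \<forall>k. (\<Prod>i\<in>{- int k + 1..0}. R i x) \<le> C * exp (- d * real k)"
    using AE_prod_exp_decay[of "\<lambda>k. {- int k + 1..0}"] by auto
  show ?thesis
    using c(2) d(2) AE_space
  proof eventually_elim
    case (elim x)
    obtain C D where C: "0 < C" "\<And>k. (\<Prod>i\<in>{1..int k}. R i x) \<le> C * exp (- c * real k)"
      and D: "0 < D" "\<And>k. (\<Prod>i\<in>{- int k + 1..0}. R i x) \<le> D * exp (- d * real k)"
      using elim(1,2) by blast
    have R: "0 < R i x" for i using pos elim by auto
    have 1: "exp (potential (\<omega> x) (int k)) = (\<Prod>i\<in>{1..int k}. R i x)" for k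
      using R by (simp add: potential_def rho[OF elim(3)] exp_sum)
    have 2: "exp (potential (\<omega> x) (- int k)) * (\<Prod>i\<in>{- int k + 1..0}. R i x) = 1" for k
    proof -
      have "exp (potential (\<omega> x) (- int k)) = exp (- (\<Sum>i\<in>{- int k + 1..0}. ln (R i x)))"
        by (simp add: potential_def rho[OF elim(3)])
      also have "\<dots> = inverse (\<Prod>i\<in>{- int k + 1..0}. R i x)"
        using R by (simp add: exp_minus exp_sum)
      finally show ?thesis using R by (simp add: prod_pos less_imp_neq[symmetric])
    qed
    define a where "a = min c d"
    define A where "A = max C D"
    have a: "0 < a" "0 < A" using c d C by (auto simp: a_def A_def)
    have up: "exp (potential (\<omega> x) (int k)) \<le> A * exp (- a * real k)" for k
    proof -
      have "C * exp (- c * real k) \<le> A * exp (- a * real k)"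
        using C by (intro mult_mono) (auto simp: a_def A_def mult_right_mono)
      then show ?thesis using C(2)[of k] 1 by simp
    qed
    have down: "exp (a * real k) \<le> A * exp (potential (\<omega> x) (- int k))" for k
    proof -
      have "D * exp (- d * real k) \<le> A * exp (- a * real k)"
        using D by (intro mult_mono) (auto simp: a_def A_def mult_right_mono)
      then have "(\<Prod>i\<in>{- int k + 1..0}. R i x) \<le> A * exp (- a * real k)" using D(2)[of k] by simp
      then have "exp (potential (\<omega> x) (- int k)) * (\<Prod>i\<in>{- int k + 1..0}. R i x)
          \<le> exp (potential (\<omega> x) (- int k)) * (A * exp (- a * real k))"
        by (rule mult_left_mono) simp
      then have "1 \<le> exp (potential (\<omega> x) (- int k)) * (A * exp (- a * real k))" unfolding 2 .
      then show ?thesis by (simp add: exp_minus field_simps)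
    qed
    show ?case unfolding potential_drift_def using a up down by blast
  qed
qed

lemma AE_ellipticity_bound:
  assumes rho: "\<And>x i. x \<in> space M \<Longrightarrow> rho (\<omega> x) i = R i x"
    and neg: "0 < \<epsilon>" "integrable M (\<lambda>x. R 0 x powr (- \<epsilon>))" and "1 < \<eta>"
  shows "AE x in M. ellipticity_bound (\<omega> x) \<eta>"
proof -
  define \<delta> where "\<delta> = min \<epsilon> 1"
  have \<delta>: "0 < \<delta>" "\<delta> \<le> 1" using neg by (auto simp: \<delta>_def)
  have int: "integrable M (\<lambda>x. R 0 x powr (- \<delta>))"
  proof (rule Bochner_Integration.integrable_bound[where f = "\<lambda>x. 1 + R 0 x powr (- \<epsilon>)"])
    show "AE x in M. norm (R 0 x powr (- \<delta>)) \<le> norm (1 + R 0 x powr (- \<epsilon>))"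
    proof (rule AE_I2)
      fix x assume x: "x \<in> space M"
      show "norm (R 0 x powr (- \<delta>)) \<le> norm (1 + R 0 x powr (- \<epsilon>))"
      proof (cases "R 0 x \<le> 1")
        case False
        then have "R 0 x powr (- \<delta>) \<le> R 0 x powr 0" using \<delta> by (intro powr_mono) auto
        then show ?thesis using pos[OF x, of 0] by (simp add: add_increasing2)
      next
        case True
        then have "R 0 x powr (- \<delta>) \<le> R 0 x powr (- \<epsilon>)"
          using pos[OF x, of 0] by (intro powr_mono') (auto simp: \<delta>_def)
        then show ?thesis by simp
      qed
    qed
  qed (use neg in auto)
  define A where "A = expectation (\<lambda>x. (2 / \<delta>) * (1 + R 0 x powr (- \<delta>)))"
  have A: "(\<integral>\<^sup>+x. ennreal (ln (1 + 1 / R i x)) \<partial>M) \<le> ennreal A" for i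
  proof -
    have "(\<integral>\<^sup>+x. ennreal (ln (1 + 1 / R i x)) \<partial>M) = (\<integral>\<^sup>+x. ennreal (ln (1 + 1 / R 0 x)) \<partial>M)"
      by (rule nn_integral_R[where g = "\<lambda>y. ennreal (ln (1 + 1 / y))"]) measurable
    also have "\<dots> \<le> (\<integral>\<^sup>+x. ennreal ((2 / \<delta>) * (1 + R 0 x powr (- \<delta>))) \<partial>M)"
      using pos \<delta> by (intro nn_integral_mono ennreal_leI ln_one_plus_inverse_le) auto
    also have "\<dots> = ennreal A"
      unfolding A_def using int \<delta> by (intro nn_integral_eq_integral) auto
    finally show ?thesis .
  qed
  have "AE x in M. \<exists>C>0. \<forall>N. (\<Sum>i\<in>{- int N..int N}. ennreal (ln (1 + 1 / R i x))) \<le> ennreal (C * (1 + real N) powr \<eta>)"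
    by (rule AE_polynomial_bound[OF _ A \<open>1 < \<eta>\<close>]) measurable
  then show ?thesis
    using AE_space
  proof eventually_elim
    case (elim x)
    then obtain C where C: "0 < C" "\<And>N. (\<Sum>i\<in>{- int N..int N}. ennreal (ln (1 + 1 / R i x))) \<le> ennreal (C * (1 + real N) powr \<eta>)"
      by blast
    have "(\<Sum>i\<in>{- int N..int N}. ln (1 + 1 / R i x)) \<le> C * (1 + real N) powr \<eta>" for N
    proof -
      have "0 \<le> ln (1 + 1 / R i x)" for i using pos[OF elim(2), of i] by (intro ln_ge_zero) simp
      then have "(\<Sum>i\<in>{- int N..int N}. ennreal (ln (1 + 1 / R i x))) = ennreal (\<Sum>i\<in>{- int N..int N}. ln (1 + 1 / R i x))"
        by (intro sum_ennreal) auto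
      then show ?thesis using C(2)[of N] C(1) by (simp add: ennreal_le_iff)
    qed
    then show ?case unfolding ellipticity_bound_def rho[OF elim(2)] using C(1) by blast
  qed
qed

end

section \<open>The perpetuity\<close>

lemma resolvent_boundI:
  fixes w :: "nat \<Rightarrow> int \<Rightarrow> real"
  assumes e: "\<And>i. 0 < rho e i" and \<delta>: "0 < \<delta>" "\<delta> \<le> 1" and "0 < s" "1 < \<eta>" "0 < C"
    and w: "\<And>l i. w l i = (1 + rho e (i - int l)) * (\<Prod>k\<in>{i - int l<..i}. (1 + \<delta>) * rho e k)"
    and Z: "\<And>N. (\<Sum>i\<in>{- int N..int N}. \<Sum>l. ennreal ((w l i * (1 + \<delta>) ^ l) powr s))
        \<le> ennreal (C * (1 + real N) powr \<eta>)"
    and pq: "\<eta> / s \<le> p" "\<eta> / s \<le> q" "\<eta> \<le> q"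
  shows "resolvent_bound e p q"
proof -
  define z where "z i = enn2real (\<Sum>l. ennreal ((w l i * (1 + \<delta>) ^ l) powr s))" for i
  have w_pos: "0 < w l i" for l i
    unfolding w using e \<delta> by (intro mult_pos_pos prod_pos) (auto intro: add_pos_pos)
  have z: "(\<Sum>l. ennreal ((w l i * (1 + \<delta>) ^ l) powr s)) = ennreal (z i)" for i
  proof -
    have "(\<Sum>l. ennreal ((w l i * (1 + \<delta>) ^ l) powr s)) \<le>
        (\<Sum>i\<in>{- int (nat \<bar>i\<bar>)..int (nat \<bar>i\<bar>)}. \<Sum>l. ennreal ((w l i * (1 + \<delta>) ^ l) powr s))"
      by (rule member_le_sum) auto
    also have "\<dots> < \<infinity>" using Z[of "nat \<bar>i\<bar>"] by (auto simp: le_less_trans)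
    finally show ?thesis unfolding z_def by simp
  qed
  have z_nonneg: "0 \<le> z i" for i by (simp add: z_def)
  have z_sum: "(\<Sum>i\<in>{- int N..int N}. z i) \<le> C * (1 + real N) powr \<eta>" for N
    using Z[of N] z_nonneg \<open>0 < C\<close> unfolding z by (simp add: sum_ennreal)
  have z_le: "z i \<le> C * (1 + \<bar>real_of_int i\<bar>) powr \<eta>" for i
  proof -
    have "z i \<le> (\<Sum>i\<in>{- int (nat \<bar>i\<bar>)..int (nat \<bar>i\<bar>)}. z i)"
      using z_nonneg by (intro member_le_sum) auto
    also have "\<dots> \<le> C * (1 + \<bar>real_of_int i\<bar>) powr \<eta>" using z_sum[of "nat \<bar>i\<bar>"] by simp
    finally show ?thesis .
  qed
  define g where "g = 1 / (1 + \<delta>)"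
  define K where "K = 1 / (1 - g)"
  have g: "0 < g" "g < 1" using \<delta> by (auto simp: g_def)
  have K: "0 < K" using g by (simp add: K_def)
  have w_le: "w l i \<le> z i powr (1 / s) * g ^ l" for l i
  proof -
    have "ennreal ((w l i * (1 + \<delta>) ^ l) powr s) \<le> ennreal (z i)"
    proof -
      define f where "f k = ennreal ((w k i * (1 + \<delta>) ^ k) powr s)" for k
      have "f l \<le> (\<Sum>k. f k)" using sum_le_suminf[of f "{l}"] by simp
      then show ?thesis unfolding f_def z .
    qed
    then have "(w l i * (1 + \<delta>) ^ l) powr s \<le> z i" using z_nonneg by simp
    then have "((w l i * (1 + \<delta>) ^ l) powr s) powr (1 / s) \<le> z i powr (1 / s)"
      using \<open>0 < s\<close> by (intro powr_mono2) auto
    moreover have "0 < w l i * (1 + \<delta>) ^ l" using w_pos[of l i] \<delta> by simp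
    ultimately have "w l i * (1 + \<delta>) ^ l \<le> z i powr (1 / s)"
      using \<open>0 < s\<close> by (simp add: powr_powr)
    then show ?thesis using \<delta> by (simp add: g_def power_one_over field_simps)
  qed
  have sum_geo: "summable (\<lambda>l. z i powr (1 / s) * g ^ l)" for i
    using g by (intro summable_mult summable_geometric) auto
  have summable: "summable (\<lambda>l. w l i)" for i
    using w_le w_pos by (intro summable_comparison_test'[OF sum_geo, of 0]) (auto simp: abs_of_pos)
  define W where "W i = (\<Sum>l. w l i)" for i
  have W_le: "W i \<le> K * z i powr (1 / s)" for i
  proof -
    have "W i \<le> (\<Sum>l. z i powr (1 / s) * g ^ l)"
      unfolding W_def by (intro suminf_le w_le summable sum_geo)
    also have "\<dots> = z i powr (1 / s) * K"
      using g by (subst suminf_mult) (auto simp: suminf_geometric summable_geometric K_def)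
    finally show ?thesis by (simp add: mult.commute)
  qed
  have W_nonneg: "0 \<le> W i" for i
    unfolding W_def using w_pos by (intro suminf_nonneg summable) (auto intro: less_imp_le)
  have W_rec: "W i = 1 + rho e i + (1 + \<delta>) * rho e i * W (i - 1)" for i
  proof -
    have "w (Suc l) i = (1 + \<delta>) * rho e i * w l (i - 1)" for l
    proof -
      have "{i - int (Suc l)<..i} = insert i {i - 1 - int l<..i - 1}" by auto
      then show ?thesis unfolding w by (simp add: algebra_simps)
    qed
    then have "(\<Sum>l. w (Suc l) i) = (1 + \<delta>) * rho e i * W (i - 1)"
      unfolding W_def by (simp add: suminf_mult[OF summable])
    moreover have "W i = w 0 i + (\<Sum>l. w (Suc l) i)"
      unfolding W_def using suminf_split_head[OF summable[of i]] by simp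
    moreover have "w 0 i = 1 + rho e i" by (simp add: w)
    ultimately show ?thesis by simp
  qed
  define D where "D = K * max (C powr (1 / s)) (1 + C)"
  have D: "K * C powr (1 / s) \<le> D" "K * (1 + C) \<le> D"
    using K by (auto simp: D_def intro!: mult_left_mono)
  have "0 < D" using K \<open>0 < C\<close> by (simp add: D_def)
  have "W i \<le> D * (1 + \<bar>real_of_int i\<bar>) powr p" for i
  proof -
    have "z i powr (1 / s) \<le> (C * (1 + \<bar>real_of_int i\<bar>) powr \<eta>) powr (1 / s)"
      using z_le z_nonneg \<open>0 < s\<close> by (intro powr_mono2) auto
    also have "\<dots> = C powr (1 / s) * (1 + \<bar>real_of_int i\<bar>) powr (\<eta> / s)"
      using \<open>0 < C\<close> by (simp add: powr_mult powr_powr)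
    finally have "K * z i powr (1 / s) \<le> K * (C powr (1 / s) * (1 + \<bar>real_of_int i\<bar>) powr (\<eta> / s))"
      using K by (intro mult_left_mono) auto
    also have "\<dots> \<le> D * (1 + \<bar>real_of_int i\<bar>) powr p"
      unfolding mult.assoc[symmetric] using D pq \<open>0 < D\<close> by (intro mult_mono powr_mono) auto
    finally show ?thesis using W_le[of i] by simp
  qed
  moreover have "(\<Sum>i\<in>{0..<m}. W i) \<le> D * (1 + real_of_int m) powr q" if "0 \<le> m" for m
  proof -
    define B where "B = C * (1 + real_of_int m) powr \<eta>"
    have B: "0 < B" using \<open>0 < C\<close> that by (simp add: B_def)
    have "(\<Sum>i\<in>{0..<m}. z i) \<le> (\<Sum>i\<in>{- int (nat m)..int (nat m)}. z i)"
      using that z_nonneg by (intro sum_mono2) auto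
    then have zB: "(\<Sum>i\<in>{0..<m}. z i) \<le> B" using z_sum[of "nat m"] that by (simp add: B_def)
    have "(\<Sum>i\<in>{0..<m}. z i powr (1 / s)) \<le> max (C powr (1 / s)) (1 + C) * (1 + real_of_int m) powr q"
    proof (cases "s \<le> 1")
      case True
      have "z i powr (1 / s) \<le> z i * B powr (1 / s - 1)" if i: "i \<in> {0..<m}" for i
      proof (cases "z i = 0")
        case False
        then have "0 < z i" using z_nonneg[of i] by simp
        have "z i \<le> (\<Sum>i\<in>{0..<m}. z i)" using i z_nonneg by (intro member_le_sum) auto
        then have "z i powr (1 / s - 1) \<le> B powr (1 / s - 1)"
          using zB z_nonneg True \<open>0 < s\<close> by (intro powr_mono2) auto
        then have "z i * z i powr (1 / s - 1) \<le> z i * B powr (1 / s - 1)"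
          using z_nonneg by (intro mult_left_mono) auto
        moreover have "z i * z i powr (1 / s - 1) = z i powr (1 / s)"
          using \<open>0 < z i\<close> by (simp add: powr_diff)
        ultimately show ?thesis by simp
      qed (use \<open>0 < s\<close> in simp)
      then have "(\<Sum>i\<in>{0..<m}. z i powr (1 / s)) \<le> (\<Sum>i\<in>{0..<m}. z i * B powr (1 / s - 1))"
        by (rule sum_mono)
      also have "\<dots> = (\<Sum>i\<in>{0..<m}. z i) * B powr (1 / s - 1)" by (simp add: sum_distrib_right)
      also have "\<dots> \<le> B * B powr (1 / s - 1)" using zB by (intro mult_right_mono) auto
      also have "\<dots> = B powr (1 / s)" using B by (simp add: powr_diff)
      also have "\<dots> = C powr (1 / s) * (1 + real_of_int m) powr (\<eta> / s)"
        using that \<open>0 < C\<close> by (simp add: B_def powr_mult powr_powr)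
      also have "\<dots> \<le> max (C powr (1 / s)) (1 + C) * (1 + real_of_int m) powr q"
        using that pq by (intro mult_mono powr_mono) (auto simp: le_max_iff_disj)
      finally show ?thesis .
    next
      case False
      have "z i powr (1 / s) \<le> 1 + z i" for i
      proof (cases "z i \<le> 1")
        case True
        then have "z i powr (1 / s) \<le> 1" using z_nonneg[of i] \<open>0 < s\<close> by (intro powr_le1) auto
        then show ?thesis using z_nonneg[of i] by simp
      next
        case big: False
        then have "z i powr (1 / s) \<le> z i powr 1" using False by (intro powr_mono) auto
        then show ?thesis using big by simp
      qed
      then have "(\<Sum>i\<in>{0..<m}. z i powr (1 / s)) \<le> (\<Sum>i\<in>{0..<m}. 1 + z i)"
        by (rule sum_mono)
      also have "\<dots> \<le> real_of_int m + B" using zB that by (simp add: sum.distrib)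
      also have "\<dots> \<le> (1 + C) * (1 + real_of_int m) powr \<eta>"
      proof -
        have "(1 + real_of_int m) powr 1 \<le> (1 + real_of_int m) powr \<eta>"
          using that \<open>1 < \<eta>\<close> by (intro powr_mono) auto
        then show ?thesis using that by (simp add: B_def algebra_simps)
      qed
      also have "\<dots> \<le> max (C powr (1 / s)) (1 + C) * (1 + real_of_int m) powr q"
        using that pq \<open>0 < C\<close> by (intro mult_mono powr_mono) (auto simp: le_max_iff_disj)
      finally show ?thesis .
    qed
    then have "K * (\<Sum>i\<in>{0..<m}. z i powr (1 / s)) \<le> D * (1 + real_of_int m) powr q"
      unfolding D_def mult.assoc using K by (intro mult_left_mono) auto
    moreover have "(\<Sum>i\<in>{0..<m}. W i) \<le> K * (\<Sum>i\<in>{0..<m}. z i powr (1 / s))"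
      unfolding sum_distrib_left by (intro sum_mono W_le)
    ultimately show ?thesis by linarith
  qed
  ultimately show ?thesis
    unfolding resolvent_bound_def using \<delta> W_nonneg W_rec by blast
qed

context iid_ratios
begin

lemma AE_resolvent_bound:
  assumes rho: "\<And>x i. x \<in> space M \<Longrightarrow> rho (\<omega> x) i = R i x"
    and pq: "1 / \<kappa> < p" "1 / \<kappa> < q" "1 < q"
  shows "AE x in M. resolvent_bound (\<omega> x) p q"
proof -
  define p' where "p' = min p q"
  have p': "1 / \<kappa> < p'" "0 < p'"
    using pq kappa_pos by (auto simp: p'_def intro: less_trans[of 0 "1 / \<kappa>"])
  then have "1 / p' < \<kappa>" using kappa_pos by (simp add: field_simps)
  then obtain s where s: "1 / p' < s" "s < \<kappa>" using dense by blast
  then have s0: "0 < s" using p' by (meson less_trans zero_less_divide_1_iff)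
  have "1 < s * p'" using s p' by (simp add: field_simps)
  then obtain \<eta> where \<eta>: "1 < \<eta>" "\<eta> < min (s * p') q" using dense[of 1 "min (s * p') q"] pq by auto
  have "\<eta> / s \<le> p'" using \<eta> s0 by (simp add: field_simps)
  then have \<eta>pq: "\<eta> / s \<le> p" "\<eta> / s \<le> q" "\<eta> \<le> q"
    using \<eta> by (auto simp: p'_def)
  define m where "m = moment s"
  have m: "0 < m" "m < 1" using moment_less_1[of s] moment_pos[of s] s s0 by (auto simp: m_def)
  define \<delta> where "\<delta> = min 1 (m powr (- 1 / (4 * s)) - 1)"
  have "1 < m powr (- 1 / (4 * s))"
    using powr_less_mono2_neg[of "- 1 / (4 * s)" m 1] m s0 by simp
  then have \<delta>: "0 < \<delta>" "\<delta> \<le> 1" "1 + \<delta> \<le> m powr (- 1 / (4 * s))" by (auto simp: \<delta>_def)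
  define \<theta> where "\<theta> = ((1 + \<delta>) powr (2 * s)) * m"
  have \<theta>: "0 < \<theta>" "\<theta> < 1"
  proof -
    show "0 < \<theta>" using m \<delta> by (simp add: \<theta>_def)
    have "(1 + \<delta>) powr (2 * s) \<le> (m powr (- 1 / (4 * s))) powr (2 * s)"
      using \<delta> s0 by (intro powr_mono2) auto
    also have "\<dots> = m powr (- 1 / 2)" using s0 by (simp add: powr_powr)
    finally have "\<theta> \<le> m powr (- 1 / 2) * m powr 1" using m by (simp add: \<theta>_def)
    also have "\<dots> = m powr (1 / 2)" by (simp only: powr_add[symmetric]) simp
    also have "\<dots> < 1" using powr_less_mono2[of "1/2" m 1] m by simp
    finally show "\<theta> < 1" .
  qed
  define A where "A = 2 powr s * (1 + m)"
  have A: "(\<integral>\<^sup>+x. ennreal ((1 + R 0 x) powr s) \<partial>M) \<le> ennreal A"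
  proof -
    have "(\<integral>\<^sup>+x. ennreal ((1 + R 0 x) powr s) \<partial>M) \<le> (\<integral>\<^sup>+x. ennreal (2 powr s * (1 + R 0 x powr s)) \<partial>M)"
    proof (intro nn_integral_mono ennreal_leI)
      fix x assume "x \<in> space M"
      then have y: "0 < R 0 x" by (rule pos)
      have "(1 + R 0 x) powr s \<le> (2 * max 1 (R 0 x)) powr s" using s0 y by (intro powr_mono2) auto
      also have "\<dots> = 2 powr s * max 1 (R 0 x) powr s" by (simp add: powr_mult)
      also have "\<dots> \<le> 2 powr s * (1 + R 0 x powr s)"
        by (intro mult_left_mono) (auto simp: max_def)
      finally show "(1 + R 0 x) powr s \<le> 2 powr s * (1 + R 0 x powr s)" .
    qed
    also have "\<dots> = ennreal (expectation (\<lambda>x. 2 powr s * (1 + R 0 x powr s)))"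
      using s s0 integrable_moment[of s] by (intro nn_integral_eq_integral) auto
    also have "expectation (\<lambda>x. 2 powr s * (1 + R 0 x powr s)) = A"
      using s s0 integrable_moment[of s] by (simp add: A_def m_def moment_def prob_space)
    finally show ?thesis .
  qed
  define w where "w x l i = (1 + R (i - int l) x) * (\<Prod>k\<in>{i - int l<..i}. (1 + \<delta>) * R k x)" for x l i
  have w_meas [measurable]: "(\<lambda>x. w x l i) \<in> borel_measurable M" for l i
    unfolding w_def by measurable
  have term_le: "(\<integral>\<^sup>+x. ennreal ((w x l i * (1 + \<delta>) ^ l) powr s) \<partial>M) \<le> ennreal (A * \<theta> ^ l)" for l i
  proof -
    define g where "g j y = (if j = i - int l then ennreal ((1 + y) powr s) else ennreal ((1 + \<delta>) powr (2 * s) * y powr s))" for j and y :: real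
    have [measurable]: "g j \<in> borel_measurable borel" for j unfolding g_def by measurable
    have I: "{i - int l..i} = insert (i - int l) {i - int l<..i}" by auto
    have "(\<integral>\<^sup>+x. ennreal ((w x l i * (1 + \<delta>) ^ l) powr s) \<partial>M) = (\<integral>\<^sup>+x. (\<Prod>j\<in>{i - int l..i}. g j (R j x)) \<partial>M)"
    proof (rule nn_integral_cong)
      fix x assume x: "x \<in> space M"
      have R: "0 < R j x" for j by (rule pos[OF x])
      have "w x l i * (1 + \<delta>) ^ l = (1 + R (i - int l) x) * (\<Prod>k\<in>{i - int l<..i}. (1 + \<delta>)\<^sup>2 * R k x)"
        by (simp add: w_def prod.distrib power2_eq_square power_mult_distrib)
      also have "\<dots> powr s = (1 + R (i - int l) x) powr s * (\<Prod>k\<in>{i - int l<..i}. ((1 + \<delta>)\<^sup>2 * R k x) powr s)"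
        using R \<delta> by (simp add: powr_mult prod_powr_distrib prod_nonneg less_imp_le)
      also have "(\<Prod>k\<in>{i - int l<..i}. ((1 + \<delta>)\<^sup>2 * R k x) powr s) = (\<Prod>k\<in>{i - int l<..i}. (1 + \<delta>) powr (2 * s) * R k x powr s)"
        using R \<delta> by (intro prod.cong) (auto simp: powr_mult powr_powr[symmetric])
      finally have "ennreal ((w x l i * (1 + \<delta>) ^ l) powr s) = ennreal ((1 + R (i - int l) x) powr s) * (\<Prod>k\<in>{i - int l<..i}. ennreal ((1 + \<delta>) powr (2 * s) * R k x powr s))"
        by (subst prod_ennreal) (auto simp: ennreal_mult prod_nonneg)
      also have "\<dots> = (\<Prod>j\<in>{i - int l..i}. g j (R j x))"
        unfolding I by (subst prod.insert) (auto simp: g_def intro!: arg_cong2[where f = "(*)"] prod.cong)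
      finally show "ennreal ((w x l i * (1 + \<delta>) ^ l) powr s) = (\<Prod>j\<in>{i - int l..i}. g j (R j x))" .
    qed
    also have "\<dots> = (\<Prod>j\<in>{i - int l..i}. \<integral>\<^sup>+x. g j (R 0 x) \<partial>M)"
      by (rule nn_integral_prod_R) auto
    also have "\<dots> = (\<integral>\<^sup>+x. ennreal ((1 + R 0 x) powr s) \<partial>M) * (\<Prod>j\<in>{i - int l<..i}. \<integral>\<^sup>+x. ennreal ((1 + \<delta>) powr (2 * s) * R 0 x powr s) \<partial>M)"
      unfolding I by (subst prod.insert) (auto simp: g_def intro!: arg_cong2[where f = "(*)"] prod.cong)
    also have "(\<integral>\<^sup>+x. ennreal ((1 + \<delta>) powr (2 * s) * R 0 x powr s) \<partial>M) = ennreal \<theta>"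
      using s s0 m by (simp add: ennreal_mult nn_integral_cmult nn_integral_moment m_def \<theta>_def)
    also have "(\<integral>\<^sup>+x. ennreal ((1 + R 0 x) powr s) \<partial>M) * (\<Prod>j\<in>{i - int l<..i}. ennreal \<theta>) \<le> ennreal A * ennreal (\<theta> ^ l)"
      using A \<theta> by (intro mult_mono) (auto simp: ennreal_power)
    also have "\<dots> = ennreal (A * \<theta> ^ l)" using m \<theta> by (simp add: A_def ennreal_mult)
    finally show ?thesis .
  qed
  define Z where "Z i x = (\<Sum>l. ennreal ((w x l i * (1 + \<delta>) ^ l) powr s))" for i x
  have Z_le: "(\<integral>\<^sup>+x. Z i x \<partial>M) \<le> ennreal (\<Sum>l. A * \<theta> ^ l)" for i
  proof -
    have "(\<integral>\<^sup>+x. Z i x \<partial>M) = (\<Sum>l. \<integral>\<^sup>+x. ennreal ((w x l i * (1 + \<delta>) ^ l) powr s) \<partial>M)"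
      unfolding Z_def by (intro nn_integral_suminf) measurable
    also have "\<dots> \<le> (\<Sum>l. ennreal (A * \<theta> ^ l))"
      by (intro suminf_le term_le summableI)
    also have "\<dots> = ennreal (\<Sum>l. A * \<theta> ^ l)"
      using \<theta> m by (intro suminf_ennreal_eq summable_sums summable_mult summable_geometric) (auto simp: A_def)
    finally show ?thesis .
  qed
  have "AE x in M. \<exists>C>0. \<forall>N. (\<Sum>i\<in>{- int N..int N}. Z i x) \<le> ennreal (C * (1 + real N) powr \<eta>)"
    by (rule AE_polynomial_bound[OF _ Z_le \<eta>(1)]) (unfold Z_def, measurable)
  then show ?thesis
    using AE_space
  proof eventually_elim
    case (elim x)
    then obtain C where "0 < C" "\<And>N. (\<Sum>i\<in>{- int N..int N}. Z i x) \<le> ennreal (C * (1 + real N) powr \<eta>)" by blast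
    then show ?case
      using pos[OF elim(2)] unfolding Z_def
      by (intro resolvent_boundI[OF _ \<delta>(1,2) s0 \<eta>(1), where w = "w x" and C = C] \<eta>pq)
        (auto simp: rho[OF elim(2)] w_def)
  qed
qed

end

section \<open>Deep traps\<close>

lemma exp_quadratic_bound:
  fixes v :: real
  shows "\<bar>exp v - 1 - v\<bar> \<le> v\<^sup>2 / 2 * exp \<bar>v\<bar>"
proof -
  obtain t where t: "\<bar>t\<bar> \<le> \<bar>v\<bar>" "exp v = (\<Sum>m<2. v ^ m / fact m) + exp t / fact 2 * v ^ 2"
    using Maclaurin_exp_le[of v 2] by blast
  have "exp v - 1 - v = exp t * (v\<^sup>2 / 2)"
    using t(2) by (simp add: numeral_2_eq_2)
  moreover have "exp t * (v\<^sup>2 / 2) \<le> exp \<bar>v\<bar> * (v\<^sup>2 / 2)"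
    using t(1) by (intro mult_right_mono) auto
  moreover have "0 \<le> exp t * (v\<^sup>2 / 2)" by simp
  ultimately show ?thesis by (simp only: abs_of_nonneg mult.commute)
qed

lemma square_le_exp:
  fixes u r :: real
  assumes "0 < r"
  shows "u\<^sup>2 \<le> 2 / r\<^sup>2 * exp (r * \<bar>u\<bar>)"
proof -
  have "0 \<le> r * \<bar>u\<bar>" using assms by simp
  then have "(r * \<bar>u\<bar>)\<^sup>2 / 2 \<le> exp (r * \<bar>u\<bar>)"
    using exp_lower_Taylor_quadratic[of "r * \<bar>u\<bar>"] by linarith
  then show ?thesis using assms by (simp add: power_mult_distrib field_simps)
qed

lemma exp_abs_le: "exp \<bar>u :: real\<bar> \<le> exp u + exp (- u)"
  by (cases "0 \<le> u") auto

lemma exp_increment_bound: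
  fixes u h r :: real
  assumes "0 < r" "\<bar>h\<bar> \<le> r"
  shows "\<bar>exp (h * u) - 1 - h * u\<bar> \<le> h\<^sup>2 / r\<^sup>2 * (exp (2 * r * u) + exp (- (2 * r * u)))"
proof -
  have "\<bar>exp (h * u) - 1 - h * u\<bar> \<le> h\<^sup>2 / 2 * (u\<^sup>2 * exp \<bar>h * u\<bar>)"
    using exp_quadratic_bound[of "h * u"] by (simp add: power_mult_distrib)
  also have "\<dots> \<le> h\<^sup>2 / 2 * (2 / r\<^sup>2 * exp (r * \<bar>u\<bar>) * exp (r * \<bar>u\<bar>))"
    using assms square_le_exp[of r u]
    by (intro mult_left_mono mult_mono) (auto simp: abs_mult intro: mult_right_mono)
  also have "\<dots> = h\<^sup>2 / r\<^sup>2 * exp \<bar>2 * r * u\<bar>"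
    using assms by (simp add: abs_mult exp_add[symmetric])
  also have "\<dots> \<le> h\<^sup>2 / r\<^sup>2 * (exp (2 * r * u) + exp (- (2 * r * u)))"
    by (intro mult_left_mono exp_abs_le) auto
  finally show ?thesis .
qed

lemma potential_diff: "potential e (i + int l) - potential e i = (\<Sum>k\<in>{i + 1..i + int l}. ln (rho e k))"
proof (induction l)
  case (Suc l)
  have "{i + 1..i + int (Suc l)} = insert (i + int (Suc l)) {i + 1..i + int l}" by auto
  then show ?case using Suc potential_step[of e "i + int (Suc l)"] by simp
qed simp

context iid_ratios
begin

definition dmoment :: "real \<Rightarrow> real" where
  "dmoment s = expectation (\<lambda>x. R 0 x powr s * ln (R 0 x))"

lemma integrable_dmoment:
  assumes "0 < s" "s < \<kappa>"
  shows "integrable M (\<lambda>x. R 0 x powr s * ln (R 0 x))"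
proof -
  define r where "r = min s (\<kappa> - s)"
  have r: "0 < r" "r \<le> s" "s + r \<le> \<kappa>" using assms by (auto simp: r_def)
  show ?thesis
  proof (rule Bochner_Integration.integrable_bound[where f = "\<lambda>x. (1 / r) * (R 0 x powr (s + r) + R 0 x powr (s - r))"])
    show "integrable M (\<lambda>x. (1 / r) * (R 0 x powr (s + r) + R 0 x powr (s - r)))"
      using r integrable_moment[of "s + r"] integrable_moment[of "s - r"] assms by auto
    show "AE x in M. norm (R 0 x powr s * ln (R 0 x)) \<le> norm ((1 / r) * (R 0 x powr (s + r) + R 0 x powr (s - r)))"
    proof (rule AE_I2)
      fix x assume x: "x \<in> space M"
      define u where "u = ln (R 0 x)"
      have pw: "R 0 x powr t = exp (t * u)" for t using pos[OF x, of 0] by (simp add: powr_def u_def)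
      have "r * \<bar>u\<bar> \<le> exp (r * \<bar>u\<bar>)" using exp_ge_add_one_self[of "r * \<bar>u\<bar>"] by linarith
      also have "\<dots> = exp \<bar>r * u\<bar>" using r by (simp add: abs_mult)
      also have "\<dots> \<le> exp (r * u) + exp (- (r * u))" by (rule exp_abs_le)
      finally have "\<bar>u\<bar> \<le> (1 / r) * (exp (r * u) + exp (- (r * u)))" using r by (simp add: field_simps)
      then have "exp (s * u) * \<bar>u\<bar> \<le> exp (s * u) * ((1 / r) * (exp (r * u) + exp (- (r * u))))"
        by (intro mult_left_mono) auto
      also have "\<dots> = (1 / r) * (exp ((s + r) * u) + exp ((s - r) * u))"
        by (simp add: exp_add[symmetric] algebra_simps)
      finally show "norm (R 0 x powr s * ln (R 0 x)) \<le> norm ((1 / r) * (R 0 x powr (s + r) + R 0 x powr (s - r)))"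
        using r unfolding pw u_def[symmetric] by (simp add: abs_mult)
    qed
  qed auto
qed

lemma DERIV_moment:
  assumes "0 < s" "s < \<kappa>"
  shows "DERIV moment s :> dmoment s"
proof -
  define r where "r = min s (\<kappa> - s) / 2"
  have r: "0 < r" "2 * r \<le> s" "s + 2 * r \<le> \<kappa>" using assms by (auto simp: r_def)
  define K where "K = (moment (s + 2 * r) + moment (s - 2 * r)) / r\<^sup>2"
  have bound: "\<bar>moment (s + h) - moment s - h * dmoment s\<bar> \<le> K * h\<^sup>2" if h: "\<bar>h\<bar> \<le> r" for h
  proof -
    have int: "integrable M (\<lambda>x. R 0 x powr (s + h))" "integrable M (\<lambda>x. R 0 x powr s)"
      "integrable M (\<lambda>x. R 0 x powr s * ln (R 0 x))"
      "integrable M (\<lambda>x. R 0 x powr (s + 2 * r))" "integrable M (\<lambda>x. R 0 x powr (s - 2 * r))"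
      using r h assms by (auto intro!: integrable_moment integrable_dmoment)
    define f where "f x = R 0 x powr (s + h) - R 0 x powr s - h * (R 0 x powr s * ln (R 0 x))" for x
    have eq: "moment (s + h) - moment s - h * dmoment s = expectation f"
      unfolding moment_def dmoment_def f_def using int by simp
    have "\<bar>expectation f\<bar> \<le> expectation (\<lambda>x. \<bar>f x\<bar>)"
      using integral_norm_bound[of M f] by simp
    also have "\<dots> \<le> expectation (\<lambda>x. h\<^sup>2 / r\<^sup>2 * (R 0 x powr (s + 2 * r) + R 0 x powr (s - 2 * r)))"
    proof (rule integral_mono)
      fix x assume x: "x \<in> space M"
      define u where "u = ln (R 0 x)"
      have pw: "R 0 x powr t = exp (t * u)" for t using pos[OF x, of 0] by (simp add: powr_def u_def)
      have fx: "f x = exp (s * u) * (exp (h * u) - 1 - h * u)"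
        unfolding f_def pw u_def[symmetric] by (simp add: exp_add[symmetric] algebra_simps)
      have "\<bar>f x\<bar> \<le> exp (s * u) * (h\<^sup>2 / r\<^sup>2 * (exp (2 * r * u) + exp (- (2 * r * u))))"
        unfolding fx abs_mult abs_exp_cancel using r h by (intro mult_left_mono exp_increment_bound) auto
      also have "\<dots> = h\<^sup>2 / r\<^sup>2 * (R 0 x powr (s + 2 * r) + R 0 x powr (s - 2 * r))"
      proof -
        have eqs: "exp (s * u) * exp (2 * r * u) = R 0 x powr (s + 2 * r)"
          "exp (s * u) * exp (- (2 * r * u)) = R 0 x powr (s - 2 * r)"
          unfolding pw by (simp_all add: exp_add[symmetric] algebra_simps)
        show ?thesis unfolding eqs[symmetric] by (simp only: distrib_left mult_ac)
      qed
      finally show "\<bar>f x\<bar> \<le> h\<^sup>2 / r\<^sup>2 * (R 0 x powr (s + 2 * r) + R 0 x powr (s - 2 * r))" .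
    qed (use int in \<open>auto simp: f_def\<close>)
    also have "\<dots> = K * h\<^sup>2"
      using int by (simp add: K_def moment_def)
    finally show ?thesis unfolding eq .
  qed
  have "((\<lambda>h. (moment (s + h) - moment s) / h - dmoment s) \<longlongrightarrow> 0) (at 0)"
  proof (rule Lim_null_comparison)
    have "\<forall>\<^sub>F h in at 0. \<bar>h :: real\<bar> < r"
      using r by (auto simp: eventually_at intro!: exI[of _ r])
    then show "\<forall>\<^sub>F h in at 0. norm ((moment (s + h) - moment s) / h - dmoment s) \<le> K * \<bar>h\<bar>"
      using eventually_neq_at_within[of 0 0 UNIV]
    proof eventually_elim
      case (elim h)
      have eq: "(moment (s + h) - moment s) / h - dmoment s = (moment (s + h) - moment s - h * dmoment s) / h"
        using elim by (simp add: field_simps)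
      have "\<bar>(moment (s + h) - moment s) / h - dmoment s\<bar> \<le> K * h\<^sup>2 / \<bar>h\<bar>"
        unfolding eq abs_divide using elim bound[of h] by (intro divide_right_mono) auto
      also have "\<dots> = K * \<bar>h\<bar>" using elim by (simp add: power2_eq_square abs_if field_simps)
      finally show ?case by simp
    qed
    show "((\<lambda>h. K * \<bar>h\<bar>) \<longlongrightarrow> 0) (at 0)" by (auto intro!: tendsto_eq_intros)
  qed
  then show ?thesis unfolding DERIV_def by (subst (asm) LIM_zero_iff)
qed

lemma moment_increment_le:
  assumes "0 < t" "t < s" "s < \<kappa>"
  shows "moment s - moment t \<le> (s - t) * dmoment s"
proof -
  have int: "integrable M (\<lambda>x. R 0 x powr t)" "integrable M (\<lambda>x. R 0 x powr s)"
    "integrable M (\<lambda>x. R 0 x powr s * ln (R 0 x))"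
    using assms by (auto intro!: integrable_moment integrable_dmoment)
  have "moment s - moment t = expectation (\<lambda>x. R 0 x powr s - R 0 x powr t)"
    unfolding moment_def using int by simp
  also have "\<dots> \<le> expectation (\<lambda>x. (s - t) * (R 0 x powr s * ln (R 0 x)))"
  proof (rule integral_mono)
    fix x assume x: "x \<in> space M"
    define u where "u = ln (R 0 x)"
    have pw: "R 0 x powr t = exp (t * u)" for t using pos[OF x, of 0] by (simp add: powr_def u_def)
    have "1 + (t - s) * u \<le> exp ((t - s) * u)" by (rule exp_ge_add_one_self)
    then have "exp (s * u) * (1 + (t - s) * u) \<le> exp (s * u) * exp ((t - s) * u)"
      by (intro mult_left_mono) auto
    also have "\<dots> = exp (t * u)" by (simp add: exp_add[symmetric] algebra_simps)
    finally show "R 0 x powr s - R 0 x powr t \<le> (s - t) * (R 0 x powr s * ln (R 0 x))"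
      unfolding pw u_def[symmetric] by (simp add: algebra_simps)
  qed (use int in auto)
  also have "\<dots> = (s - t) * dmoment s" unfolding dmoment_def by simp
  finally show ?thesis .
qed

lemma moment_near_kappa:
  assumes tail: "integrable M (\<lambda>x. R 0 x powr \<kappa> * ln_plus (R 0 x))" and "0 < s" "s < \<kappa>"
  shows "1 - (\<kappa> - s) * expectation (\<lambda>x. R 0 x powr \<kappa> * ln_plus (R 0 x)) \<le> moment s"
proof -
  have int: "integrable M (\<lambda>x. R 0 x powr s)" using assms by (auto intro!: integrable_moment)
  have "expectation (\<lambda>x. R 0 x powr \<kappa> - (\<kappa> - s) * (R 0 x powr \<kappa> * ln_plus (R 0 x))) \<le> moment s"
    unfolding moment_def
  proof (rule integral_mono)
    fix x assume x: "x \<in> space M"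
    define u where "u = ln (R 0 x)"
    have pw: "R 0 x powr t = exp (t * u)" for t using pos[OF x, of 0] by (simp add: powr_def u_def)
    have "1 - (\<kappa> - s) * ln_plus (R 0 x) \<le> 1 + (s - \<kappa>) * u"
      using mult_left_mono[of u "ln_plus (R 0 x)" "\<kappa> - s"] assms by (simp add: ln_plus_def u_def algebra_simps)
    also have "\<dots> \<le> exp ((s - \<kappa>) * u)" by (rule exp_ge_add_one_self)
    finally have "exp (\<kappa> * u) * (1 - (\<kappa> - s) * ln_plus (R 0 x)) \<le> exp (\<kappa> * u) * exp ((s - \<kappa>) * u)"
      by (intro mult_left_mono) auto
    also have "\<dots> = exp (s * u)" by (simp add: exp_add[symmetric] algebra_simps)
    finally show "R 0 x powr \<kappa> - (\<kappa> - s) * (R 0 x powr \<kappa> * ln_plus (R 0 x)) \<le> R 0 x powr s"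
      unfolding pw by (simp add: algebra_simps)
  qed (use int kappa_integrable tail in auto)
  then show ?thesis using kappa_integrable tail kappa_one by simp
qed

text \<open>
  \<open>a\<close> and \<open>b\<close> are chosen slightly below and above the slope of \<open>ln \<circ> moment\<close> at a point \<open>s\<close> close
  to \<open>\<kappa>\<close>. Working at \<open>s < \<kappa>\<close> makes \<open>moment\<close> differentiable on both sides.
\<close>

lemma tilting_parameters:
  assumes tail: "integrable M (\<lambda>x. R 0 x powr \<kappa> * ln_plus (R 0 x))" and p: "0 < p" "p * \<kappa> < 1"
  obtains s h a b where "0 < s" "s < \<kappa>" "0 < h" "h < s" "s + h < \<kappa>" "0 < a" "0 < b"
    "moment (s - h) * exp (h * a) < moment s" "moment (s + h) * exp (- (h * b)) < moment s"
    "p * (s * b - ln (moment s)) < a"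
proof -
  define m0 where "m0 = moment (\<kappa> / 2)"
  have m0: "0 < m0" "m0 < 1"
    using kappa_pos moment_pos[of "\<kappa> / 2"] moment_less_1[of "\<kappa> / 2"] by (auto simp: m0_def)
  define g where "g = (1 - m0) / \<kappa>"
  have g: "0 < g" using m0 kappa_pos by (simp add: g_def)
  have pk: "0 < p * \<kappa>" using p kappa_pos by simp
  then have "0 < (1 - p * \<kappa>) / (1 + p * \<kappa>)" using p by (intro divide_pos_pos) auto
  then obtain \<epsilon> where \<epsilon>: "0 < \<epsilon>" "\<epsilon> < (1 - p * \<kappa>) / (1 + p * \<kappa>)"
    using dense by blast
  define d where "d = 1 - \<epsilon> - p * \<kappa> * (1 + \<epsilon>)"
  have d: "0 < d" using \<epsilon> pk by (simp add: d_def field_simps)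
  have "0 < p * \<kappa> * (1 + \<epsilon>)" using pk \<epsilon> by (intro mult_pos_pos[of "p * \<kappa>"]) auto
  then have "\<epsilon> < 1" using d unfolding d_def by linarith
  define H where "H = expectation (\<lambda>x. R 0 x powr \<kappa> * ln_plus (R 0 x))"
  have "0 \<le> H" unfolding H_def by (intro integral_nonneg_AE) (auto simp: ln_plus_def)
  define L where "L = max ((1 + m0) / 2) (exp (- (g * d / p)))"
  have L: "L < 1" using m0 g d p by (simp add: L_def)
  obtain s where s: "max (\<kappa> / 2) (\<kappa> - (1 - L) / (H + 1)) < s" "s < \<kappa>"
    using dense[of "max (\<kappa> / 2) (\<kappa> - (1 - L) / (H + 1))" \<kappa>] kappa_pos L \<open>0 \<le> H\<close> by (auto simp: divide_pos_pos)
  have s0: "0 < s" "\<kappa> / 2 < s" using s kappa_pos by auto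
  define m where "m = moment s"
  have m: "0 < m" "m < 1" using moment_less_1[of s] moment_pos[of s] s s0 by (auto simp: m_def)
  have "L < m"
  proof -
    have "(\<kappa> - s) * (H + 1) < 1 - L" using s \<open>0 \<le> H\<close> by (simp add: field_simps)
    moreover have "(\<kappa> - s) * H \<le> (\<kappa> - s) * (H + 1)" using s by (intro mult_left_mono) auto
    moreover have "1 - (\<kappa> - s) * H \<le> m"
      unfolding m_def H_def using moment_near_kappa[OF tail] s s0 by auto
    ultimately show ?thesis by linarith
  qed
  then have "(1 + m0) / 2 < m" "exp (- (g * d / p)) < m" by (auto simp: L_def)
  then have "ln (exp (- (g * d / p))) < ln m" using m by (subst ln_less_cancel_iff) auto
  then have "- (g * d / p) < ln m" by simp
  then have lnm: "p * - ln m < g * d" using p by (simp add: field_simps)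
  define D where "D = dmoment s"
  have "(1 - m0) / 2 \<le> (s - \<kappa> / 2) * D"
    using moment_increment_le[of "\<kappa> / 2" s] s s0 kappa_pos \<open>(1 + m0) / 2 < m\<close> by (simp add: m_def m0_def D_def)
  moreover have "0 < D"
  proof (rule ccontr)
    assume "\<not> 0 < D"
    then have "(s - \<kappa> / 2) * D \<le> 0" using s0 by (intro mult_nonneg_nonpos) auto
    then show False using \<open>(1 - m0) / 2 \<le> (s - \<kappa> / 2) * D\<close> m0 by simp
  qed
  then have "(s - \<kappa> / 2) * D \<le> (\<kappa> / 2) * D" using s by (intro mult_right_mono) auto
  ultimately have "g \<le> D" using kappa_pos by (simp add: g_def field_simps)
  define \<mu> where "\<mu> = D / m"
  have "D * m \<le> D * 1" using \<open>0 < D\<close> m by (intro mult_left_mono) auto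
  then have "D \<le> \<mu>" using m by (simp add: \<mu>_def field_simps)
  with \<open>g \<le> D\<close> have \<mu>: "g \<le> \<mu>" "0 < \<mu>" using g by auto
  define a where "a = \<mu> * (1 - \<epsilon>)"
  define b where "b = \<mu> * (1 + \<epsilon>)"
  have ab: "0 < a" "0 < b" using \<mu> \<epsilon> \<open>\<epsilon> < 1\<close> by (auto simp: a_def b_def)
  have "p * (s * b - ln m) < a"
  proof -
    have "p * (s * b) \<le> p * (\<kappa> * b)" using p s ab by (intro mult_left_mono mult_right_mono) auto
    moreover have "g * d \<le> \<mu> * d" using \<mu> d by (intro mult_right_mono) auto
    ultimately have "p * (s * b) + p * - ln m < p * (\<kappa> * b) + \<mu> * d" using lnm by linarith
    also have "\<dots> = a" by (simp add: a_def b_def d_def algebra_simps)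
    finally show ?thesis by (simp add: algebra_simps)
  qed
  have deriv: "DERIV moment s :> D" unfolding D_def using s s0 by (intro DERIV_moment)
  have Dm: "D = \<mu> * m" using m by (simp add: \<mu>_def)
  have "\<exists>d>0. \<forall>h>0. h < d \<longrightarrow> moment (s - (0 + h)) * exp ((0 + h) * a) < moment (s - 0) * exp (0 * a)"
  proof (rule DERIV_neg_dec_right)
    show "DERIV (\<lambda>h. moment (s - h) * exp (h * a)) 0 :> - D + m * a"
      using deriv by (auto intro!: derivative_eq_intros DERIV_chain2[of moment] simp: m_def)
    show "- D + m * a < 0" using m \<mu> \<epsilon> by (simp add: Dm a_def algebra_simps)
  qed
  then obtain d1 where d1: "0 < d1" "\<And>h. 0 < h \<Longrightarrow> h < d1 \<Longrightarrow> moment (s - h) * exp (h * a) < m"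
    by (auto simp: m_def)
  have "\<exists>d>0. \<forall>h>0. h < d \<longrightarrow> moment (s + (0 + h)) * exp (- ((0 + h) * b)) < moment (s + 0) * exp (- (0 * b))"
  proof (rule DERIV_neg_dec_right)
    show "DERIV (\<lambda>h. moment (s + h) * exp (- (h * b))) 0 :> D - m * b"
      using deriv by (auto intro!: derivative_eq_intros DERIV_chain2[of moment] simp: m_def)
    show "D - m * b < 0" using m \<mu> \<epsilon> by (simp add: Dm b_def algebra_simps)
  qed
  then obtain d2 where d2: "0 < d2" "\<And>h. 0 < h \<Longrightarrow> h < d2 \<Longrightarrow> moment (s + h) * exp (- (h * b)) < m"
    by (auto simp: m_def)
  obtain h where h: "0 < h" "h < min (min d1 d2) (min s (\<kappa> - s))"
    using dense[of 0 "min (min d1 d2) (min s (\<kappa> - s))"] d1(1) d2(1) s s0 by auto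
  show ?thesis
    by (rule that[of s h a b]) (use s s0 h ab d1 d2 \<open>p * (s * b - ln m) < a\<close> in \<open>auto simp: m_def\<close>)
qed

end

context iid_ratios
begin

lemma expectation_exp_sum:
  assumes "finite I" "0 \<le> t" "t \<le> \<kappa>"
  shows "integrable M (\<lambda>x. exp (t * (\<Sum>i\<in>I. ln (R i x))))"
    and "expectation (\<lambda>x. exp (t * (\<Sum>i\<in>I. ln (R i x)))) = moment t ^ card I"
proof -
  have "(\<integral>\<^sup>+x. ennreal (exp (t * (\<Sum>i\<in>I. ln (R i x)))) \<partial>M) = (\<integral>\<^sup>+x. (\<Prod>i\<in>I. ennreal (R i x powr t)) \<partial>M)"
  proof (rule nn_integral_cong)
    fix x assume x: "x \<in> space M"
    have "exp (t * (\<Sum>i\<in>I. ln (R i x))) = (\<Prod>i\<in>I. R i x powr t)"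
      using pos[OF x] \<open>finite I\<close> by (simp add: sum_distrib_left exp_sum powr_def less_imp_neq[symmetric])
    then show "ennreal (exp (t * (\<Sum>i\<in>I. ln (R i x)))) = (\<Prod>i\<in>I. ennreal (R i x powr t))"
      by (simp add: prod_ennreal)
  qed
  also have "\<dots> = (\<Prod>i\<in>I. \<integral>\<^sup>+x. ennreal (R 0 x powr t) \<partial>M)"
    using \<open>finite I\<close> by (rule nn_integral_prod_R[where g = "\<lambda>_ y. ennreal (y powr t)"]) measurable
  also have "\<dots> = ennreal (moment t ^ card I)"
    using assms moment_pos[of t] by (simp add: nn_integral_moment ennreal_power)
  finally have "integrable M (\<lambda>x. exp (t * (\<Sum>i\<in>I. ln (R i x)))) \<and>
      expectation (\<lambda>x. exp (t * (\<Sum>i\<in>I. ln (R i x)))) = moment t ^ card I"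
    using moment_pos[OF assms(2,3)] by (subst (asm) nn_integral_eq_integrable) (auto intro: zero_le_power)
  then show "integrable M (\<lambda>x. exp (t * (\<Sum>i\<in>I. ln (R i x))))"
    and "expectation (\<lambda>x. exp (t * (\<Sum>i\<in>I. ln (R i x)))) = moment t ^ card I" by auto
qed

text \<open>
  Cramer's lower bound without a change of measure: on \<open>a l \<le> S \<le> b l\<close> the weight \<open>exp (s S)\<close> is at
  most \<open>exp (s b l)\<close>, and off this event it is dominated by the weights of order \<open>s - h\<close> and \<open>s + h\<close>.
\<close>

lemma prob_sum_ge:
  assumes s: "0 < s" "s < \<kappa>" and h: "0 < h" "h < s" "s + h < \<kappa>" and "finite I"
  shows "exp (- (s * b * card I)) * (moment s ^ card I - (moment (s - h) * exp (h * a)) ^ card I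
        - (moment (s + h) * exp (- (h * b))) ^ card I)
      \<le> prob {x \<in> space M. a * card I \<le> (\<Sum>i\<in>I. ln (R i x))}"
proof -
  define l where "l = real (card I)"
  define S where "S x = (\<Sum>i\<in>I. ln (R i x))" for x
  have [measurable]: "S \<in> borel_measurable M" unfolding S_def by measurable
  define E where "E t x = exp (t * S x)" for t x
  have E: "integrable M (E t)" "expectation (E t) = moment t ^ card I" if "0 \<le> t" "t \<le> \<kappa>" for t
    using expectation_exp_sum[OF \<open>finite I\<close> that] by (auto simp: E_def[abs_def] S_def)
  note int = E(1)[of s] E(1)[of "s - h"] E(1)[of "s + h"]
  define f where "f x = exp (- (s * b * l)) * (E s x - E (s - h) x * exp (h * a * l) - E (s + h) x * exp (- (h * b * l)))" for x
  have "expectation f \<le> expectation (indicator {x \<in> space M. a * l \<le> S x})"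
  proof (rule integral_mono)
    show "integrable M f" unfolding f_def using int s h by auto
    show "integrable M (indicator {x \<in> space M. a * l \<le> S x} :: 'a \<Rightarrow> real)"
      by (intro integrable_real_indicator) (auto simp: emeasure_eq_measure)
    fix x assume x: "x \<in> space M"
    have pos: "0 < E t x" for t by (simp add: E_def)
    show "f x \<le> indicator {x \<in> space M. a * l \<le> S x} x"
    proof (cases "a * l \<le> S x")
      case False
      have "E s x = E (s - h) x * exp (h * S x)"
        by (simp add: E_def exp_add[symmetric] algebra_simps)
      also have "\<dots> \<le> E (s - h) x * exp (h * a * l)"
        using False h pos[of "s - h"] by (intro mult_left_mono) (auto simp: mult.assoc)
      finally have "E s x - E (s - h) x * exp (h * a * l) - E (s + h) x * exp (- (h * b * l)) \<le> 0"
        using mult_pos_pos[OF pos[of "s + h"] exp_gt_zero[of "- (h * b * l)"]] by linarith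
      then have "f x \<le> 0" unfolding f_def by (intro mult_nonneg_nonpos) auto
      then show ?thesis using False by simp
    next
      case True
      have "f x \<le> 1"
      proof (cases "S x \<le> b * l")
        case True
        have "E s x \<le> exp (s * b * l)" using True s by (simp add: E_def mult.assoc)
        then have "E s x - E (s - h) x * exp (h * a * l) - E (s + h) x * exp (- (h * b * l)) \<le> exp (s * b * l)"
          using mult_pos_pos[OF pos[of "s + h"] exp_gt_zero[of "- (h * b * l)"]]
            mult_pos_pos[OF pos[of "s - h"] exp_gt_zero[of "h * a * l"]] by linarith
        then have "f x \<le> exp (- (s * b * l)) * exp (s * b * l)" unfolding f_def by (intro mult_left_mono) auto
        then show ?thesis by (simp add: exp_add[symmetric])
      next
        case False
        have "E s x = E (s + h) x * exp (- (h * S x))"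
          by (simp add: E_def exp_add[symmetric] algebra_simps)
        also have "\<dots> \<le> E (s + h) x * exp (- (h * b * l))"
          using False h pos[of "s + h"] by (intro mult_left_mono) (auto simp: mult.assoc)
        finally have "E s x - E (s - h) x * exp (h * a * l) - E (s + h) x * exp (- (h * b * l)) \<le> 0"
          using mult_pos_pos[OF pos[of "s - h"] exp_gt_zero[of "h * a * l"]] by linarith
        then have "f x \<le> 0" unfolding f_def by (intro mult_nonneg_nonpos) auto
        then show ?thesis by simp
      qed
      then show ?thesis using True x by simp
    qed
  qed
  also have "\<dots> = prob {x \<in> space M. a * l \<le> S x}" by simp
  also have "expectation f = exp (- (s * b * l)) * (moment s ^ card I - moment (s - h) ^ card I * exp (h * a * l) - moment (s + h) ^ card I * exp (- (h * b * l)))"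
    unfolding f_def using int s h by (simp add: E)
  also have "exp (h * a * l) = exp (h * a) ^ card I"
    by (simp add: l_def exp_of_nat_mult[symmetric] mult_ac)
  also have "exp (- (h * b * l)) = exp (- (h * b)) ^ card I"
    by (simp add: l_def exp_of_nat_mult[symmetric] mult_ac)
  finally show ?thesis by (simp add: power_mult_distrib l_def S_def)
qed

lemma prob_all_sums_less:
  fixes K :: "nat \<Rightarrow> int set"
  assumes K: "\<And>j. finite (K j)" "disjoint_family_on K {..<N}"
    and q: "\<And>j. q \<le> prob {x \<in> space M. u \<le> (\<Sum>k\<in>K j. ln (R k x))}"
  shows "prob {x \<in> space M. \<forall>j<N. (\<Sum>k\<in>K j. ln (R k x)) < u} \<le> exp (- (q * real N))"
proof (cases "N = 0")
  case False
  define S where "S j x = (\<Sum>k\<in>K j. ln (R k x))" for j x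
  have [measurable]: "S j \<in> borel_measurable M" for j unfolding S_def by measurable
  have "indep_vars (\<lambda>j. borel) (\<lambda>j x. \<Sum>k\<in>K j. ln (restrict (\<lambda>i. R i x) (K j) k)) {..<N}"
    by (rule indep_vars_compose2[OF indep_vars_restrict[OF indep _ K(2)]]) auto
  then have indep_S: "indep_vars (\<lambda>j. borel) S {..<N}"
    unfolding S_def by (simp cong: sum.cong)
  have "{x \<in> space M. \<forall>j<N. S j x < u} = (\<Inter>j\<in>{..<N}. S j -` {..<u} \<inter> space M)"
    using False by auto
  then have "prob {x \<in> space M. \<forall>j<N. S j x < u} = (\<Prod>j<N. prob (S j -` {..<u} \<inter> space M))"
    using indep_varsD_finite[OF indep_S, of "\<lambda>_. {..<u}"] False by auto
  also have "\<dots> \<le> (\<Prod>j<N. exp (- q))"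
  proof (intro prod_mono conjI)
    fix j
    have "S j -` {..<u} \<inter> space M = space M - {x \<in> space M. u \<le> S j x}" by auto
    then have "prob (S j -` {..<u} \<inter> space M) = 1 - prob {x \<in> space M. u \<le> S j x}"
      by (simp add: prob_compl)
    also have "\<dots> \<le> 1 - q" using q[of j] by (simp add: S_def)
    also have "\<dots> \<le> exp (- q)" using exp_ge_add_one_self[of "- q"] by simp
    finally show "prob (S j -` {..<u} \<inter> space M) \<le> exp (- q)" .
  qed auto
  also have "\<dots> = exp (- (q * real N))" by (simp add: exp_of_nat_mult[symmetric] mult.commute)
  finally show ?thesis unfolding S_def .
qed simp

lemma AE_deep_traps:
  fixes b :: "nat \<Rightarrow> int"
  assumes rho: "\<And>x i. x \<in> space M \<Longrightarrow> rho (\<omega> x) i = R i x"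
    and tail: "integrable M (\<lambda>x. R 0 x powr \<kappa> * ln_plus (R 0 x))" and p: "0 < p" "p * \<kappa> < 1"
  shows "AE x in M. deep_traps (\<omega> x) b p"
proof -
  obtain s h a \<beta> where s: "0 < s" "s < \<kappa>" and h: "0 < h" "h < s" "s + h < \<kappa>" and ab: "0 < a" "0 < \<beta>"
    and tilt: "moment (s - h) * exp (h * a) < moment s" "moment (s + h) * exp (- (h * \<beta>)) < moment s"
    and rate: "p * (s * \<beta> - ln (moment s)) < a"
    using tilting_parameters[OF tail p] by metis
  define T where "T = s * \<beta> - ln (moment s)"
  have m: "0 < moment s" "moment s < 1" using moment_less_1[of s] moment_pos[of s] s by auto
  have "0 < s * \<beta>" "ln (moment s) < 0" using m s ab by (auto intro: ln_less_zero)
  then have T: "0 < T" unfolding T_def by linarith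
  have expT: "exp (- T) = moment s * exp (- (s * \<beta>))" using m by (simp add: T_def exp_diff exp_minus field_simps)
  have "\<forall>\<^sub>F l in sequentially. \<forall>I. finite I \<and> card I = l \<longrightarrow>
      exp (- T) ^ l / 2 \<le> prob {x \<in> space M. a * l \<le> (\<Sum>i\<in>I. ln (R i x))}"
  proof -
    define r1 where "r1 = moment (s - h) * exp (h * a) / moment s"
    define r2 where "r2 = moment (s + h) * exp (- (h * \<beta>)) / moment s"
    have "0 < moment (s - h)" "0 < moment (s + h)" using s h by (auto intro!: moment_pos)
    then have r: "0 \<le> r1" "r1 < 1" "0 \<le> r2" "r2 < 1" using m tilt by (auto simp: r1_def r2_def)
    have "\<forall>\<^sub>F l in sequentially. r1 ^ l < 1 / 4" "\<forall>\<^sub>F l in sequentially. r2 ^ l < 1 / 4"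
      using r by (intro order_tendstoD(2)[OF LIMSEQ_power_zero]; simp)+
    then show ?thesis
    proof eventually_elim
      case (elim l)
      show ?case
      proof (intro allI impI)
        fix I :: "int set" assume I: "finite I \<and> card I = l"
        have "moment s * r1 = moment (s - h) * exp (h * a)" "moment s * r2 = moment (s + h) * exp (- (h * \<beta>))"
          using m by (auto simp: r1_def r2_def)
        then have "exp (- (s * \<beta> * l)) * (moment s ^ l - (moment s * r1) ^ l - (moment s * r2) ^ l)
            \<le> prob {x \<in> space M. a * l \<le> (\<Sum>i\<in>I. ln (R i x))}"
          using prob_sum_ge[OF s h, of I \<beta> a] I by simp
        moreover have "exp (- (s * \<beta> * l)) * (moment s ^ l * (1 / 2))
            \<le> exp (- (s * \<beta> * l)) * (moment s ^ l * (1 - r1 ^ l - r2 ^ l))"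
          using elim m by (intro mult_left_mono) auto
        moreover have "exp (- (s * \<beta> * l)) * moment s ^ l = exp (- T) ^ l"
          unfolding expT power_mult_distrib by (simp add: exp_of_nat_mult[symmetric] mult_ac)
        ultimately show "exp (- T) ^ l / 2 \<le> prob {x \<in> space M. a * l \<le> (\<Sum>i\<in>I. ln (R i x))}"
          by (simp add: power_mult_distrib algebra_simps)
      qed
    qed
  qed
  then obtain L where L: "\<And>l I. L \<le> l \<Longrightarrow> finite I \<Longrightarrow> card I = l \<Longrightarrow>
      exp (- T) ^ l / 2 \<le> prob {x \<in> space M. a * l \<le> (\<Sum>i\<in>I. ln (R i x))}"
    unfolding eventually_sequentially by blast
  define c where "c = p / a"
  have c: "0 < c" using p ab by (simp add: c_def)
  have cT: "c * T < 1" using rate ab by (simp add: c_def T_def field_simps)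
  define l where "l m = nat \<lceil>c * ln (real m)\<rceil>" for m :: nat
  define N where "N m = (m - 1) div l m" for m
  define K where "K m j = {b m + int (j * l m) + 1..b m + int (j * l m) + int (l m)}" for m j
  define A where "A m = {x \<in> space M. \<forall>j<N m. (\<Sum>k\<in>K m j. ln (R k x)) < p * ln (real m)}" for m
  have [measurable]: "A m \<in> events" for m unfolding A_def by measurable
  have "\<forall>\<^sub>F x :: real in at_top. 2 * ln x \<le> exp (- T) / 2 * x powr (- (c * T)) * ((x - 1) / (c * ln x + 1) - 1)"
    using c T cT by real_asymp
  then have ev1: "\<forall>\<^sub>F m in sequentially. 2 * ln (real m) \<le> exp (- T) / 2 * real m powr (- (c * T)) * ((real m - 1) / (c * ln (real m) + 1) - 1)"
    by (rule eventually_compose_filterlim[OF _ filterlim_real_sequentially])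
  have "\<forall>\<^sub>F x :: real in at_top. real L + 1 \<le> c * ln x"
    using c by real_asymp
  then have ev2: "\<forall>\<^sub>F m in sequentially. real L + 1 \<le> c * ln (real m)"
    by (rule eventually_compose_filterlim[OF _ filterlim_real_sequentially])
  have prob_A: "\<forall>\<^sub>F m in sequentially. norm (prob (A m)) \<le> real m powr (- 2)"
    using ev1 ev2 eventually_ge_at_top[of 2]
  proof eventually_elim
    case (elim m)
    have lm: "c * ln (real m) \<le> real (l m)" "real (l m) \<le> c * ln (real m) + 1" "L \<le> l m" "0 < l m"
      using elim unfolding l_def by linarith+
    have u: "p * ln (real m) \<le> a * real (l m)"
      using lm(1) ab by (simp add: c_def field_simps)
    define q where "q = exp (- T) ^ l m / 2"
    have "prob (A m) \<le> exp (- (q * real (N m)))"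
      unfolding A_def
    proof (rule prob_all_sums_less)
      show "finite (K m j)" for j by (simp add: K_def)
      show "disjoint_family_on (K m) {..<N m}"
      proof -
        have "K m i \<inter> K m j = {}" if "i < j" for i j
        proof -
          have "i * l m + l m \<le> j * l m" using that by (metis Suc_leI mult.commute mult_Suc_right mult_le_mono1 add.commute)
          then have "int (i * l m) + int (l m) \<le> int (j * l m)" by linarith
          then show ?thesis by (auto simp: K_def)
        qed
        then show ?thesis unfolding disjoint_family_on_def by (metis Int_commute nat_neq_iff)
      qed
      show "q \<le> prob {x \<in> space M. p * ln (real m) \<le> (\<Sum>k\<in>K m j. ln (R k x))}" for j
      proof -
        have "q \<le> prob {x \<in> space M. a * real (l m) \<le> (\<Sum>k\<in>K m j. ln (R k x))}"
          unfolding q_def by (rule L) (use lm in \<open>auto simp: K_def\<close>)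
        also have "\<dots> \<le> prob {x \<in> space M. p * ln (real m) \<le> (\<Sum>k\<in>K m j. ln (R k x))}"
          using u by (intro finite_measure_mono) auto
        finally show ?thesis .
      qed
    qed
    also have "\<dots> \<le> exp (- (2 * ln (real m)))"
    proof -
      have "exp (- T) / 2 * real m powr (- (c * T)) \<le> q"
      proof -
        have "exp (- T) * real m powr (- (c * T)) = exp (- (T * (c * ln (real m) + 1)))"
          using elim by (simp add: powr_def exp_add[symmetric] algebra_simps)
        also have "\<dots> \<le> exp (- (T * real (l m)))" using lm T by simp
        also have "\<dots> = exp (- T) ^ l m" by (simp add: exp_of_nat_mult[symmetric] mult_ac)
        finally show ?thesis by (simp add: q_def)
      qed
      moreover have "(real m - 1) / (c * ln (real m) + 1) - 1 \<le> real (N m)"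
      proof -
        have "m - 1 < l m + l m * N m" unfolding N_def by (rule dividend_less_times_div[OF lm(4)])
        then have "real (m - 1) < real (l m + l m * N m)" by (simp only: of_nat_less_iff)
        then have "real m - 1 < real (l m) * (1 + real (N m))" using elim by (simp add: algebra_simps)
        also have "\<dots> \<le> (c * ln (real m) + 1) * (1 + real (N m))" using lm by (intro mult_right_mono) auto
        finally show ?thesis using lm by (simp add: field_simps)
      qed
      moreover have "0 \<le> real (N m)" by simp
      ultimately have "exp (- T) / 2 * real m powr (- (c * T)) * ((real m - 1) / (c * ln (real m) + 1) - 1) \<le> q * real (N m)"
        by (smt (verit) mult_mono mult_nonneg_nonpos mult_nonneg_nonneg powr_ge_zero exp_ge_zero divide_nonneg_nonneg)
      then show ?thesis using elim by simp
    qed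
    also have "\<dots> = real m powr (- 2)" using elim by (simp add: powr_def)
    finally show ?case by simp
  qed
  have "summable (\<lambda>m. prob (A m))"
    using prob_A by (rule summable_comparison_test_ev) (simp add: summable_real_powr_iff)
  then have "AE x in M. \<forall>\<^sub>F m in sequentially. x \<in> space M - A m"
    by (intro borel_cantelli_AE1) (auto simp: emeasure_eq_measure)
  then show ?thesis
    using AE_space
  proof eventually_elim
    case (elim x)
    show ?case
      unfolding deep_traps_def using elim(1) eventually_ge_at_top[of 1]
    proof eventually_elim
      case (elim m)
      then obtain j where j: "j < N m" "p * ln (real m) \<le> (\<Sum>k\<in>K m j. ln (R k x))"
        by (auto simp: A_def not_less)
      define i where "i = b m + int (j * l m)"
      have "(j + 1) * l m \<le> N m * l m" using j by (intro mult_right_mono) auto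
      also have "\<dots> \<le> m - 1" unfolding N_def by simp
      finally have "j * l m + l m + 1 \<le> m" using \<open>1 \<le> m\<close> by simp
      then have "int (j * l m) + int (l m) + 1 \<le> int m" by linarith
      moreover have "potential (\<omega> x) (i + int (l m)) - potential (\<omega> x) i = (\<Sum>k\<in>K m j. ln (R k x))"
        unfolding potential_diff K_def i_def using \<open>x \<in> space M\<close> by (simp add: rho)
      ultimately show ?case using j(2)
        by (intro exI[of _ i] exI[of _ "i + int (l m) + 1"]) (auto simp: i_def)
    qed
  qed
qed

end

section \<open>Slowdown exponents\<close>

locale iid_environment = iid_ratios M "\<lambda>i x. rho (\<omega> x) i" \<kappa> for M :: "'a measure" and \<omega> :: "'a \<Rightarrow> int \<Rightarrow> real" and \<kappa> +
  fixes \<epsilon> :: real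
  assumes environment: "x \<in> space M \<Longrightarrow> environment (\<omega> x)"
    and kappa_tail: "integrable M (\<lambda>x. rho (\<omega> x) 0 powr \<kappa> * ln_plus (rho (\<omega> x) 0))"
    and neg_moment: "0 < \<epsilon>" "integrable M (\<lambda>x. rho (\<omega> x) 0 powr (- \<epsilon>))"
begin

lemma AE_traps: "0 < p \<Longrightarrow> p < 1 / \<kappa> \<Longrightarrow> AE x in M. deep_traps (\<omega> x) b p"
  using AE_deep_traps[OF _ kappa_tail, of \<omega> p b] kappa_pos by (simp add: field_simps)

lemma AE_ellipticity: "1 < \<eta> \<Longrightarrow> AE x in M. ellipticity_bound (\<omega> x) \<eta>"
  using AE_ellipticity_bound[OF _ neg_moment] by simp

lemma resolvent_exponents:
  assumes "0 < a" "a < min 1 \<kappa>" "0 < b" "b / \<kappa> < 1 - t" "0 < t"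
  obtains p q \<sigma> where "0 < p" "0 < q" "b * p < \<sigma>" "\<sigma> < 1" "a * q < 1" "t < 1 - \<sigma>"
    "1 / \<kappa> < p" "1 / \<kappa> < q" "1 < q"
proof -
  obtain \<sigma> where \<sigma>: "b / \<kappa> < \<sigma>" "\<sigma> < 1 - t" using dense assms by blast
  then have "1 / \<kappa> < \<sigma> / b" using assms kappa_pos by (simp add: field_simps)
  then obtain p where p: "1 / \<kappa> < p" "p < \<sigma> / b" using dense by blast
  have "max 1 (1 / \<kappa>) < 1 / a" using assms kappa_pos by (auto simp: field_simps)
  then obtain q where q: "max 1 (1 / \<kappa>) < q" "q < 1 / a" using dense by blast
  have "0 < 1 / \<kappa>" using kappa_pos by simp
  then have "0 < p" "0 < q" "\<sigma> < 1" "t < 1 - \<sigma>" using p q \<sigma> assms by linarith+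
  moreover have "b * p < \<sigma>" "a * q < 1" using p q assms by (simp_all add: field_simps)
  ultimately show ?thesis using that[of p q \<sigma>] p q by simp
qed

lemma kappa_ratio:
  "0 < \<kappa> / (\<kappa> + 1)" "\<kappa> / (\<kappa> + 1) < 1" "\<kappa> / (\<kappa> + 1) < \<kappa>" "\<kappa> / (\<kappa> + 1) / \<kappa> = 1 - \<kappa> / (\<kappa> + 1)"
proof -
  have "\<kappa> + 1 \<noteq> 0" "0 < \<kappa> * \<kappa>" using kappa_pos by auto
  then show "0 < \<kappa> / (\<kappa> + 1)" "\<kappa> / (\<kappa> + 1) < 1" "\<kappa> / (\<kappa> + 1) < \<kappa>" "\<kappa> / (\<kappa> + 1) / \<kappa> = 1 - \<kappa> / (\<kappa> + 1)"
    using kappa_pos by (simp_all add: divide_simps)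
qed

lemma AE_hitting_reflect_upper:
  assumes "0 < b" "b < min 1 \<kappa>" "b / \<kappa> < 1 - t" "0 < t"
  shows "AE x in M. \<forall>\<^sub>F n in sequentially.
    survive (reflect_env (\<omega> x)) (- {\<lfloor>real n powr b\<rfloor>}) (- {\<lfloor>real n powr b\<rfloor>}) n 0 \<le> exp (- (real n powr t))"
proof -
  obtain p q \<sigma> where pq: "0 < p" "0 < q" "b * p < \<sigma>" "\<sigma> < 1" "b * q < 1" "t < 1 - \<sigma>"
    "1 / \<kappa> < p" "1 / \<kappa> < q" "1 < q"
    using resolvent_exponents[of b b t] assms by metis
  have "AE x in M. resolvent_bound (\<omega> x) p q" using pq by (intro AE_resolvent_bound) auto
  then show ?thesis
    using AE_space
  proof eventually_elim
    case (elim x)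
    interpret environment "\<omega> x" using elim(2) by (rule environment)
    show ?case
      by (rule survive_reflect_asymp[OF elim(1), where \<sigma> = \<sigma>]) (use pq assms in auto)
  qed
qed

lemma AE_hitting_env_upper:
  assumes "0 < a" "a \<le> b" "a < min 1 \<kappa>" "b / \<kappa> < 1 - t" "0 < t" "t < b"
  shows "AE x in M. \<forall>\<^sub>F n in sequentially.
    survive (\<omega> x) (- {\<lfloor>real n powr a\<rfloor>}) (- {\<lfloor>real n powr a\<rfloor>}) n 0 \<le> exp (- (real n powr t))"
proof -
  obtain p q \<sigma> where pq: "0 < p" "0 < q" "b * p < \<sigma>" "\<sigma> < 1" "a * q < 1" "t < 1 - \<sigma>"
    "1 / \<kappa> < p" "1 / \<kappa> < q" "1 < q"
    using resolvent_exponents[of a b t] less_le_trans[OF assms(1,2)] assms by metis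
  have "AE x in M. resolvent_bound (\<omega> x) p q" using pq by (intro AE_resolvent_bound) auto
  moreover have "AE x in M. potential_drift (\<omega> x)" by (rule AE_potential_drift) simp
  ultimately show ?thesis
    using AE_space
  proof eventually_elim
    case (elim x)
    interpret environment "\<omega> x" using elim(3) by (rule environment)
    show ?case
      by (rule survive_env_asymp[OF elim(1,2), where \<sigma> = \<sigma> and b = b]) (use pq assms in auto)
  qed
qed

lemma AE_position_upper:
  assumes \<nu>: "0 < \<nu>" "\<nu> < min 1 \<kappa>" and t: "0 < t" "t < min (1 - \<nu> / \<kappa>) (\<kappa> / (\<kappa> + 1))"
    and e': "e' = (\<lambda>x. \<omega> x) \<or> e' = (\<lambda>x. reflect_env (\<omega> x))"
  shows "AE x in M. \<forall>\<^sub>F n in sequentially.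
    survive (e' x) UNIV {y. real_of_int y < real n powr \<nu>} n 0 \<le> exp (- (real n powr t))"
proof -
  define a where "a = \<kappa> / (\<kappa> + 1)"
  have a: "0 < a" "a < 1" "a < \<kappa>" "a / \<kappa> = 1 - a"
    using kappa_ratio by (auto simp: a_def)
  obtain t' where t': "t < t'" "t' < min (1 - \<nu> / \<kappa>) a" using t dense unfolding a_def by blast
  have "a = \<kappa> * (1 - a)" using a(4) kappa_pos by (simp add: field_simps)
  also have "\<dots> < \<kappa> * (1 - t')" using t' kappa_pos by simp
  finally have "a < \<kappa> * (1 - t')" .
  moreover have "\<nu> < \<kappa> * (1 - t')" using t' kappa_pos by (simp add: field_simps)
  ultimately have "max \<nu> a < min (min 1 \<kappa>) (\<kappa> * (1 - t'))" using \<nu> a by auto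
  then obtain b where b: "max \<nu> a < b" "b < min (min 1 \<kappa>) (\<kappa> * (1 - t'))" using dense by blast
  then have b': "0 < b" "b < min 1 \<kappa>" "b / \<kappa> < 1 - t'" "\<nu> < b" "t' < b" "t < b"
    using \<nu> a t' kappa_pos by (auto simp: field_simps)
  have "1 < b / \<nu>" using b' \<nu> by simp
  then obtain \<eta> where \<eta>: "1 < \<eta>" "\<eta> < b / \<nu>" using dense by blast
  have "AE x in M. \<forall>\<^sub>F n in sequentially.
      survive (e' x) (- {\<lfloor>real n powr b\<rfloor>}) (- {\<lfloor>real n powr b\<rfloor>}) n 0 \<le> exp (- (real n powr t'))"
    using e' AE_hitting_reflect_upper[of b t'] AE_hitting_env_upper[of b b t'] b' t t' by auto
  moreover have "AE x in M. potential_drift (\<omega> x)" by (rule AE_potential_drift) simp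
  moreover have "AE x in M. ellipticity_bound (\<omega> x) \<eta>" using \<eta> by (intro AE_ellipticity)
  ultimately show ?thesis
    using AE_space
  proof eventually_elim
    case (elim x)
    interpret environment "\<omega> x" using elim(4) by (rule environment)
    show ?case
      by (rule position_asymp[OF elim(2,3) _ _ _ _ _ _ _ _ elim(1)])
        (use e' \<nu> b' \<eta> t t' in \<open>auto simp: field_simps\<close>)
  qed
qed

lemma AE_hitting_lower:
  assumes "0 < \<nu>" "1 - \<nu> / \<kappa> < t" "0 < t" and e': "e' = (\<lambda>x. \<omega> x) \<or> e' = (\<lambda>x. reflect_env (\<omega> x))"
  shows "AE x in M. \<forall>\<^sub>F n in sequentially.
    exp (- (real n powr t)) \<le> survive (e' x) (- {\<lfloor>real n powr \<nu>\<rfloor>}) (- {\<lfloor>real n powr \<nu>\<rfloor>}) n 0"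
proof -
  have "max 0 ((1 - t) / \<nu>) < 1 / \<kappa>" using assms kappa_pos by (auto simp: field_simps)
  then obtain p where p: "max 0 ((1 - t) / \<nu>) < p" "p < 1 / \<kappa>" using dense by blast
  have "AE x in M. deep_traps (\<omega> x) (\<lambda>_. 0) p" using p by (intro AE_traps) auto
  then show ?thesis
    using AE_space
  proof eventually_elim
    case (elim x)
    interpret environment "\<omega> x" using elim(2) by (rule environment)
    show ?case
      by (rule hitting_trap_asymp[OF elim(1)]) (use assms p in \<open>auto simp: field_simps\<close>)
  qed
qed

lemma lower_exponents:
  assumes "\<kappa> / (\<kappa> + 1) < t"
  obtains a p \<eta> where "0 < a" "a < 1" "0 < p" "p < 1 / \<kappa>" "1 < \<eta>" "1 - a * p < t" "a * \<eta> < t" "a < t"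
proof -
  define a where "a = \<kappa> / (\<kappa> + 1)"
  have a: "0 < a" "a < 1" "a / \<kappa> = 1 - a" "a < t" using assms kappa_ratio by (auto simp: a_def)
  have "1 - t < a / \<kappa>" using a by simp
  then have "(1 - t) / a < 1 / \<kappa>" using a(1) kappa_pos by (simp add: field_simps)
  then have "max 0 ((1 - t) / a) < 1 / \<kappa>" using kappa_pos by simp
  then obtain p where p: "max 0 ((1 - t) / a) < p" "p < 1 / \<kappa>" using dense by blast
  have "1 < t / a" using a by simp
  then obtain \<eta> where \<eta>: "1 < \<eta>" "\<eta> < t / a" using dense by blast
  show ?thesis using that[of a p \<eta>] a p \<eta> by (auto simp: field_simps)
qed

lemma AE_hitting_env_lower:
  assumes "0 < \<nu>" "\<kappa> / (\<kappa> + 1) < t"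
  shows "AE x in M. \<forall>\<^sub>F n in sequentially.
    exp (- (real n powr t)) \<le> survive (\<omega> x) (- {\<lfloor>real n powr \<nu>\<rfloor>}) (- {\<lfloor>real n powr \<nu>\<rfloor>}) n 0"
proof -
  obtain a p \<eta> where ap: "0 < a" "a < 1" "0 < p" "p < 1 / \<kappa>" "1 < \<eta>" "1 - a * p < t" "a * \<eta> < t" "a < t"
    using lower_exponents[OF assms(2)] by metis
  have "AE x in M. deep_traps (\<omega> x) (\<lambda>m. - int m) p" using ap by (intro AE_traps)
  moreover have "AE x in M. ellipticity_bound (\<omega> x) \<eta>" using ap by (intro AE_ellipticity)
  ultimately show ?thesis
    using AE_space
  proof eventually_elim
    case (elim x)
    interpret environment "\<omega> x" using elim(3) by (rule environment)
    show ?case by (rule hitting_left_trap_asymp[OF elim(1,2), where a = a]) (use assms ap in auto)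
  qed
qed

lemma AE_position_reflect_lower:
  assumes "0 < \<nu>" "\<kappa> / (\<kappa> + 1) < t"
  shows "AE x in M. \<forall>\<^sub>F n in sequentially.
    exp (- (real n powr t)) \<le> survive (reflect_env (\<omega> x)) UNIV {y. real_of_int y < real n powr \<nu>} n 0"
proof -
  obtain a p \<eta> where ap: "0 < a" "a < 1" "0 < p" "p < 1 / \<kappa>" "1 < \<eta>" "1 - a * p < t" "a * \<eta> < t" "a < t"
    using lower_exponents[OF assms(2)] by metis
  have "AE x in M. deep_traps (\<omega> x) (\<lambda>_. 0) p" using ap by (intro AE_traps)
  moreover have "AE x in M. ellipticity_bound (\<omega> x) \<eta>" using ap by (intro AE_ellipticity)
  ultimately show ?thesis
    using AE_space
  proof eventually_elim
    case (elim x)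
    interpret environment "\<omega> x" using elim(3) by (rule environment)
    show ?case by (rule position_return_asymp[OF elim(1,2), where a = a]) (use assms ap in auto)
  qed
qed

lemma AE_position_lower_from_hitting:
  assumes "0 < \<nu>" and e': "e' = (\<lambda>x. \<omega> x) \<or> e' = (\<lambda>x. reflect_env (\<omega> x))"
    and hit: "AE x in M. \<forall>\<^sub>F n in sequentially.
      exp (- (real n powr t)) \<le> survive (e' x) (- {\<lfloor>real n powr \<nu>\<rfloor>}) (- {\<lfloor>real n powr \<nu>\<rfloor>}) n 0"
  shows "AE x in M. \<forall>\<^sub>F n in sequentially.
      exp (- (real n powr t)) \<le> survive (e' x) UNIV {y. real_of_int y < real n powr \<nu>} n 0"
  using hit AE_space
proof eventually_elim
  case (elim x)
  interpret environment "\<omega> x" using elim(2) by (rule environment)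
  have range: "0 \<le> e' x y" "e' x y \<le> 1" for y using e' env_le by auto
  show ?case
    using elim(1) eventually_ge_at_top[of 1]
  proof eventually_elim
    case (elim n)
    have "survive (e' x) (- {\<lfloor>real n powr \<nu>\<rfloor>}) (- {\<lfloor>real n powr \<nu>\<rfloor>}) n 0
        \<le> survive (e' x) UNIV {y. real_of_int y < real n powr \<nu>} n 0"
      using floor_powr_bounds[of n \<nu>] elim \<open>0 < \<nu>\<close>
      by (intro survive_hitting_le_position range) (auto simp: less_floor_iff)
    then show ?case using elim by simp
  qed
qed

theorem slowdown_exponents:
  assumes \<nu>: "0 < \<nu>" "\<nu> < min 1 \<kappa>"
  defines "\<theta> \<equiv> min (1 - \<nu> / \<kappa>) (\<kappa> / (\<kappa> + 1))"
  shows "AE x in M. (\<lambda>n. ln (- ln (survive (reflect_env (\<omega> x)) (- {\<lfloor>real n powr \<nu>\<rfloor>}) (- {\<lfloor>real n powr \<nu>\<rfloor>}) n 0)) / ln (real n))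
      \<longlonglongrightarrow> 1 - \<nu> / \<kappa>"
    and "AE x in M. (\<lambda>n. ln (- ln (survive (reflect_env (\<omega> x)) UNIV {y. real_of_int y < real n powr \<nu>} n 0)) / ln (real n)) \<longlonglongrightarrow> \<theta>"
    and "AE x in M. (\<lambda>n. ln (- ln (survive (\<omega> x) (- {\<lfloor>real n powr \<nu>\<rfloor>}) (- {\<lfloor>real n powr \<nu>\<rfloor>}) n 0)) / ln (real n)) \<longlonglongrightarrow> \<theta>"
    and "AE x in M. (\<lambda>n. ln (- ln (survive (\<omega> x) UNIV {y. real_of_int y < real n powr \<nu>} n 0)) / ln (real n)) \<longlonglongrightarrow> \<theta>"
proof -
  have \<nu>\<kappa>: "0 < 1 - \<nu> / \<kappa>" using \<nu> kappa_pos by simp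
  then have \<theta>: "0 < \<theta>" using kappa_pos by (simp add: \<theta>_def)
  show "AE x in M. (\<lambda>n. ln (- ln (survive (reflect_env (\<omega> x)) (- {\<lfloor>real n powr \<nu>\<rfloor>}) (- {\<lfloor>real n powr \<nu>\<rfloor>}) n 0)) / ln (real n))
      \<longlonglongrightarrow> 1 - \<nu> / \<kappa>"
  proof (rule AE_log_log_tendsto[OF \<nu>\<kappa>])
    fix t assume "1 - \<nu> / \<kappa> < t"
    moreover from this have "0 < t" using \<nu>\<kappa> by linarith
    ultimately show "AE x in M. \<forall>\<^sub>F n in sequentially. exp (- (real n powr t))
        \<le> survive (reflect_env (\<omega> x)) (- {\<lfloor>real n powr \<nu>\<rfloor>}) (- {\<lfloor>real n powr \<nu>\<rfloor>}) n 0"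
      using \<nu> by (intro AE_hitting_lower) auto
  next
    fix t assume "0 < t" "t < 1 - \<nu> / \<kappa>"
    then show "AE x in M. \<forall>\<^sub>F n in sequentially.
        survive (reflect_env (\<omega> x)) (- {\<lfloor>real n powr \<nu>\<rfloor>}) (- {\<lfloor>real n powr \<nu>\<rfloor>}) n 0 \<le> exp (- (real n powr t))"
      using \<nu> by (intro AE_hitting_reflect_upper) auto
  qed
  have hit: "AE x in M. \<forall>\<^sub>F n in sequentially. exp (- (real n powr t))
      \<le> survive (\<omega> x) (- {\<lfloor>real n powr \<nu>\<rfloor>}) (- {\<lfloor>real n powr \<nu>\<rfloor>}) n 0" if "\<theta> < t" for t
  proof (cases "1 - \<nu> / \<kappa> < t")
    case True
    moreover from this have "0 < t" using \<nu>\<kappa> by linarith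
    ultimately show ?thesis using \<nu> by (intro AE_hitting_lower) auto
  next
    case False
    then show ?thesis using \<nu> that by (intro AE_hitting_env_lower) (auto simp: \<theta>_def)
  qed
  show "AE x in M. (\<lambda>n. ln (- ln (survive (\<omega> x) (- {\<lfloor>real n powr \<nu>\<rfloor>}) (- {\<lfloor>real n powr \<nu>\<rfloor>}) n 0)) / ln (real n)) \<longlonglongrightarrow> \<theta>"
  proof (rule AE_log_log_tendsto[OF \<theta> hit])
    fix t assume t: "0 < t" "t < \<theta>"
    define a where "a = \<kappa> / (\<kappa> + 1)"
    have a: "0 < a" "a < 1" "a < \<kappa>" "a / \<kappa> = 1 - a" "t < a" "t < 1 - \<nu> / \<kappa>"
      using kappa_ratio t by (auto simp: a_def \<theta>_def)
    have "max \<nu> a / \<kappa> < 1 - t" using a kappa_pos by (cases "\<nu> \<le> a") (auto simp: max_def)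
    then show "AE x in M. \<forall>\<^sub>F n in sequentially.
        survive (\<omega> x) (- {\<lfloor>real n powr \<nu>\<rfloor>}) (- {\<lfloor>real n powr \<nu>\<rfloor>}) n 0 \<le> exp (- (real n powr t))"
      using \<nu> a t by (intro AE_hitting_env_upper[of \<nu> "max \<nu> a"]) auto
  qed
  show "AE x in M. (\<lambda>n. ln (- ln (survive (\<omega> x) UNIV {y. real_of_int y < real n powr \<nu>} n 0)) / ln (real n)) \<longlonglongrightarrow> \<theta>"
  proof (rule AE_log_log_tendsto[OF \<theta>])
    fix t assume "\<theta> < t"
    then show "AE x in M. \<forall>\<^sub>F n in sequentially. exp (- (real n powr t))
        \<le> survive (\<omega> x) UNIV {y. real_of_int y < real n powr \<nu>} n 0"
      using \<nu> hit[of t] by (intro AE_position_lower_from_hitting) auto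
  next
    fix t assume "0 < t" "t < \<theta>"
    then show "AE x in M. \<forall>\<^sub>F n in sequentially.
        survive (\<omega> x) UNIV {y. real_of_int y < real n powr \<nu>} n 0 \<le> exp (- (real n powr t))"
      using \<nu> by (intro AE_position_upper) (auto simp: \<theta>_def)
  qed
  show "AE x in M. (\<lambda>n. ln (- ln (survive (reflect_env (\<omega> x)) UNIV {y. real_of_int y < real n powr \<nu>} n 0)) / ln (real n)) \<longlonglongrightarrow> \<theta>"
  proof (rule AE_log_log_tendsto[OF \<theta>])
    fix t assume t: "\<theta> < t"
    show "AE x in M. \<forall>\<^sub>F n in sequentially. exp (- (real n powr t))
        \<le> survive (reflect_env (\<omega> x)) UNIV {y. real_of_int y < real n powr \<nu>} n 0"
    proof (cases "1 - \<nu> / \<kappa> < t")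
      case True
      moreover from this have "0 < t" using \<nu>\<kappa> by linarith
      ultimately have "AE x in M. \<forall>\<^sub>F n in sequentially. exp (- (real n powr t))
          \<le> survive (reflect_env (\<omega> x)) (- {\<lfloor>real n powr \<nu>\<rfloor>}) (- {\<lfloor>real n powr \<nu>\<rfloor>}) n 0"
        using \<nu> by (intro AE_hitting_lower) auto
      then show ?thesis using \<nu> by (intro AE_position_lower_from_hitting) auto
    next
      case False
      then show ?thesis using \<nu> t by (intro AE_position_reflect_lower) (auto simp: \<theta>_def)
    qed
  next
    fix t assume "0 < t" "t < \<theta>"
    then show "AE x in M. \<forall>\<^sub>F n in sequentially.
        survive (reflect_env (\<omega> x)) UNIV {y. real_of_int y < real n powr \<nu>} n 0 \<le> exp (- (real n powr t))"
      using \<nu> by (intro AE_position_upper) (auto simp: \<theta>_def)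
  qed
qed

end

theorem theorem1p2:
  fixes M :: "'a measure"
    and \<omega> :: "'a \<Rightarrow> int \<Rightarrow> real"
    and \<kappa> \<nu> :: real
  assumes "prob_space M"
    and indep: "prob_space.indep_vars M (\<lambda>_. borel) (\<lambda>i x. \<omega> x i) UNIV"
    and ident: "\<And>i. distr M borel (\<lambda>x. \<omega> x i) = distr M borel (\<lambda>x. \<omega> x 0)"
    and range: "\<And>i x. x \<in> space M \<Longrightarrow> 0 < \<omega> x i \<and> \<omega> x i < 1"
    and transient: "prob_space.expectation M (\<lambda>x. ln (rho (\<omega> x) 0)) < 0"
    and kappa: "\<kappa> > 0"
      "integrable M (\<lambda>x. rho (\<omega> x) 0 powr \<kappa>)"
      "prob_space.expectation M (\<lambda>x. rho (\<omega> x) 0 powr \<kappa>) = 1"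
      "integrable M (\<lambda>x. rho (\<omega> x) 0 powr \<kappa> * ln_plus (rho (\<omega> x) 0))"
    and kappa_unique: "\<And>\<kappa>'. \<lbrakk>\<kappa>' > 0;
      integrable M (\<lambda>x. rho (\<omega> x) 0 powr \<kappa>');
      prob_space.expectation M (\<lambda>x. rho (\<omega> x) 0 powr \<kappa>') = 1;
      integrable M (\<lambda>x. rho (\<omega> x) 0 powr \<kappa>' * ln_plus (rho (\<omega> x) 0))\<rbrakk> \<Longrightarrow> \<kappa>' = \<kappa>"
    and neg_moment: "\<exists>\<epsilon>\<^sub>0>0. integrable M (\<lambda>x. rho (\<omega> x) 0 powr (- \<epsilon>\<^sub>0))"
    and nu: "0 < \<nu>" "\<nu> < min 1 \<kappa>"
  shows
    "(AE x in M. (\<lambda>n. ln (- ln (\<P>(X in quenched (reflect_env (\<omega> x)).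
          hitting_time \<lfloor>real n powr \<nu>\<rfloor> X > enat n))) / ln (real n))
        \<longlonglongrightarrow> 1 - \<nu> / \<kappa>)
   \<and> (AE x in M. (\<lambda>n. ln (- ln (\<P>(X in quenched (reflect_env (\<omega> x)).
          real_of_int (X n) < real n powr \<nu>))) / ln (real n))
        \<longlonglongrightarrow> min (1 - \<nu> / \<kappa>) (\<kappa> / (\<kappa> + 1)))
   \<and> (AE x in M. (\<lambda>n. ln (- ln (\<P>(X in quenched (\<omega> x).
          hitting_time \<lfloor>real n powr \<nu>\<rfloor> X > enat n))) / ln (real n))
        \<longlonglongrightarrow> min (1 - \<nu> / \<kappa>) (\<kappa> / (\<kappa> + 1)))
   \<and> (AE x in M. (\<lambda>n. ln (- ln (\<P>(X in quenched (\<omega> x).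
          real_of_int (X n) < real n powr \<nu>))) / ln (real n))
        \<longlonglongrightarrow> min (1 - \<nu> / \<kappa>) (\<kappa> / (\<kappa> + 1)))"
proof -
  interpret prob_space M by fact
  obtain \<epsilon> where \<epsilon>: "0 < \<epsilon>" "integrable M (\<lambda>x. rho (\<omega> x) 0 powr (- \<epsilon>))" using neg_moment by blast
  have [measurable]: "(\<lambda>x. \<omega> x i) \<in> borel_measurable M" for i
    using indep unfolding indep_vars_def by auto
  have env: "environment (\<omega> x)" if "x \<in> space M" for x
    using range[OF that] by unfold_locales auto
  interpret iid_environment M \<omega> \<kappa> \<epsilon>
  proof (intro iid_environment.intro iid_ratios.intro iid_ratios_axioms.intro iid_environment_axioms.intro)
    show "indep_vars (\<lambda>_. borel) (\<lambda>i x. rho (\<omega> x) i) UNIV"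
      unfolding rho_def by (rule indep_vars_compose2[OF indep]) measurable
    show "distr M borel (\<lambda>x. rho (\<omega> x) i) = distr M borel (\<lambda>x. rho (\<omega> x) 0)" for i
    proof -
      have "distr M borel (\<lambda>x. rho (\<omega> x) j) = distr (distr M borel (\<lambda>x. \<omega> x j)) borel (\<lambda>w. (1 - w) / w)" for j
        by (subst distr_distr) (auto simp: rho_def comp_def)
      then show ?thesis using ident[of i] by simp
    qed
    show "0 < rho (\<omega> x) i" if "x \<in> space M" for x i
      using environment.rho_pos[OF env[OF that]] .
  qed (fact prob_space_axioms transient kappa env \<epsilon>)+
  have hit: "\<P>(X in quenched (\<omega> x). hitting_time \<lfloor>real n powr \<nu>\<rfloor> X > enat n)
      = survive (\<omega> x) (- {\<lfloor>real n powr \<nu>\<rfloor>}) (- {\<lfloor>real n powr \<nu>\<rfloor>}) n 0"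
    "\<P>(X in quenched (reflect_env (\<omega> x)). hitting_time \<lfloor>real n powr \<nu>\<rfloor> X > enat n)
      = survive (reflect_env (\<omega> x)) (- {\<lfloor>real n powr \<nu>\<rfloor>}) (- {\<lfloor>real n powr \<nu>\<rfloor>}) n 0"
    "\<P>(X in quenched (\<omega> x). real_of_int (X n) < real n powr \<nu>)
      = survive (\<omega> x) UNIV {y. real_of_int y < real n powr \<nu>} n 0"
    "\<P>(X in quenched (reflect_env (\<omega> x)). real_of_int (X n) < real n powr \<nu>)
      = survive (reflect_env (\<omega> x)) UNIV {y. real_of_int y < real n powr \<nu>} n 0"
    if "x \<in> space M" for x n
    using environment.env_le[OF env[OF that]]
    by (intro prob_hitting_time_greater prob_position_less; simp)+
  show ?thesis
  proof (intro conjI)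
  qed (use slowdown_exponents[OF nu] AE_space in \<open>eventually_elim; simp add: hit\<close>)+
qed

end
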